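(* Let $k$ be an algebraically closed field and let $\Lambda=kQ/I$ be a gentle $k$-algebra which is Gorenstein of dimension at most one and such that $\Omega^2\tau M\simeq M$ for all $M\in\underline{\mathrm{CM}}(\Lambda)$. Then the bound quiver $(Q,I)$ is gentle-block-decomposable, i.e. it is obtained via block decomposition by matching blocks of type I, type II and type loop.
   Context: All algebras are finite-dimensional basic $k$-algebras $kQ/I$, where $Q=(Q_0,Q_1)$ is a finite quiver with source and target maps $s,t:Q_1\to Q_0$ and $I$ is an admissible ideal; $(Q,I)$ is called a bound quiver. The path $\alpha\beta$ means $\alpha$ followed by $\beta$ ($t(\alpha)=s(\beta)$). Modules are finitely generated. Gentle algebra: $\Lambda=kQ/I$ is gentle if (G1) each vertex is the source of at most two arrows and the target of at most two arrows; (G2) $I$ is generated by paths of length $2$; (G3) for each arrow $\beta$ there is at most one arrow $\alpha$ with $t(\alpha)=s(\beta)$ and $\alpha\beta\in I$, and at most one arrow $\gamma$ with $t(\beta)=s(\gamma)$ and $\beta\gamma\in I$; (G4) for each arrow $\beta$ there is at most one arrow $\alpha$ with $t(\alpha)=s(\beta)$ and $\alpha\beta\notin I$, and at most one arrow $\gamma$ with $t(\beta)=s(\gamma)$ and $\beta\gamma\notin I$. Gorenstein: $\Lambda$ is Gorenstein of dimension $d$ if $\mathrm{inj.dim}\,\Lambda=\mathrm{proj.dim}\,D(\Lambda^{op})=d$ for a non-negative integer $d$, where $D=\mathrm{Hom}_k(-,k)$. Stable Cohen-Macaulay modules: $\mathrm{CM}(\Lambda)=\{M:\mathrm{Ext}^i_\Lambda(M,\Lambda)=0\text{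 for all }i>0\}$, and $\underline{\mathrm{CM}}(\Lambda)=\mathrm{CM}(\Lambda)/(\mathcal P)$, where $(\mathcal P)$ is the ideal of morphisms factoring through a projective $\Lambda$-module. When a module $M$ is said to lie in $\underline{\mathrm{CM}}(\Lambda)$ and is compared with another module, $M$ is taken to be a module in $\mathrm{CM}(\Lambda)$ without nonzero projective direct summands. $\Omega$ is the syzygy operator (kernel of a projective cover) and $\tau$ is the Auslander-Reiten translation. Blocks: a block of type I is a single arrow $\lambda$ between two distinct vertices, with no relations; a block of type II is an oriented $3$-cycle on three distinct vertices with arrows $\alpha,\beta,\gamma$ ($t(\alpha)=s(\beta)$, $t(\beta)=s(\gamma)$, $t(\gamma)=s(\alpha)$) and relations $\alpha\beta=\beta\gamma=\gamma\alpha=0$; a block of type loop is a single vertex with one loop $\delta$ and the relation $\delta^2=0$. All vertices of all blocks are called outlets. Gentle-block-decomposable: a bound quiver $(Q,I)$ is gentle-block-decomposable if it is obtained from a collection of disjoint blocks as follows. Take a partial matching of the combined set of outlets such that (1) no outlet is matched to itself or to another outlet of the same block, and (2) no two outlets belonging to different blocks of type loop are matched. Identify the two vertices in each pair of the matching; after this gluing, having a pair of arrows connecting the same pair of vertices in opposite directions is not allowed. The ideal $I$ is generated by the relations of the blocks.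
   Formalization: It is additionally assumed that every vertex of Q is the source or target of some arrow; without this the claim fails for Λ = k (one vertex, no arrows), since no block contains an isolated vertex. *)

theory Defs
  imports
    "HOL-Computational_Algebra.Polynomial"
    "HOL-Library.Extended_Nat"
    "Graph_Theory.Digraph_Isomorphism"
    "HOL-Algebra.Module"
    "HOL-Algebra.QuotRing"
    "HOL-Algebra.Ideal_Product"
begin

text \<open>
  A \<open>k\<close>-algebra is a record of type \<^typ>\<open>('k, 'a) module\<close>: the ring operations together with the
  scalar multiplication by \<open>k\<close>. A module over it uses the same record type with scalars from
  \<^typ>\<open>'a\<close>; its fields \<^const>\<open>mult\<close> and \<^const>\<open>one\<close> carry no meaning. The locale \<^locale>\<open>module\<close> of
  the library requires commutative scalars, hence the following variant. All modules are left
  modules; right modules are left modules over the opposite algebra.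
\<close>

locale left_module = R?: ring R + M?: abelian_group M
  for R :: "('a, 'y) ring_scheme" (structure) and M :: "('a, 'm, 'z) module_scheme" (structure) +
  assumes smult_closed: "\<lbrakk>a \<in> carrier R; x \<in> carrier M\<rbrakk> \<Longrightarrow> a \<odot>\<^bsub>M\<^esub> x \<in> carrier M"
    and smult_l_distr: "\<lbrakk>a \<in> carrier R; b \<in> carrier R; x \<in> carrier M\<rbrakk> \<Longrightarrow>
      (a \<oplus>\<^bsub>R\<^esub> b) \<odot>\<^bsub>M\<^esub> x = a \<odot>\<^bsub>M\<^esub> x \<oplus>\<^bsub>M\<^esub> b \<odot>\<^bsub>M\<^esub> x"
    and smult_r_distr: "\<lbrakk>a \<in> carrier R; x \<in> carrier M; y \<in> carrier M\<rbrakk> \<Longrightarrow>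
      a \<odot>\<^bsub>M\<^esub> (x \<oplus>\<^bsub>M\<^esub> y) = a \<odot>\<^bsub>M\<^esub> x \<oplus>\<^bsub>M\<^esub> a \<odot>\<^bsub>M\<^esub> y"
    and smult_assoc: "\<lbrakk>a \<in> carrier R; b \<in> carrier R; x \<in> carrier M\<rbrakk> \<Longrightarrow>
      (a \<otimes>\<^bsub>R\<^esub> b) \<odot>\<^bsub>M\<^esub> x = a \<odot>\<^bsub>M\<^esub> (b \<odot>\<^bsub>M\<^esub> x)"
    and smult_one: "x \<in> carrier M \<Longrightarrow> \<one>\<^bsub>R\<^esub> \<odot>\<^bsub>M\<^esub> x = x"

definition fg_module :: "('k, 'a) module \<Rightarrow> ('a, 'm) module \<Rightarrow> bool" where
  "fg_module A M \<longleftrightarrow> left_module A M \<and>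
     (\<exists>S. finite S \<and> S \<subseteq> carrier M \<and> (\<forall>N. submodule N A M \<and> S \<subseteq> N \<longrightarrow> N = carrier M))"

text \<open>
  Quantification over all finitely generated modules needs a fixed type of elements. Such a module
  over a finite-dimensional algebra is finite-dimensional over \<open>k\<close>, so it is isomorphic to one whose
  elements have type \<^typ>\<open>nat \<Rightarrow> 'k\<close> (the carrier and the operations being arbitrary).
\<close>

type_synonym ('k, 'a) fgmod = "('a, nat \<Rightarrow> 'k) module"

definition lhom :: "('k, 'a) module \<Rightarrow> ('a, 'm) module \<Rightarrow> ('a, 'n) module \<Rightarrow> ('m \<Rightarrow> 'n) set" where
  "lhom A M N = {f \<in> carrier M \<rightarrow>\<^sub>E carrier N.
     (\<forall>x\<in>carrier M. \<forall>y\<in>carrier M. f (x \<oplus>\<^bsub>M\<^esub> y) = f x \<oplus>\<^bsub>N\<^esub> f y) \<and>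
     (\<forall>a\<in>carrier A. \<forall>x\<in>carrier M. f (a \<odot>\<^bsub>M\<^esub> x) = a \<odot>\<^bsub>N\<^esub> f x)}"

definition lmod_iso :: "('k, 'a) module \<Rightarrow> ('a, 'm) module \<Rightarrow> ('a, 'n) module \<Rightarrow> bool" where
  "lmod_iso A M N \<longleftrightarrow> (\<exists>f\<in>lhom A M N. bij_betw f (carrier M) (carrier N))"

definition quot :: "('s, 'm) module \<Rightarrow> 'm set \<Rightarrow> ('s, 'm set) module"
  \<comment> \<open>used both for algebras modulo ideals and for modules modulo submodules\<close>
  where "quot M N = \<lparr>carrier = carrier (M Quot N), mult = mult (M Quot N), one = one (M Quot N),
     zero = zero (M Quot N), add = add (M Quot N),
     smult = (\<lambda>c U. \<Union>x\<in>U. N +>\<^bsub>M\<^esub> (c \<odot>\<^bsub>M\<^esub> x))\<rparr>"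

definition opp :: "('k, 'a) module \<Rightarrow> ('k, 'a) module" where
  "opp A = A\<lparr>mult := (\<lambda>x y. y \<otimes>\<^bsub>A\<^esub> x)\<rparr>"

definition regular :: "('k, 'a) module \<Rightarrow> ('a, 'a) module" where
  "regular A = \<lparr>carrier = carrier A, mult = mult A, one = one A, zero = zero A, add = add A,
     smult = mult A\<rparr>"

definition dual :: "('k::field, 'a) module \<Rightarrow> ('a, 'm) module \<Rightarrow> ('a, 'm \<Rightarrow> 'k) module"
  \<comment> \<open>\<open>D M = Hom\<^sub>k(M, k)\<close> as a module over \<^term>\<open>opp A\<close>; the scalar \<open>c\<close> acts on \<open>M\<close> as \<open>c \<cdot> 1\<^sub>A\<close>\<close>
  where "dual A M = \<lparr>
     carrier = {f \<in> carrier M \<rightarrow>\<^sub>E UNIV.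
       (\<forall>x\<in>carrier M. \<forall>y\<in>carrier M. f (x \<oplus>\<^bsub>M\<^esub> y) = f x + f y) \<and>
       (\<forall>c. \<forall>x\<in>carrier M. f ((c \<odot>\<^bsub>A\<^esub> \<one>\<^bsub>A\<^esub>) \<odot>\<^bsub>M\<^esub> x) = c * f x)},
     mult = undefined, one = undefined,
     zero = (\<lambda>x\<in>carrier M. 0),
     add = (\<lambda>f g. \<lambda>x\<in>carrier M. f x + g x),
     smult = (\<lambda>a f. \<lambda>x\<in>carrier M. f (a \<odot>\<^bsub>M\<^esub> x))\<rparr>"

definition hom_dual :: "('k, 'a) module \<Rightarrow> ('a, 'm) module \<Rightarrow> ('a, 'm \<Rightarrow> 'a) module"
  \<comment> \<open>\<open>Hom\<^sub>A(M, A)\<close> as a module over \<^term>\<open>opp A\<close>\<close>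
  where "hom_dual A M = \<lparr>
     carrier = lhom A M (regular A),
     mult = undefined, one = undefined,
     zero = (\<lambda>x\<in>carrier M. \<zero>\<^bsub>A\<^esub>),
     add = (\<lambda>f g. \<lambda>x\<in>carrier M. f x \<oplus>\<^bsub>A\<^esub> g x),
     smult = (\<lambda>a f. \<lambda>x\<in>carrier M. f x \<otimes>\<^bsub>A\<^esub> a)\<rparr>"

definition projective :: "('k, 'a) module \<Rightarrow> ('a, 'm) module \<Rightarrow> bool" where
  "projective A P \<longleftrightarrow> fg_module A P \<and>
     (\<forall>(U :: ('k, 'a) fgmod) (V :: ('k, 'a) fgmod) g f.
        fg_module A U \<and> fg_module A V \<and> g \<in> lhom A U V \<and> g ` carrier U = carrier V \<and>
        f \<in> lhom A P V \<longrightarrow> (\<exists>h\<in>lhom A P U. \<forall>x\<in>carrier P. g (h x) = f x))"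

definition injective :: "('k, 'a) module \<Rightarrow> ('a, 'm) module \<Rightarrow> bool" where
  "injective A J \<longleftrightarrow> fg_module A J \<and>
     (\<forall>(U :: ('k, 'a) fgmod) (V :: ('k, 'a) fgmod) g f.
        fg_module A U \<and> fg_module A V \<and> g \<in> lhom A U V \<and> inj_on g (carrier U) \<and>
        f \<in> lhom A U J \<longrightarrow> (\<exists>h\<in>lhom A V J. \<forall>x\<in>carrier U. h (g x) = f x))"

definition proj_resolution ::
  "('k, 'a) module \<Rightarrow> ('a, 'm) module \<Rightarrow> (nat \<Rightarrow> ('k, 'a) fgmod) \<Rightarrow>
    (nat \<Rightarrow> (nat \<Rightarrow> 'k) \<Rightarrow> (nat \<Rightarrow> 'k)) \<Rightarrow> ((nat \<Rightarrow> 'k) \<Rightarrow> 'm) \<Rightarrow> bool"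
  \<comment> \<open>\<open>\<dots> \<rightarrow> P 2 \<rightarrow> P 1 \<rightarrow> P 0 \<rightarrow> M \<rightarrow> 0\<close> with maps \<open>d n : P (n + 1) \<rightarrow> P n\<close> and \<open>e : P 0 \<rightarrow> M\<close>\<close>
  where "proj_resolution A M P d e \<longleftrightarrow>
     (\<forall>n. projective A (P n)) \<and>
     e \<in> lhom A (P 0) M \<and> e ` carrier (P 0) = carrier M \<and>
     (\<forall>n. d n \<in> lhom A (P (Suc n)) (P n)) \<and>
     d 0 ` carrier (P 1) = a_kernel (P 0) M e \<and>
     (\<forall>n. d (Suc n) ` carrier (P (Suc (Suc n))) = a_kernel (P (Suc n)) (P n) (d n))"

definition inj_resolution ::
  "('k, 'a) module \<Rightarrow> ('a, 'm) module \<Rightarrow> (nat \<Rightarrow> ('k, 'a) fgmod) \<Rightarrow>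
    (nat \<Rightarrow> (nat \<Rightarrow> 'k) \<Rightarrow> (nat \<Rightarrow> 'k)) \<Rightarrow> ('m \<Rightarrow> (nat \<Rightarrow> 'k)) \<Rightarrow> bool"
  \<comment> \<open>\<open>0 \<rightarrow> M \<rightarrow> J 0 \<rightarrow> J 1 \<rightarrow> J 2 \<rightarrow> \<dots>\<close> with maps \<open>e : M \<rightarrow> J 0\<close> and \<open>d n : J n \<rightarrow> J (n + 1)\<close>\<close>
  where "inj_resolution A M J d e \<longleftrightarrow>
     (\<forall>n. injective A (J n)) \<and>
     e \<in> lhom A M (J 0) \<and> inj_on e (carrier M) \<and>
     (\<forall>n. d n \<in> lhom A (J n) (J (Suc n))) \<and>
     e ` carrier M = a_kernel (J 0) (J 1) (d 0) \<and>
     (\<forall>n. d n ` carrier (J n) = a_kernel (J (Suc n)) (J (Suc (Suc n))) (d (Suc n)))"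

definition proj_dim :: "('k, 'a) module \<Rightarrow> ('a, 'm) module \<Rightarrow> enat" where
  "proj_dim A M = Inf (enat ` {n. \<exists>P d e. proj_resolution A M P d e \<and>
     (\<forall>m>n. carrier (P m) = {\<zero>\<^bsub>P m\<^esub>})})"

definition inj_dim :: "('k, 'a) module \<Rightarrow> ('a, 'm) module \<Rightarrow> enat" where
  "inj_dim A M = Inf (enat ` {n. \<exists>J d e. inj_resolution A M J d e \<and>
     (\<forall>m>n. carrier (J m) = {\<zero>\<^bsub>J m\<^esub>})})"

definition gorenstein :: "('k::field, 'a) module \<Rightarrow> nat \<Rightarrow> bool" where
  "gorenstein A d \<longleftrightarrow> inj_dim A (regular A) = enat d \<and>
     proj_dim A (dual (opp A) (regular (opp A))) = enat d"

definition ext_vanishes :: "('k, 'a) module \<Rightarrow> nat \<Rightarrow> ('a, 'm) module \<Rightarrow> ('a, 'n) module \<Rightarrow> bool"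
  \<comment> \<open>\<open>Ext\<^sup>i(M, N) = 0\<close> for \<open>i > 0\<close>: in degree \<open>i\<close>, the cocycles of \<open>Hom(P, N)\<close> are coboundaries,
    for a projective resolution \<open>P\<close> of \<open>M\<close>\<close>
  where "ext_vanishes A i M N \<longleftrightarrow> (\<exists>P d e. proj_resolution A M P d e \<and>
     {f \<in> lhom A (P i) N. \<forall>x\<in>carrier (P (i + 1)). f (d i x) = \<zero>\<^bsub>N\<^esub>} \<subseteq>
     {compose (carrier (P i)) g (d (i - 1)) | g. g \<in> lhom A (P (i - 1)) N})"

definition cohen_macaulay :: "('k, 'a) module \<Rightarrow> ('a, 'm) module \<Rightarrow> bool" where
  "cohen_macaulay A M \<longleftrightarrow> fg_module A M \<and> (\<forall>i>0. ext_vanishes A i M (regular A))"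

definition no_projective_summand :: "('k, 'a) module \<Rightarrow> ('a, 'm) module \<Rightarrow> bool" where
  "no_projective_summand A M \<longleftrightarrow> (\<forall>N L. submodule N A M \<and> submodule L A M \<and>
     N \<inter> L = {\<zero>\<^bsub>M\<^esub>} \<and> N <+>\<^bsub>M\<^esub> L = carrier M \<and> projective A (M\<lparr>carrier := N\<rparr>) \<longrightarrow>
     N = {\<zero>\<^bsub>M\<^esub>})"

definition superfluous :: "('k, 'a) module \<Rightarrow> ('a, 'm) module \<Rightarrow> 'm set \<Rightarrow> bool" where
  "superfluous A M K \<longleftrightarrow> submodule K A M \<and>
     (\<forall>L. submodule L A M \<and> K <+>\<^bsub>M\<^esub> L = carrier M \<longrightarrow> L = carrier M)"

definition proj_cover ::
  "('k, 'a) module \<Rightarrow> ('a, 'p) module \<Rightarrow> ('p \<Rightarrow> 'm) \<Rightarrow> ('a, 'm) module \<Rightarrow> bool" where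
  "proj_cover A P p M \<longleftrightarrow> projective A P \<and> p \<in> lhom A P M \<and> p ` carrier P = carrier M \<and>
     superfluous A P (a_kernel P M p)"

text \<open>
  Projective covers are unique only up to isomorphism, so the syzygy and the Auslander-Reiten
  translation are relations: \<open>syzygy A M K\<close> says that \<open>K\<close> is a value of \<open>\<Omega> M\<close>, and
  \<open>ar_translate A M T\<close> that \<open>T\<close> is a value of \<open>\<tau> M\<close>.
\<close>

definition syzygy :: "('k, 'a) module \<Rightarrow> ('a, 'm) module \<Rightarrow> ('k, 'a) fgmod \<Rightarrow> bool" where
  "syzygy A M K \<longleftrightarrow> (\<exists>(P :: ('k, 'a) fgmod) p. proj_cover A P p M \<and>
     K = P\<lparr>carrier := a_kernel P M p\<rparr>)"

definition min_proj_presentation ::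
  "('k, 'a) module \<Rightarrow> ('k, 'a) fgmod \<Rightarrow> ((nat \<Rightarrow> 'k) \<Rightarrow> (nat \<Rightarrow> 'k)) \<Rightarrow>
    ('k, 'a) fgmod \<Rightarrow> ((nat \<Rightarrow> 'k) \<Rightarrow> 'm) \<Rightarrow> ('a, 'm) module \<Rightarrow> bool" where
  "min_proj_presentation A P1 d P0 p M \<longleftrightarrow>
     proj_cover A P0 p M \<and> proj_cover A P1 d (P0\<lparr>carrier := a_kernel P0 M p\<rparr>)"

definition transpose_of ::
  "('k, 'a) module \<Rightarrow> ('a, 'p) module \<Rightarrow> ('p \<Rightarrow> 'q) \<Rightarrow> ('a, 'q) module \<Rightarrow>
    ('a, ('p \<Rightarrow> 'a) set) module"
  \<comment> \<open>the cokernel of \<open>Hom(P0, A) \<rightarrow> Hom(P1, A)\<close>, a module over \<^term>\<open>opp A\<close>\<close>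
  where "transpose_of A P1 d P0 =
     quot (hom_dual A P1) ((\<lambda>f. compose (carrier P1) f d) ` carrier (hom_dual A P0))"

definition ar_translate ::
  "('k::field, 'a) module \<Rightarrow> ('a, 'm) module \<Rightarrow> ('a, ((nat \<Rightarrow> 'k) \<Rightarrow> 'a) set \<Rightarrow> 'k) module \<Rightarrow> bool"
  \<comment> \<open>\<open>\<tau> M = D Tr M\<close>\<close>
  where "ar_translate A M T \<longleftrightarrow> (\<exists>P1 d P0 p. min_proj_presentation A P1 d P0 p M \<and>
     T = dual (opp A) (transpose_of A P1 d P0))"

text \<open>
  A quiver is a \<^typ>\<open>('v, 'e) pre_digraph\<close>. A path is a pair \<open>(u, p)\<close> of its source and its list of
  arrows, in the order of traversal; \<open>(u, [])\<close> is the trivial path at \<open>u\<close>. An element of \<open>kQ\<close> is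
  its coefficient function.
\<close>

definition paths :: "('v, 'e) pre_digraph \<Rightarrow> ('v \<times> 'e list) set" where
  "paths Q = {(u, p). \<exists>v. pre_digraph.awalk Q u p v}"

definition path_algebra :: "('v, 'e) pre_digraph \<Rightarrow> ('k::field, 'v \<times> 'e list \<Rightarrow> 'k) module" where
  "path_algebra Q = \<lparr>
     carrier = {f. finite {x. f x \<noteq> 0} \<and> {x. f x \<noteq> 0} \<subseteq> paths Q},
     mult = (\<lambda>f g (u, p). \<Sum>i\<le>length p.
       f (u, take i p) * g (pre_digraph.awlast Q u (take i p), drop i p)),
     one = (\<lambda>(u, p). if u \<in> verts Q \<and> p = [] then 1 else 0),
     zero = (\<lambda>_. 0),
     add = (\<lambda>f g x. f x + g x),
     smult = (\<lambda>c f x. c * f x)\<rparr>"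

definition path_elem :: "'v \<Rightarrow> 'e list \<Rightarrow> ('v \<times> 'e list \<Rightarrow> 'k::field)" where
  "path_elem u p = (\<lambda>x. if x = (u, p) then 1 else 0)"

definition arrow_ideal :: "('v, 'e) pre_digraph \<Rightarrow> ('v \<times> 'e list \<Rightarrow> 'k::field) set" where
  "arrow_ideal Q = genideal (path_algebra Q) {path_elem (tail Q a) [a] | a. a \<in> arcs Q}"

primrec arrow_ideal_power ::
  "('v, 'e) pre_digraph \<Rightarrow> nat \<Rightarrow> ('v \<times> 'e list \<Rightarrow> 'k::field) set" where
  "arrow_ideal_power Q 0 = carrier (path_algebra Q)"
| "arrow_ideal_power Q (Suc n) =
     ideal_prod (path_algebra Q) (arrow_ideal Q) (arrow_ideal_power Q n)"

definition admissible :: "('v, 'e) pre_digraph \<Rightarrow> ('v \<times> 'e list \<Rightarrow> 'k::field) set \<Rightarrow> bool" where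
  "admissible Q I \<longleftrightarrow> ideal I (path_algebra Q) \<and>
     (\<exists>m\<ge>2. arrow_ideal_power Q m \<subseteq> I) \<and> I \<subseteq> arrow_ideal_power Q 2"

definition bound_quiver :: "('v, 'e) pre_digraph \<Rightarrow> ('v \<times> 'e list \<Rightarrow> 'k::field) set \<Rightarrow> bool" where
  "bound_quiver Q I \<longleftrightarrow> fin_digraph Q \<and> admissible Q I"

definition bound_quiver_algebra ::
  "('v, 'e) pre_digraph \<Rightarrow> ('v \<times> 'e list \<Rightarrow> 'k::field) set \<Rightarrow>
    ('k, ('v \<times> 'e list \<Rightarrow> 'k) set) module" where
  "bound_quiver_algebra Q I = quot (path_algebra Q) I"

definition two_path :: "('v, 'e) pre_digraph \<Rightarrow> 'e \<Rightarrow> 'e \<Rightarrow> ('v \<times> 'e list \<Rightarrow> 'k::field)" where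
  "two_path Q a b = path_elem (tail Q a) [a, b]"

definition gentle :: "('v, 'e) pre_digraph \<Rightarrow> ('v \<times> 'e list \<Rightarrow> 'k::field) set \<Rightarrow> bool" where
  "gentle Q I \<longleftrightarrow> bound_quiver Q I \<and>
     (\<forall>v\<in>verts Q. card {a \<in> arcs Q. tail Q a = v} \<le> 2 \<and> card {a \<in> arcs Q. head Q a = v} \<le> 2) \<and>
     (\<exists>S \<subseteq> {(a, b). a \<in> arcs Q \<and> b \<in> arcs Q \<and> head Q a = tail Q b}.
        I = genideal (path_algebra Q) {two_path Q a b | a b. (a, b) \<in> S}) \<and>
     (\<forall>b\<in>arcs Q.
        card {a \<in> arcs Q. head Q a = tail Q b \<and> two_path Q a b \<in> I} \<le> 1 \<and>
        card {c \<in> arcs Q. head Q b = tail Q c \<and> two_path Q b c \<in> I} \<le> 1) \<and>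
     (\<forall>b\<in>arcs Q.
        card {a \<in> arcs Q. head Q a = tail Q b \<and> two_path Q a b \<notin> I} \<le> 1 \<and>
        card {c \<in> arcs Q. head Q b = tail Q c \<and> two_path Q b c \<notin> I} \<le> 1)"

datatype block = Type_I | Type_II | Type_loop

fun block_quiver :: "block \<Rightarrow> (nat, nat) pre_digraph" where
  "block_quiver Type_I = \<lparr>verts = {0, 1}, arcs = {0}, tail = (\<lambda>_. 0), head = (\<lambda>_. 1)\<rparr>"
| "block_quiver Type_II = \<lparr>verts = {0, 1, 2}, arcs = {0, 1, 2},
     tail = (\<lambda>a. a), head = (\<lambda>a. (a + 1) mod 3)\<rparr>"
| "block_quiver Type_loop = \<lparr>verts = {0}, arcs = {0}, tail = (\<lambda>_. 0), head = (\<lambda>_. 0)\<rparr>"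

fun block_relations :: "block \<Rightarrow> (nat \<times> nat) set"
  \<comment> \<open>the pairs \<open>(a, b)\<close> of arrows with relation \<open>ab = 0\<close>\<close>
  where
  "block_relations Type_I = {}"
| "block_relations Type_II = {(0, 1), (1, 2), (2, 0)}"
| "block_relations Type_loop = {(0, 0)}"

text \<open>
  A finite collection of disjoint blocks is a list \<open>bs\<close>; the vertex (or arrow) \<open>v\<close> of the block
  \<open>bs ! i\<close> is \<open>(i, v)\<close>.
\<close>

definition outlets :: "block list \<Rightarrow> (nat \<times> nat) set" where
  "outlets bs = {(i, v). i < length bs \<and> v \<in> verts (block_quiver (bs ! i))}"

definition outlet_matching :: "block list \<Rightarrow> ((nat \<times> nat) \<times> (nat \<times> nat)) set \<Rightarrow> bool" where
  "outlet_matching bs m \<longleftrightarrow> m \<subseteq> outlets bs \<times> outlets bs \<and> sym m \<and> single_valued m \<and>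
     (\<forall>i v j w. ((i, v), (j, w)) \<in> m \<longrightarrow> i \<noteq> j \<and> \<not> (bs ! i = Type_loop \<and> bs ! j = Type_loop))"

definition glued_vertex :: "((nat \<times> nat) \<times> (nat \<times> nat)) set \<Rightarrow> nat \<times> nat \<Rightarrow> (nat \<times> nat) set" where
  "glued_vertex m x = insert x (m `` {x})"

definition glued_quiver ::
  "block list \<Rightarrow> ((nat \<times> nat) \<times> (nat \<times> nat)) set \<Rightarrow> ((nat \<times> nat) set, nat \<times> nat) pre_digraph" where
  "glued_quiver bs m = \<lparr>
     verts = glued_vertex m ` outlets bs,
     arcs = {(i, a). i < length bs \<and> a \<in> arcs (block_quiver (bs ! i))},
     tail = (\<lambda>(i, a). glued_vertex m (i, tail (block_quiver (bs ! i)) a)),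
     head = (\<lambda>(i, a). glued_vertex m (i, head (block_quiver (bs ! i)) a))\<rparr>"

definition glued_relations :: "block list \<Rightarrow> ((nat \<times> nat) \<times> (nat \<times> nat)) set" where
  "glued_relations bs =
     {((i, a), (i, b)) | i a b. i < length bs \<and> (a, b) \<in> block_relations (bs ! i)}"

definition has_opposite_arrows :: "('v, 'e) pre_digraph \<Rightarrow> bool" where
  "has_opposite_arrows Q \<longleftrightarrow> (\<exists>a\<in>arcs Q. \<exists>b\<in>arcs Q.
     tail Q a \<noteq> head Q a \<and> tail Q b = head Q a \<and> head Q b = tail Q a)"

definition gentle_block_decomposable ::
  "('v, 'e) pre_digraph \<Rightarrow> ('v \<times> 'e list \<Rightarrow> 'k::field) set \<Rightarrow> bool"
  \<comment> \<open>no block is a single vertex without arrows, so a quiver with an isolated vertex never qualifies\<close>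
  where
  "gentle_block_decomposable Q I \<longleftrightarrow> (\<exists>bs m h.
     outlet_matching bs m \<and> \<not> has_opposite_arrows (glued_quiver bs m) \<and>
     pre_digraph.digraph_isomorphism (glued_quiver bs m) h \<and> Q = app_iso h (glued_quiver bs m) \<and>
     I = genideal (path_algebra Q)
       {two_path Q (iso_arcs h a) (iso_arcs h b) | a b. (a, b) \<in> glued_relations bs})"

end

theory Submission
  imports Defs "HOL-Library.Sublist"
begin

text \<open>
  Write \<open>a \<rightarrow> b\<close> if \<open>ab\<close> is a relation; by (G3) this is a partial injection on the arrows. For an arrow
  \<open>b\<close> the left ideal \<open>\<Lambda>b\<close> is \<open>\<Lambda>e / \<Lambda>a\<close> with \<open>a \<rightarrow> b\<close> (or \<open>\<Lambda>e\<close> if there is no such \<open>a\<close>). If \<open>a \<rightarrow> b\<close>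
  and nothing precedes \<open>a\<close>, then \<open>\<Lambda>a\<close> is a projective second syzygy and \<open>Ext\<^sup>2(\<Lambda> / \<Lambda>b, \<Lambda>) \<noteq> 0\<close>. So
  if \<open>inj.dim \<Lambda> \<le> 1\<close>, every arrow having a successor has a predecessor, and by finiteness \<open>\<rightarrow>\<close> is a
  permutation of the arrows that occur in relations.

  Then each \<open>\<Lambda>b\<close> with \<open>b\<close> in a relation is Cohen-Macaulay and indecomposable non-projective. For
  \<open>a'' \<rightarrow> a' \<rightarrow> a \<rightarrow> b\<close> its transpose is the uniserial right module \<open>a'\<Lambda>\<close>. If \<open>a'p\<close> is the
  longest nonzero path starting with \<open>a'\<close> and \<open>v\<close> its end, then \<open>\<tau>(\<Lambda>b) = D(a'\<Lambda>)\<close> is covered by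
  \<open>\<Lambda>e\<^sub>v\<close> with kernel \<open>\<Lambda>a'p \<oplus> \<Lambda>d\<close>, where \<open>d\<close> is the other arrow into \<open>v\<close>, if any. Maximality of
  \<open>p\<close> forces \<open>\<Lambda>d\<close> to be projective, so \<open>\<Omega>\<^sup>2\<tau>(\<Lambda>b) = \<Omega>(\<Lambda>a') = \<Lambda>a''\<close>. Hence \<open>\<Lambda>a'' \<cong> \<Lambda>b\<close>, which gives
  \<open>a'' = b\<close>: the cycles of \<open>\<rightarrow>\<close> have length 1 or 3. They are the blocks of type loop and type II, the
  remaining arrows are the blocks of type I, and gentleness leaves room for at most two blocks at
  each vertex.
\<close>

section \<open>Modules as submodules of the square of the algebra\<close>

text \<open>Uniqueness of covers and resolutions is nowhere required. The hypothesis on the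
  translate ranges over all values of the relations involved, so for each arrow one explicit chain
  of projective covers is enough. Its members must have the prescribed element types, and each
  kernel must equal the next module on the nose, not merely up to isomorphism. Hence all modules are
  cut out of one encoded copy of the square of the algebra; two summands suffice because a vertex
  receives at most two arrows. The algebra is seen only through coordinates in the basis of nonzero
  paths. Exactness then becomes a comparison of coefficients that is decided by the first or last
  arrow of a path. An isomorphism between two such left ideals recovers the arrow: the predecessor
  of \<open>c\<close> annihilates \<open>c\<close>, hence also the image of \<open>c\<close>, whose
  leading term is a multiple of \<open>b\<close>. For the gluing, finite dimension replaces
  acyclicity: a closed path without relation at its joint would have infinitely many nonzero
  powers.\<close>

lemma (in left_module) smult_zero_l: "x \<in> carrier M \<Longrightarrow> \<zero>\<^bsub>R\<^esub> \<odot>\<^bsub>M\<^esub> x = \<zero>\<^bsub>M\<^esub>"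
  using smult_l_distr[of "\<zero>\<^bsub>R\<^esub>" "\<zero>\<^bsub>R\<^esub>" x] smult_closed[of "\<zero>\<^bsub>R\<^esub>" x]
  by (metis R.l_zero R.zero_closed M.add.r_cancel_one)

lemma lhom_closed: "f \<in> lhom A M N \<Longrightarrow> x \<in> carrier M \<Longrightarrow> f x \<in> carrier N"
  by (auto simp: lhom_def)

lemma lhom_add:
  "f \<in> lhom A M N \<Longrightarrow> x \<in> carrier M \<Longrightarrow> y \<in> carrier M \<Longrightarrow> f (x \<oplus>\<^bsub>M\<^esub> y) = f x \<oplus>\<^bsub>N\<^esub> f y"
  by (auto simp: lhom_def)

lemma lhom_smult:
  "f \<in> lhom A M N \<Longrightarrow> a \<in> carrier A \<Longrightarrow> x \<in> carrier M \<Longrightarrow> f (a \<odot>\<^bsub>M\<^esub> x) = a \<odot>\<^bsub>N\<^esub> f x"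
  by (auto simp: lhom_def)

lemma lhom_zero:
  assumes "left_module A M" "left_module A N" "f \<in> lhom A M N"
  shows "f \<zero>\<^bsub>M\<^esub> = \<zero>\<^bsub>N\<^esub>"
proof -
  interpret M: left_module A M by fact
  interpret N: left_module A N by fact
  have "f \<zero>\<^bsub>M\<^esub> = f (\<zero>\<^bsub>A\<^esub> \<odot>\<^bsub>M\<^esub> \<zero>\<^bsub>M\<^esub>)" by (simp add: M.smult_zero_l)
  also have "\<dots> = \<zero>\<^bsub>A\<^esub> \<odot>\<^bsub>N\<^esub> f \<zero>\<^bsub>M\<^esub>" using assms(3) by (simp add: lhom_smult)
  also have "\<dots> = \<zero>\<^bsub>N\<^esub>" using assms(3) by (simp add: N.smult_zero_l lhom_closed)
  finally show ?thesis .
qed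

lemma a_kernelD: "x \<in> a_kernel M N f \<longleftrightarrow> x \<in> carrier M \<and> f x = \<zero>\<^bsub>N\<^esub>"
  by (simp add: a_kernel_def')

text \<open>
  The definitions quantify over modules with elements of type \<^typ>\<open>nat \<Rightarrow> 'k\<close>, whence the injection
  \<open>\<iota>\<close>. The direct sum of two copies of \<open>A\<close> contains all the modules that are needed.
\<close>

locale pair_modules = ring A for A :: "('k, 'a) module" (structure) +
  fixes \<iota> :: "'a \<times> 'a \<Rightarrow> nat \<Rightarrow> 'k"
  assumes inj_iota: "inj_on \<iota> (carrier A \<times> carrier A)"
begin

definition unp :: "(nat \<Rightarrow> 'k) \<Rightarrow> 'a \<times> 'a" where
  "unp = the_inv_into (carrier A \<times> carrier A) \<iota>"

lemma unp_iota [simp]: "x \<in> carrier A \<Longrightarrow> y \<in> carrier A \<Longrightarrow> unp (\<iota> (x, y)) = (x, y)"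
  unfolding unp_def by (rule the_inv_into_f_f[OF inj_iota]) auto

lemma iota_eq_iff [simp]:
  "x \<in> carrier A \<Longrightarrow> y \<in> carrier A \<Longrightarrow> x' \<in> carrier A \<Longrightarrow> y' \<in> carrier A \<Longrightarrow>
    \<iota> (x, y) = \<iota> (x', y') \<longleftrightarrow> x = x' \<and> y = y'"
  using inj_onD[OF inj_iota, of "(x,y)" "(x',y')"] by auto

text \<open>The operations do not depend on \<open>X\<close>, so shrinking the carrier of
  \<open>pm X\<close> gives literally \<open>pm Y\<close>. Kernels, syzygies and summands therefore
  stay within this family of modules.\<close>

definition pm :: "('a \<times> 'a) set \<Rightarrow> ('k, 'a) fgmod" where
  "pm X = \<lparr>carrier = \<iota> ` X, mult = undefined, one = undefined, zero = \<iota> (\<zero>, \<zero>),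
     add = (\<lambda>u v. \<iota> (fst (unp u) \<oplus> fst (unp v), snd (unp u) \<oplus> snd (unp v))),
     smult = (\<lambda>a u. \<iota> (a \<otimes> fst (unp u), a \<otimes> snd (unp u)))\<rparr>"

lemma pm_simps [simp]:
  "carrier (pm X) = \<iota> ` X"
  "zero (pm X) = \<iota> (\<zero>, \<zero>)"
  "(pm X)\<lparr>carrier := \<iota> ` Y\<rparr> = pm Y"
  by (simp_all add: pm_def)

lemma pm_add [simp]:
  "\<lbrakk>x \<in> carrier A; y \<in> carrier A; x' \<in> carrier A; y' \<in> carrier A\<rbrakk> \<Longrightarrow>
    \<iota> (x, y) \<oplus>\<^bsub>pm X\<^esub> \<iota> (x', y') = \<iota> (x \<oplus> x', y \<oplus> y')"
  by (simp add: pm_def)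

lemma pm_smult [simp]:
  "\<lbrakk>x \<in> carrier A; y \<in> carrier A\<rbrakk> \<Longrightarrow> a \<odot>\<^bsub>pm X\<^esub> \<iota> (x, y) = \<iota> (a \<otimes> x, a \<otimes> y)"
  by (simp add: pm_def)

text \<open>Closure under negatives follows from the action of
  \<open>\<ominus> \<one>\<close>.\<close>

definition subm :: "('a \<times> 'a) set \<Rightarrow> bool" where
  "subm X \<longleftrightarrow> X \<subseteq> carrier A \<times> carrier A \<and> (\<zero>, \<zero>) \<in> X \<and>
    (\<forall>x y x' y'. (x, y) \<in> X \<longrightarrow> (x', y') \<in> X \<longrightarrow> (x \<oplus> x', y \<oplus> y') \<in> X) \<and>
    (\<forall>a x y. a \<in> carrier A \<longrightarrow> (x, y) \<in> X \<longrightarrow> (a \<otimes> x, a \<otimes> y) \<in> X)"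

lemma submD:
  assumes "subm X"
  shows "(x, y) \<in> X \<Longrightarrow> x \<in> carrier A" "(x, y) \<in> X \<Longrightarrow> y \<in> carrier A" "(\<zero>, \<zero>) \<in> X"
    "(x, y) \<in> X \<Longrightarrow> (x', y') \<in> X \<Longrightarrow> (x \<oplus> x', y \<oplus> y') \<in> X"
    "a \<in> carrier A \<Longrightarrow> (x, y) \<in> X \<Longrightarrow> (a \<otimes> x, a \<otimes> y) \<in> X"
  using assms by (auto simp: subm_def)

lemma subm_neg:
  assumes "subm X" "(x, y) \<in> X" shows "(\<ominus> x, \<ominus> y) \<in> X"
proof -
  have "((\<ominus> \<one>) \<otimes> x, (\<ominus> \<one>) \<otimes> y) \<in> X"
    by (rule submD(5)[OF assms(1) _ assms(2)]) simp
  thus ?thesis using submD(1,2)[OF assms] by (simp add: l_minus)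
qed

lemma left_module_pm:
  assumes X: "subm X" shows "left_module A (pm X)"
proof -
  note D = submD[OF X]
  have "abelian_group (pm X)"
  proof (rule abelian_groupI)
    fix u assume "u \<in> carrier (pm X)"
    then obtain x y where u: "u = \<iota> (x, y)" "(x, y) \<in> X" by auto
    show "\<exists>v\<in>carrier (pm X). v \<oplus>\<^bsub>pm X\<^esub> u = \<zero>\<^bsub>pm X\<^esub>"
      by (rule bexI[of _ "\<iota> (\<ominus> x, \<ominus> y)"]) (use u D(1,2) subm_neg[OF X] in \<open>auto simp: l_neg\<close>)
  qed (use D in \<open>auto simp: a_ac intro!: imageI\<close>)
  then show ?thesis
  proof (intro left_module.intro left_module_axioms.intro)
    show "ring A" by (rule ring_axioms)
  qed (use D in \<open>auto simp: l_distr r_distr m_assoc intro!: imageI\<close>)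
qed

text \<open>Turns the quantifiers over submodules in the definitions of finite generation,
  superfluity and direct summands into quantifiers over sets of pairs.\<close>

lemma submodule_pm:
  assumes X: "subm X"
  shows "submodule N A (pm X) \<longleftrightarrow> (\<exists>Y. subm Y \<and> Y \<subseteq> X \<and> N = \<iota> ` Y)"
proof
  assume "submodule N A (pm X)"
  then interpret N: submodule N A "pm X" .
  define Y where "Y = {z \<in> X. \<iota> z \<in> N}"
  have NX: "N \<subseteq> \<iota> ` X" using N.subset by simp
  have "subm Y"
    unfolding subm_def
  proof (intro conjI allI impI)
    show "Y \<subseteq> carrier A \<times> carrier A" using X by (auto simp: Y_def subm_def)
    show "(\<zero>, \<zero>) \<in> Y" using N.one_closed X by (auto simp: Y_def subm_def)
  next
    fix x y x' y' assume "(x, y) \<in> Y" "(x', y') \<in> Y"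
    then show "(x \<oplus> x', y \<oplus> y') \<in> Y"
      using N.m_closed[of "\<iota> (x,y)" "\<iota> (x',y')"] submD[OF X] by (auto simp: Y_def)
  next
    fix a x y assume "a \<in> carrier A" "(x, y) \<in> Y"
    then show "(a \<otimes> x, a \<otimes> y) \<in> Y"
      using N.smult_closed[of a "\<iota> (x,y)"] submD(5)[OF X, of a x y] submD(1,2)[OF X, of x y] by (simp add: Y_def)
  qed
  moreover have "N = \<iota> ` Y" using NX by (auto simp: Y_def)
  moreover have "Y \<subseteq> X" by (auto simp: Y_def)
  ultimately show "\<exists>Y. subm Y \<and> Y \<subseteq> X \<and> N = \<iota> ` Y" by blast
next
  assume "\<exists>Y. subm Y \<and> Y \<subseteq> X \<and> N = \<iota> ` Y"
  then obtain Y where Y: "subm Y" "Y \<subseteq> X" "N = \<iota> ` Y" by auto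
  interpret P: left_module A "pm X" by (rule left_module_pm[OF X])
  have XC: "X \<subseteq> carrier A \<times> carrier A" using X by (simp add: subm_def)
  show "submodule N A (pm X)"
  proof (intro submodule.intro subgroup.intro submodule_axioms.intro)
    show "N \<subseteq> carrier (add_monoid (pm X))" using Y by auto
    show "\<one>\<^bsub>add_monoid (pm X)\<^esub> \<in> N" using Y submD(3)[OF Y(1)] by auto
    fix u assume "u \<in> N"
    then obtain x y where u: "u = \<iota> (x, y)" "(x, y) \<in> Y" using Y by auto
    have uX: "(x, y) \<in> X" using u Y by auto
    have xy: "x \<in> carrier A" "y \<in> carrier A" using uX XC by auto
    have "\<ominus>\<^bsub>pm X\<^esub> u = \<iota> (\<ominus> x, \<ominus> y)"
      using u uX xy subm_neg[OF X uX] by (intro P.M.minus_equality) (simp_all add: l_neg)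
    then have "\<ominus>\<^bsub>pm X\<^esub> u \<in> N" using subm_neg[OF Y(1) u(2)] Y by auto
    then show "inv\<^bsub>add_monoid (pm X)\<^esub> u \<in> N" by (simp add: a_inv_def)
    {
      fix a assume "a \<in> carrier A"
      then show "a \<odot>\<^bsub>pm X\<^esub> u \<in> N" using submD(5)[OF Y(1) _ u(2)] u xy Y by simp
    }
    fix v assume "v \<in> N"
    then obtain x' y' where v: "v = \<iota> (x', y')" "(x', y') \<in> Y" using Y by auto
    have "x' \<in> carrier A" "y' \<in> carrier A" using v(2) Y XC by auto
    then show "u \<otimes>\<^bsub>add_monoid (pm X)\<^esub> v \<in> N"
      using submD(4)[OF Y(1) u(2) v(2)] u v xy Y by simp
  qed
qed

text \<open>Restricted to the encoded set because \<open>lhom\<close> admits extensional functions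
  only.\<close>

definition lift :: "('a \<times> 'a) set \<Rightarrow> ('a \<times> 'a \<Rightarrow> 'n) \<Rightarrow> (nat \<Rightarrow> 'k) \<Rightarrow> 'n" where
  "lift X F = (\<lambda>u\<in>\<iota> ` X. F (unp u))"

lemma lift_iota [simp]:
  "X \<subseteq> carrier A \<times> carrier A \<Longrightarrow> (x, y) \<in> X \<Longrightarrow> lift X F (\<iota> (x, y)) = F (x, y)"
  by (auto simp: lift_def subset_eq)

lemma lift_lhom:
  assumes X: "subm X"
    and "\<And>x y. (x, y) \<in> X \<Longrightarrow> F (x, y) \<in> carrier N"
    and "\<And>x y x' y'. (x, y) \<in> X \<Longrightarrow> (x', y') \<in> X \<Longrightarrow> F (x \<oplus> x', y \<oplus> y') = F (x, y) \<oplus>\<^bsub>N\<^esub> F (x', y')"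
    and "\<And>a x y. a \<in> carrier A \<Longrightarrow> (x, y) \<in> X \<Longrightarrow> F (a \<otimes> x, a \<otimes> y) = a \<odot>\<^bsub>N\<^esub> F (x, y)"
  shows "lift X F \<in> lhom A (pm X) N"
proof -
  have XC: "X \<subseteq> carrier A \<times> carrier A" using X by (simp add: subm_def)
  note D = submD[OF X]
  have "lift X F \<in> extensional (\<iota> ` X)" by (simp add: lift_def)
  then show ?thesis
    unfolding lhom_def using D assms(2-4) by (auto simp: XC PiE_iff)
qed

section \<open>Direct sums of two principal left ideals\<close>

definition lgen :: "'a \<Rightarrow> 'a \<Rightarrow> ('a \<times> 'a) set" where
  "lgen z z' = {(x \<otimes> z, y \<otimes> z') | x y. x \<in> carrier A \<and> y \<in> carrier A}"

lemma subm_lgen: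
  assumes "z \<in> carrier A" "z' \<in> carrier A" shows "subm (lgen z z')"
  unfolding subm_def
proof (intro conjI allI impI)
  show "lgen z z' \<subseteq> carrier A \<times> carrier A" using assms by (auto simp: lgen_def)
  show "(\<zero>, \<zero>) \<in> lgen z z'" unfolding lgen_def using assms
    by (auto intro!: exI[of _ "\<zero>"])
next
  fix x y x' y' assume "(x, y) \<in> lgen z z'" "(x', y') \<in> lgen z z'"
  then obtain a b a' b' where "x = a \<otimes> z" "y = b \<otimes> z'" "x' = a' \<otimes> z" "y' = b' \<otimes> z'"
     "a \<in> carrier A" "b \<in> carrier A" "a' \<in> carrier A" "b' \<in> carrier A" by (auto simp: lgen_def)
  then have "x \<oplus> x' = (a \<oplus> a') \<otimes> z" "y \<oplus> y' = (b \<oplus> b') \<otimes> z'" "a \<oplus> a' \<in> carrier A" "b \<oplus> b' \<in> carrier A"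
    using assms by (auto simp: l_distr)
  then show "(x \<oplus> x', y \<oplus> y') \<in> lgen z z'" unfolding lgen_def by blast
next
  fix c x y assume "c \<in> carrier A" "(x, y) \<in> lgen z z'"
  then obtain a b where "x = a \<otimes> z" "y = b \<otimes> z'" "a \<in> carrier A" "b \<in> carrier A" by (auto simp: lgen_def)
  then have "c \<otimes> x = (c \<otimes> a) \<otimes> z" "c \<otimes> y = (c \<otimes> b) \<otimes> z'" "c \<otimes> a \<in> carrier A" "c \<otimes> b \<in> carrier A"
    using assms \<open>c \<in> carrier A\<close> by (auto simp: m_assoc)
  then show "(c \<otimes> x, c \<otimes> y) \<in> lgen z z'" unfolding lgen_def by blast
qed

lemma lgen_carrier: "z \<in> carrier A \<Longrightarrow> z' \<in> carrier A \<Longrightarrow> lgen z z' \<subseteq> carrier A \<times> carrier A"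
  using subm_lgen by (simp add: subm_def)

lemma lgenI: "x \<in> carrier A \<Longrightarrow> y \<in> carrier A \<Longrightarrow> (x \<otimes> z, y \<otimes> z') \<in> lgen z z'"
  by (auto simp: lgen_def)

lemma lgen_fst: "z \<in> carrier A \<Longrightarrow> z' \<in> carrier A \<Longrightarrow> (z, \<zero>) \<in> lgen z z'"
  using lgenI[of \<one> \<zero> z z'] by simp

lemma lgen_snd: "z \<in> carrier A \<Longrightarrow> z' \<in> carrier A \<Longrightarrow> (\<zero>, z') \<in> lgen z z'"
  using lgenI[of \<zero> \<one> z z'] by simp

lemma lgen_minimal:
  assumes "subm Y" "z \<in> carrier A" "z' \<in> carrier A" "(z, \<zero>) \<in> Y" "(\<zero>, z') \<in> Y"
  shows "lgen z z' \<subseteq> Y"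
proof
  fix u assume "u \<in> lgen z z'"
  then obtain a b where u: "u = (a \<otimes> z, b \<otimes> z')" "a \<in> carrier A" "b \<in> carrier A" by (auto simp: lgen_def)
  have "(a \<otimes> z, a \<otimes> \<zero>) \<in> Y" "(b \<otimes> \<zero>, b \<otimes> z') \<in> Y"
    by (rule submD(5)[OF assms(1) u(2) assms(4)] submD(5)[OF assms(1) u(3) assms(5)])+
  from submD(4)[OF assms(1) this] show "u \<in> Y" using u assms by simp
qed

lemma fg_module_lgen:
  assumes z: "z \<in> carrier A" "z' \<in> carrier A" shows "fg_module A (pm (lgen z z'))"
  unfolding fg_module_def
proof (intro conjI exI[of _ "{\<iota> (z, \<zero>), \<iota> (\<zero>, z')}"] allI impI)
  note S = subm_lgen[OF z]
  show "left_module A (pm (lgen z z'))" by (rule left_module_pm[OF S])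
  show "{\<iota> (z, \<zero>), \<iota> (\<zero>, z')} \<subseteq> carrier (pm (lgen z z'))"
    using lgen_fst[OF z] lgen_snd[OF z] by auto
  fix N assume N: "submodule N A (pm (lgen z z')) \<and> {\<iota> (z, \<zero>), \<iota> (\<zero>, z')} \<subseteq> N"
  then obtain Y where Y: "subm Y" "Y \<subseteq> lgen z z'" "N = \<iota> ` Y" using submodule_pm[OF S] by auto
  have YC: "Y \<subseteq> carrier A \<times> carrier A" using Y(1) by (simp add: subm_def)
  have "(z, \<zero>) \<in> Y" using N Y z inj_onD[OF inj_iota] YC by (auto simp: inj_on_image_mem_iff[OF inj_iota])
  moreover have "(\<zero>, z') \<in> Y" using N Y z YC by (auto simp: inj_on_image_mem_iff[OF inj_iota])
  ultimately have "lgen z z' \<subseteq> Y" using lgen_minimal[OF Y(1) z] by blast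
  then show "N = carrier (pm (lgen z z'))" using Y by auto
qed simp

lemma lgen_idem:
  assumes "z \<in> carrier A" "z' \<in> carrier A" "z \<otimes> z = z" "z' \<otimes> z' = z'" "(x, y) \<in> lgen z z'"
  shows "x \<otimes> z = x" "y \<otimes> z' = y" "x \<in> carrier A" "y \<in> carrier A"
  using assms by (auto simp: lgen_def m_assoc)

lemma lhom_split:
  assumes z: "z \<in> carrier A" "z' \<in> carrier A" "x \<in> carrier A" "y \<in> carrier A"
    and f: "f \<in> lhom A (pm (lgen z z')) N"
  shows "f (\<iota> (x \<otimes> z, y \<otimes> z')) = x \<odot>\<^bsub>N\<^esub> f (\<iota> (z, \<zero>)) \<oplus>\<^bsub>N\<^esub> y \<odot>\<^bsub>N\<^esub> f (\<iota> (\<zero>, z'))"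
proof -
  have 1: "\<iota> (z, \<zero>) \<in> carrier (pm (lgen z z'))" "\<iota> (\<zero>, z') \<in> carrier (pm (lgen z z'))"
    using lgen_fst[OF z(1,2)] lgen_snd[OF z(1,2)] by auto
  have 2: "\<iota> (x \<otimes> z, \<zero>) \<in> carrier (pm (lgen z z'))" "\<iota> (\<zero>, y \<otimes> z') \<in> carrier (pm (lgen z z'))"
    using lgenI[of x \<zero> z z'] lgenI[of \<zero> y z z'] z by auto
  have "f (\<iota> (x \<otimes> z, y \<otimes> z')) = f (\<iota> (x \<otimes> z, \<zero>) \<oplus>\<^bsub>pm (lgen z z')\<^esub> \<iota> (\<zero>, y \<otimes> z'))" using z by simp
  also have "\<dots> = f (\<iota> (x \<otimes> z, \<zero>)) \<oplus>\<^bsub>N\<^esub> f (\<iota> (\<zero>, y \<otimes> z'))" by (rule lhom_add[OF f 2])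
  also have "f (\<iota> (x \<otimes> z, \<zero>)) = f (x \<odot>\<^bsub>pm (lgen z z')\<^esub> \<iota> (z, \<zero>))" using z by simp
  also have "\<dots> = x \<odot>\<^bsub>N\<^esub> f (\<iota> (z, \<zero>))" by (rule lhom_smult[OF f z(3) 1(1)])
  also have "f (\<iota> (\<zero>, y \<otimes> z')) = f (y \<odot>\<^bsub>pm (lgen z z')\<^esub> \<iota> (\<zero>, z'))" using z by simp
  also have "\<dots> = y \<odot>\<^bsub>N\<^esub> f (\<iota> (\<zero>, z'))" by (rule lhom_smult[OF f z(4) 1(2)])
  finally show ?thesis .
qed

text \<open>Since x = x z on A z, arbitrary preimages of the images of the two generators already
  define a lift; they need not be fixed by the idempotents.\<close>

lemma projective_lgen:
  assumes z: "z \<in> carrier A" "z' \<in> carrier A" and idem: "z \<otimes> z = z" "z' \<otimes> z' = z'"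
  shows "projective A (pm (lgen z z'))"
  unfolding projective_def
proof (intro conjI allI impI, goal_cases)
  case 1
  show ?case by (rule fg_module_lgen[OF z])
next
  case (2 U V g f)
  interpret U: left_module A U using 2 by (simp add: fg_module_def)
  have g: "g \<in> lhom A U V" and gs: "g ` carrier U = carrier V" and f: "f \<in> lhom A (pm (lgen z z')) V"
    using 2 by auto
  have "f (\<iota> (z, \<zero>)) \<in> carrier V" "f (\<iota> (\<zero>, z')) \<in> carrier V"
    using lgen_fst[OF z] lgen_snd[OF z] by (auto intro!: lhom_closed[OF f])
  then obtain u v where u: "u \<in> carrier U" "g u = f (\<iota> (z, \<zero>))" and v: "v \<in> carrier U" "g v = f (\<iota> (\<zero>, z'))"
    using gs by (metis (no_types, lifting) imageE)
  let ?h = "lift (lgen z z') (\<lambda>(x, y). x \<odot>\<^bsub>U\<^esub> u \<oplus>\<^bsub>U\<^esub> y \<odot>\<^bsub>U\<^esub> v)"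
  have LC: "lgen z z' \<subseteq> carrier A \<times> carrier A" using z by (rule lgen_carrier)
  have h: "?h \<in> lhom A (pm (lgen z z')) U"
  proof (rule lift_lhom[OF subm_lgen[OF z]], goal_cases)
    case (1 x y)
    then show ?case using LC u v by (auto simp: U.smult_closed)
  next
    case (2 x y x' y')
    then have "x \<in> carrier A" "y \<in> carrier A" "x' \<in> carrier A" "y' \<in> carrier A" using LC by auto
    then show ?case using u v
      by (simp add: U.smult_closed U.smult_l_distr U.M.a_assoc U.M.a_lcomm)
  next
    case (3 a x y)
    then show ?case using LC u v
      by (auto simp: U.smult_closed U.smult_assoc U.smult_r_distr)
  qed
  have "g (?h w) = f w" if "w \<in> carrier (pm (lgen z z'))" for w
  proof -
    obtain x y where w: "w = \<iota> (x, y)" "(x, y) \<in> lgen z z'" using \<open>w \<in> _\<close> by auto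
    have xy: "x \<otimes> z = x" "y \<otimes> z' = y" "x \<in> carrier A" "y \<in> carrier A"
      by (rule lgen_idem[OF z idem w(2)])+
    have "g (?h w) = g (x \<odot>\<^bsub>U\<^esub> u \<oplus>\<^bsub>U\<^esub> y \<odot>\<^bsub>U\<^esub> v)" using w LC by simp
    also have "\<dots> = x \<odot>\<^bsub>V\<^esub> g u \<oplus>\<^bsub>V\<^esub> y \<odot>\<^bsub>V\<^esub> g v"
      using xy u v by (simp add: U.smult_closed lhom_add[OF g] lhom_smult[OF g])
    also have "\<dots> = f (\<iota> (x \<otimes> z, y \<otimes> z'))" using lhom_split[OF z xy(3,4) f] u v by simp
    finally show ?thesis using xy w by simp
  qed
  then show ?case using h by blast
qed

end

text \<open>\<open>F n\<close> plays the role of the \<open>n\<close>-th power of the radical.\<close>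

locale filtered_pair_modules = pair_modules A \<iota>
  for A :: "('k, 'a) module" (structure) and \<iota> +
  fixes F :: "nat \<Rightarrow> 'a set"
  assumes filt_carrier: "F n \<subseteq> carrier A" and filt_0: "F 0 = carrier A" and filt_nilp: "\<exists>m. F m = {\<zero>}"
    and filt_add: "x \<in> F n \<Longrightarrow> y \<in> F n \<Longrightarrow> x \<oplus> y \<in> F n"
    and filt_mult: "x \<in> F n \<Longrightarrow> y \<in> F 1 \<Longrightarrow> x \<otimes> y \<in> F (Suc n)"
begin

text \<open>Nakayama's lemma. Both generators lie in \<open>L\<close> up to an error in
  \<open>F 1\<close>; substituting this into an element of \<open>F n\<close> leaves an error in
  \<open>F (Suc n)\<close>, and the filtration ends at zero.\<close>

lemma nakayama_lgen:
  assumes z: "z \<in> carrier A" "z' \<in> carrier A" and idem: "z \<otimes> z = z" "z' \<otimes> z' = z'"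
    and L: "subm L"
    and 1: "(k, k') \<in> lgen z z'" "(l, l') \<in> L" "z = k \<oplus> l" "\<zero> = k' \<oplus> l'"
    and 2: "(h, h') \<in> lgen z z'" "(m, m') \<in> L" "\<zero> = h \<oplus> m" "z' = h' \<oplus> m'"
    and F1: "k \<in> F 1" "k' \<in> F 1" "h \<in> F 1" "h' \<in> F 1"
  shows "lgen z z' \<subseteq> L"
proof -
  note S = subm_lgen[OF z]
  note LC = lgen_carrier[OF z]
  have c: "k \<in> carrier A" "k' \<in> carrier A" "l \<in> carrier A" "l' \<in> carrier A"
    "h \<in> carrier A" "h' \<in> carrier A" "m \<in> carrier A" "m' \<in> carrier A"
    using 1 2 LC submD(1,2)[OF L] by auto
  obtain n0 where n0: "F n0 = {\<zero>}" using filt_nilp by blast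
  have main: "(x, y) \<in> L" if "(x, y) \<in> lgen z z'" "x \<in> F n" "y \<in> F n" "n \<le> n0" for x y n
    using that(4,1-3)
  proof (induction n arbitrary: x y rule: inc_induct)
    case base
    then show ?case using submD(3)[OF L] n0 by simp
  next
    case (step n)
    have xy: "x \<otimes> z = x" "y \<otimes> z' = y" "x \<in> carrier A" "y \<in> carrier A"
      by (rule lgen_idem[OF z idem step.prems(1)])+
    \<comment> \<open>Expand (x, y) = x (z, 0) + y (0, z') by the two decompositions:
      \<open>(?p, ?p')\<close> is the part of higher degree, \<open>(?q, ?q')\<close> the part in
      \<open>L\<close>.\<close>
    let ?p = "x \<otimes> k \<oplus> y \<otimes> h" and ?p' = "x \<otimes> k' \<oplus> y \<otimes> h'"
    let ?q = "x \<otimes> l \<oplus> y \<otimes> m" and ?q' = "x \<otimes> l' \<oplus> y \<otimes> m'"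
    have "(?p, ?p') \<in> lgen z z'"
      by (rule submD(4)[OF S submD(5)[OF S xy(3) 1(1)] submD(5)[OF S xy(4) 2(1)]])
    moreover have "?p \<in> F (Suc n)" "?p' \<in> F (Suc n)" using F1 step.prems by (auto intro!: filt_add filt_mult)
    ultimately have p: "(?p, ?p') \<in> L" by (rule step.IH)
    have q: "(?q, ?q') \<in> L"
      by (rule submD(4)[OF L submD(5)[OF L xy(3) 1(2)] submD(5)[OF L xy(4) 2(2)]])
    have "(?p \<oplus> ?q, ?p' \<oplus> ?q') \<in> L" by (rule submD(4)[OF L p q])
    moreover have "?p \<oplus> ?q = x \<otimes> (k \<oplus> l) \<oplus> y \<otimes> (h \<oplus> m)" using c xy by (simp add: r_distr a_ac)
    moreover have "?p' \<oplus> ?q' = x \<otimes> (k' \<oplus> l') \<oplus> y \<otimes> (h' \<oplus> m')" using c xy by (simp add: r_distr a_ac)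
    ultimately show ?case using xy 1(3,4)[symmetric] 2(3,4)[symmetric] by simp
  qed
  show ?thesis using main[of _ _ 0] filt_0 LC by auto
qed

text \<open>If \<open>K\<close> and \<open>L\<close> together span the module, the decompositions of
  the generators are those required by Nakayama's lemma.\<close>

lemma superfluous_lgen:
  assumes z: "z \<in> carrier A" "z' \<in> carrier A" and idem: "z \<otimes> z = z" "z' \<otimes> z' = z'"
    and K: "subm K" "K \<subseteq> lgen z z'" "K \<subseteq> F 1 \<times> F 1"
  shows "superfluous A (pm (lgen z z')) (\<iota> ` K)"
  unfolding superfluous_def
proof (intro conjI allI impI)
  note S = subm_lgen[OF z]
  note LC = lgen_carrier[OF z]
  show "submodule (\<iota> ` K) A (pm (lgen z z'))" using submodule_pm[OF S] K by auto
  fix N assume N: "submodule N A (pm (lgen z z')) \<and> \<iota> ` K <+>\<^bsub>pm (lgen z z')\<^esub> N = carrier (pm (lgen z z'))"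
  then obtain L where L: "subm L" "L \<subseteq> lgen z z'" "N = \<iota> ` L" using submodule_pm[OF S] by auto
  have KC: "K \<subseteq> carrier A \<times> carrier A" using K(1) by (simp add: subm_def)
  have LLC: "L \<subseteq> carrier A \<times> carrier A" using L(1) by (simp add: subm_def)
  have dec: "\<exists>k k' l l'. (k, k') \<in> K \<and> (l, l') \<in> L \<and> x = k \<oplus> l \<and> y = k' \<oplus> l'"
    if "(x, y) \<in> lgen z z'" for x y
  proof -
    have "\<iota> (x, y) \<in> \<iota> ` K <+>\<^bsub>pm (lgen z z')\<^esub> N" using N that by auto
    then obtain k k' l l' where kl: "(k, k') \<in> K" "(l, l') \<in> L"
       "\<iota> (x, y) = \<iota> (k, k') \<oplus>\<^bsub>pm (lgen z z')\<^esub> \<iota> (l, l')"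
      by (auto simp: set_add_def set_mult_def L(3))
    have c: "k \<in> carrier A" "k' \<in> carrier A" "l \<in> carrier A" "l' \<in> carrier A" "x \<in> carrier A" "y \<in> carrier A"
      using kl(1,2) KC LLC that LC by auto
    then have "\<iota> (x, y) = \<iota> (k \<oplus> l, k' \<oplus> l')" using kl(3) by simp
    then have "x = k \<oplus> l" "y = k' \<oplus> l'" using c by simp_all
    then show ?thesis using kl by blast
  qed
    obtain k k' l l' where 1: "(k, k') \<in> K" "(l, l') \<in> L" "z = k \<oplus> l" "\<zero> = k' \<oplus> l'"
    using dec[OF lgen_fst[OF z]] by blast
  obtain h h' m m' where 2: "(h, h') \<in> K" "(m, m') \<in> L" "\<zero> = h \<oplus> m" "z' = h' \<oplus> m'"
    using dec[OF lgen_snd[OF z]] by blast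
  have "lgen z z' \<subseteq> L"
    by (rule nakayama_lgen[OF z idem L(1) _ 1(2-4) _ 2(2-4)]) (use 1(1) 2(1) K in auto)
  then show "N = carrier (pm (lgen z z'))" using L by auto
qed

end

section \<open>Principal left ideals and right multiplication\<close>

context pair_modules
begin

abbreviation mm :: "'a \<Rightarrow> ('k, 'a) fgmod" where
  "mm z \<equiv> pm (lgen z \<zero>)"

lemma lgen0_iff: "z \<in> carrier A \<Longrightarrow> (x, y) \<in> lgen z \<zero> \<longleftrightarrow> y = \<zero> \<and> (\<exists>a\<in>carrier A. x = a \<otimes> z)"
  unfolding lgen_def by simp (metis r_null)

lemma mm_elem:
  assumes "u \<in> carrier (mm z)" "z \<in> carrier A"
  obtains x where "x \<in> carrier A" "u = \<iota> (x \<otimes> z, \<zero>)"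
  using assms by (auto simp: lgen_def)

lemma mm_mem [simp]: "x \<in> carrier A \<Longrightarrow> z \<in> carrier A \<Longrightarrow> \<iota> (x \<otimes> z, \<zero>) \<in> \<iota> ` lgen z \<zero>"
  by (rule imageI) (auto simp: lgen0_iff)

lemma mm_gen: "z \<in> carrier A \<Longrightarrow> \<iota> (z, \<zero>) \<in> \<iota> ` lgen z \<zero>"
  using mm_mem[of \<one> z] by simp

lemma left_module_mm: "z \<in> carrier A \<Longrightarrow> left_module A (mm z)"
  by (simp add: left_module_pm subm_lgen)

lemma projective_mm: "z \<in> carrier A \<Longrightarrow> z \<otimes> z = z \<Longrightarrow> projective A (mm z)"
  by (simp add: projective_lgen)

lemma fg_module_mm: "z \<in> carrier A \<Longrightarrow> fg_module A (mm z)"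
  by (simp add: fg_module_lgen)

text \<open>The target is left open: the same function serves for every \<open>pm X\<close> that
  contains the image.\<close>

definition rmul :: "'a \<Rightarrow> 'a \<Rightarrow> (nat \<Rightarrow> 'k) \<Rightarrow> (nat \<Rightarrow> 'k)" where
  "rmul z w = lift (lgen z \<zero>) (\<lambda>(x, y). \<iota> (x \<otimes> w, \<zero>))"

lemma rmul_apply:
  assumes "x \<in> carrier A" "z \<in> carrier A" "w \<in> carrier A"
  shows "rmul z w (\<iota> (x \<otimes> z, \<zero>)) = \<iota> (x \<otimes> (z \<otimes> w), \<zero>)"
proof -
  have "(x \<otimes> z, \<zero>) \<in> lgen z \<zero>" using assms by (auto simp: lgen0_iff)
  then show ?thesis unfolding rmul_def using assms lgen_carrier[of z \<zero>] by (simp add: m_assoc)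
qed

lemma rmul_lhom:
  assumes z: "z \<in> carrier A" "w \<in> carrier A" and X: "subm X" "(z \<otimes> w, \<zero>) \<in> X"
  shows "rmul z w \<in> lhom A (mm z) (pm X)"
  unfolding rmul_def
proof (rule lift_lhom[OF subm_lgen[OF z(1) zero_closed]], goal_cases)
  case (1 x y)
  then obtain a where a: "a \<in> carrier A" "x = a \<otimes> z" using z by (auto simp: lgen0_iff)
  then show ?case using submD(5)[OF X(1) a(1) X(2)] z by (simp add: m_assoc)
next
  case (2 x y x' y')
  then have "x \<in> carrier A" "x' \<in> carrier A" using z by (auto simp: lgen0_iff)
  then show ?case using z by (simp add: l_distr)
next
  case (3 a x y)
  then have "x \<in> carrier A" using z by (auto simp: lgen0_iff)
  then show ?case using z 3 by (simp add: m_assoc)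
qed

lemma rmul_image:
  assumes z: "z \<in> carrier A" "w \<in> carrier A"
  shows "rmul z w ` carrier (mm z) = carrier (mm (z \<otimes> w))"
proof (intro equalityI subsetI)
  fix u assume "u \<in> rmul z w ` carrier (mm z)"
  then obtain v where v: "u = rmul z w v" "v \<in> carrier (mm z)" by blast
  obtain x where "x \<in> carrier A" "v = \<iota> (x \<otimes> z, \<zero>)" using v(2) z(1) by (rule mm_elem)
  then show "u \<in> carrier (mm (z \<otimes> w))" using v z by (simp add: rmul_apply)
next
  fix u assume "u \<in> carrier (mm (z \<otimes> w))"
  then obtain x where x: "x \<in> carrier A" "u = \<iota> (x \<otimes> (z \<otimes> w), \<zero>)"
    using m_closed[OF z] by (rule mm_elem)
  then have "u = rmul z w (\<iota> (x \<otimes> z, \<zero>))" using z by (simp add: rmul_apply)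
  moreover have "\<iota> (x \<otimes> z, \<zero>) \<in> carrier (mm z)" using x z by simp
  ultimately show "u \<in> rmul z w ` carrier (mm z)" by (rule image_eqI)
qed

lemma rmul_kernel:
  assumes z: "z \<in> carrier A" "w \<in> carrier A"
  shows "a_kernel (mm z) (pm X) (rmul z w) = \<iota> ` {(x \<otimes> z, \<zero>) | x. x \<in> carrier A \<and> x \<otimes> (z \<otimes> w) = \<zero>}"
    (is "_ = ?R")
proof (intro equalityI subsetI)
  fix u assume "u \<in> a_kernel (mm z) (pm X) (rmul z w)"
  then have u: "u \<in> carrier (mm z)" "rmul z w u = \<iota> (\<zero>, \<zero>)" by (auto simp: a_kernelD)
  obtain x where x: "x \<in> carrier A" "u = \<iota> (x \<otimes> z, \<zero>)" using u(1) z(1) by (rule mm_elem)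
  then show "u \<in> ?R" using u(2) z by (auto simp: rmul_apply)
next
  fix u assume "u \<in> ?R"
  then show "u \<in> a_kernel (mm z) (pm X) (rmul z w)" using z by (auto simp: a_kernelD rmul_apply)
qed

section \<open>Homomorphisms from a principal left ideal to the algebra\<close>

definition ev :: "'a \<Rightarrow> 'a \<Rightarrow> (nat \<Rightarrow> 'k) \<Rightarrow> 'a" where
  "ev z y = lift (lgen z \<zero>) (\<lambda>(x, _). x \<otimes> y)"

lemma ev_apply:
  assumes "x \<in> carrier A" "z \<in> carrier A" "y \<in> carrier A"
  shows "ev z y (\<iota> (x \<otimes> z, \<zero>)) = x \<otimes> (z \<otimes> y)"
proof -
  have "(x \<otimes> z, \<zero>) \<in> lgen z \<zero>" using assms by (auto simp: lgen0_iff)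
  then show ?thesis unfolding ev_def using assms lgen_carrier[of z \<zero>] by (simp add: m_assoc)
qed

lemma ev_extensional: "ev z y \<in> extensional (carrier (mm z))"
  by (simp add: ev_def lift_def)

lemma ev_lhom:
  assumes z: "z \<in> carrier A" "y \<in> carrier A"
  shows "ev z y \<in> lhom A (mm z) (regular A)"
  unfolding ev_def
  by (rule lift_lhom[OF subm_lgen[OF z(1) zero_closed]])
    (use z in \<open>auto simp: lgen0_iff regular_def l_distr m_assoc\<close>)

lemma ev_eqI:
  assumes z: "z \<in> carrier A" and f: "f \<in> extensional (carrier (mm z))"
    and "\<And>x. x \<in> carrier A \<Longrightarrow> f (\<iota> (x \<otimes> z, \<zero>)) = x \<otimes> (z \<otimes> y)" and "y \<in> carrier A"
  shows "f = ev z y"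
proof (rule extensionalityI[OF f ev_extensional])
  fix u assume "u \<in> carrier (mm z)"
  then obtain x where "x \<in> carrier A" "u = \<iota> (x \<otimes> z, \<zero>)" using z by (rule mm_elem)
  then show "f u = ev z y u" using assms by (simp add: ev_apply)
qed

text \<open>The identification Hom(A z, A) = z A for an idempotent z, by evaluation at the
  generator.\<close>

lemma lhom_eq_ev:
  assumes z: "z \<in> carrier A" "z \<otimes> z = z" and f: "f \<in> lhom A (mm z) (regular A)"
  shows "f (\<iota> (z, \<zero>)) \<in> carrier A" "z \<otimes> f (\<iota> (z, \<zero>)) = f (\<iota> (z, \<zero>))" "f = ev z (f (\<iota> (z, \<zero>)))"
proof -
  have g: "\<iota> (z, \<zero>) \<in> carrier (mm z)" using mm_gen z by simp
  show 1: "f (\<iota> (z, \<zero>)) \<in> carrier A" using lhom_closed[OF f g] by (simp add: regular_def)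
  have fx: "f (\<iota> (x \<otimes> z, \<zero>)) = x \<otimes> f (\<iota> (z, \<zero>))" if "x \<in> carrier A" for x
    using lhom_smult[OF f that g] that z by (simp add: regular_def)
  show 2: "z \<otimes> f (\<iota> (z, \<zero>)) = f (\<iota> (z, \<zero>))" using fx[OF z(1)] z by simp
  show "f = ev z (f (\<iota> (z, \<zero>)))"
    by (rule ev_eqI[OF z(1) _ _ 1]) (use f fx 2 in \<open>auto simp: lhom_def PiE_def\<close>)
qed

section \<open>Divisibility in injective modules\<close>

lemma left_module_regular: "left_module A (regular A)"
proof (intro left_module.intro left_module_axioms.intro)
  show "abelian_group (regular A)"
  proof (rule abelian_groupI)
    fix x assume "x \<in> carrier (regular A)"
    then show "\<exists>y\<in>carrier (regular A). y \<oplus>\<^bsub>regular A\<^esub> x = \<zero>\<^bsub>regular A\<^esub>"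
      by (intro bexI[of _ "\<ominus> x"]) (auto simp: regular_def l_neg)
  qed (auto simp: regular_def a_ac)
qed (auto simp: regular_def l_distr r_distr m_assoc ring_axioms)

text \<open>Baer's criterion for the left ideal A a: the annihilator condition makes x a \<mapsto> x
  w well defined, and an extension to A sends 1 to the required quotient.\<close>

lemma injective_divides:
  assumes J: "injective A J" and a: "a \<in> carrier A" and w: "w \<in> carrier J"
    and ann: "\<And>x. x \<in> carrier A \<Longrightarrow> x \<otimes> a = \<zero> \<Longrightarrow> x \<odot>\<^bsub>J\<^esub> w = \<zero>\<^bsub>J\<^esub>"
  obtains z where "z \<in> carrier J" "a \<odot>\<^bsub>J\<^esub> z = w"
proof -
  interpret J: left_module A J using J by (simp add: injective_def fg_module_def)
  let ?U = "mm a" and ?V = "mm \<one>"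
  have sV: "subm (lgen \<one> \<zero>)" by (simp add: subm_lgen)
  \<comment> \<open>\<open>?F\<close> picks some x with x a = b; any two choices differ by an
    element that kills a, hence w.\<close>
  let ?F = "\<lambda>(b, _::'a). (SOME x. x \<in> carrier A \<and> x \<otimes> a = b) \<odot>\<^bsub>J\<^esub> w"
  have F: "?F (x \<otimes> a, y) = x \<odot>\<^bsub>J\<^esub> w" if x: "x \<in> carrier A" for x y
  proof -
    let ?x = "SOME x'. x' \<in> carrier A \<and> x' \<otimes> a = x \<otimes> a"
    have x': "?x \<in> carrier A \<and> ?x \<otimes> a = x \<otimes> a" by (rule someI[of _ x]) (use x in simp)
    then have "(?x \<ominus> x) \<otimes> a = \<zero>" using x a by (simp add: minus_eq l_distr l_minus r_neg)
    then have "(?x \<ominus> x) \<odot>\<^bsub>J\<^esub> w = \<zero>\<^bsub>J\<^esub>" using x x' by (intro ann) auto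
    moreover have "?x \<odot>\<^bsub>J\<^esub> w = (?x \<ominus> x) \<odot>\<^bsub>J\<^esub> w \<oplus>\<^bsub>J\<^esub> x \<odot>\<^bsub>J\<^esub> w"
    proof -
      have "?x = (?x \<ominus> x) \<oplus> x" using x x' by (simp add: minus_eq a_assoc l_neg)
      then show ?thesis using J.smult_l_distr[of "?x \<ominus> x" x w] x x' w by simp
    qed
    ultimately show ?thesis using x w by (simp add: J.smult_closed)
  qed
  let ?f = "lift (lgen a \<zero>) ?F"
  \<comment> \<open>The inclusion of A a into A.\<close>
  let ?g = "lift (lgen a \<zero>) \<iota>"
  have f: "?f \<in> lhom A ?U J"
  proof (rule lift_lhom[OF subm_lgen[OF a zero_closed]], goal_cases)
    case (1 x y)
    then show ?case using F w by (auto simp: lgen0_iff[OF a] J.smult_closed simp del: split_conv)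
  next
    case (2 x y x' y')
    then obtain b b' where b: "b \<in> carrier A" "b' \<in> carrier A" "x = b \<otimes> a" "x' = b' \<otimes> a"
      by (auto simp: lgen0_iff[OF a])
    then have "x \<oplus> x' = (b \<oplus> b') \<otimes> a" using a by (simp add: l_distr)
    then show ?case using F[of b] F[of b'] F[of "b \<oplus> b'"] b w by (simp add: J.smult_l_distr del: split_conv)
  next
    case (3 c x y)
    then obtain b where b: "b \<in> carrier A" "x = b \<otimes> a" by (auto simp: lgen0_iff[OF a])
    then have "c \<otimes> x = (c \<otimes> b) \<otimes> a" using a 3 by (simp add: m_assoc)
    then show ?case using F[of b] F[of "c \<otimes> b"] b w 3 by (simp add: J.smult_assoc del: split_conv)
  qed
  have g: "?g \<in> lhom A ?U ?V"
    by (rule lift_lhom[OF subm_lgen[OF a zero_closed]]) (use a in \<open>auto simp: lgen0_iff intro!: imageI\<close>)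
  have "inj_on ?g (carrier ?U)"
    using a by (intro inj_onI) (auto elim!: mm_elem simp: lgen_carrier lgen0_iff)
  then obtain h where h: "h \<in> lhom A ?V J" "\<forall>x\<in>carrier ?U. h (?g x) = ?f x"
    using J f g fg_module_mm[OF a] fg_module_mm[OF one_closed] unfolding injective_def by blast
  have 1: "\<iota> (\<one>, \<zero>) \<in> carrier ?V" using mm_gen[of \<one>] by simp
  show ?thesis
  proof (rule that)
    show "h (\<iota> (\<one>, \<zero>)) \<in> carrier J" using lhom_closed[OF h(1) 1] .
    have "a \<odot>\<^bsub>J\<^esub> h (\<iota> (\<one>, \<zero>)) = h (\<iota> (a, \<zero>))" using lhom_smult[OF h(1) a 1] a by simp
    also have "\<dots> = ?f (\<iota> (a, \<zero>))"
      using h(2) mm_gen[OF a] a lgen_fst[OF a zero_closed] lgen_carrier[OF a zero_closed] by (auto dest!: bspec)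
    also have "\<dots> = ?F (\<one> \<otimes> a, \<zero>)" using a lgen_fst[OF a zero_closed] lgen_carrier[OF a zero_closed] by simp
    also have "\<dots> = w" using F[of \<one> \<zero>] w by (simp add: J.smult_one del: split_conv)
    finally show "a \<odot>\<^bsub>J\<^esub> h (\<iota> (\<one>, \<zero>)) = w" .
  qed
qed

text \<open>Vanishing of \<open>Ext\<^sup>2(A / A b, A)\<close>, unravelled by dimension shifting along the injective
  resolution; \<open>A a\<close> is a projective second syzygy of \<open>A / A b\<close>.\<close>

lemma inj_dim_le_1_divides:
  assumes res: "inj_resolution A (regular A) J d h" and triv: "\<And>m. m > 1 \<Longrightarrow> carrier (J m) = {\<zero>\<^bsub>J m\<^esub>}"
    and c: "a \<in> carrier A" "b \<in> carrier A" "e \<in> carrier A" "u \<in> carrier A"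
    and ab: "a \<otimes> b = \<zero>" "a \<otimes> e = a" "e \<otimes> b = b"
    and ker_b: "\<And>x. x \<in> carrier A \<Longrightarrow> x \<otimes> b = \<zero> \<Longrightarrow> \<exists>y\<in>carrier A. x \<otimes> e = y \<otimes> a"
    and ker_a: "\<And>x. x \<in> carrier A \<Longrightarrow> x \<otimes> a = \<zero> \<Longrightarrow> x \<otimes> u = \<zero>"
  shows "\<exists>y\<in>carrier A. a \<otimes> y = u"
proof -
  have inj: "injective A (J n)" for n using res by (simp add: inj_resolution_def)
  interpret J0: left_module A "J 0" using inj[of 0] by (simp add: injective_def fg_module_def)
  interpret J1: left_module A "J 1" using inj[of 1] by (simp add: injective_def fg_module_def)
  have h: "h \<in> lhom A (regular A) (J 0)" "inj_on h (carrier (regular A))"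
    and d: "d 0 \<in> lhom A (J 0) (J 1)"
    and ex0: "h ` carrier (regular A) = a_kernel (J 0) (J 1) (d 0)"
    and ex1: "d 0 ` carrier (J 0) = a_kernel (J 1) (J 2) (d 1)"
    and d1: "d 1 \<in> lhom A (J 1) (J 2)"
    using res by (auto simp: inj_resolution_def numeral_2_eq_2)
  have hc: "h x \<in> carrier (J 0)" if "x \<in> carrier A" for x
    using lhom_closed[OF h(1)] that by (simp add: regular_def)
  have hs: "h (x \<otimes> y) = x \<odot>\<^bsub>J 0\<^esub> h y" if "x \<in> carrier A" "y \<in> carrier A" for x y
    using lhom_smult[OF h(1)] that by (simp add: regular_def)
  have dc: "d 0 x \<in> carrier (J 1)" if "x \<in> carrier (J 0)" for x
    using lhom_closed[OF d] that by simp
  \<comment> \<open>The resolution stops after \<open>J 1\<close>, so exactness there makes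
    \<open>d 0\<close> surjective.\<close>
  have onto: "d 0 ` carrier (J 0) = carrier (J 1)"
    unfolding ex1 using lhom_closed[OF d1] triv[of 2] by (auto simp: a_kernelD)
  have h0: "h \<zero> = \<zero>\<^bsub>J 0\<^esub>"
    using lhom_zero[OF left_module_regular J0.left_module_axioms h(1)] by (simp add: regular_def)
  have dh: "d 0 (h x) = \<zero>\<^bsub>J 1\<^esub>" if "x \<in> carrier A" for x
    using ex0 that by (auto simp: a_kernelD regular_def)
  \<comment> \<open>The map x a \<mapsto> h (x u) extends from A a to A because \<open>J 0\<close>
    is injective; \<open>j\<close> is the image of 1.\<close>
  obtain j where j: "j \<in> carrier (J 0)" "a \<odot>\<^bsub>J 0\<^esub> j = h u"
  proof (rule injective_divides[OF inj c(1) hc[OF c(4)]])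
    fix x assume "x \<in> carrier A" "x \<otimes> a = \<zero>"
    then show "x \<odot>\<^bsub>J 0\<^esub> h u = \<zero>\<^bsub>J 0\<^esub>" using hs[of x u] c ker_a[of x] h0 by simp
  qed
  \<comment> \<open>With the factor \<open>e\<close>, the action of x on \<open>w\<close> is that of
    x e on \<open>j\<close>, and x e lies in A a as soon as x b = 0.\<close>
  define w where "w = e \<odot>\<^bsub>J 0\<^esub> j"
  have w: "w \<in> carrier (J 0)" using c j by (simp add: w_def J0.smult_closed)
  have aw: "a \<odot>\<^bsub>J 0\<^esub> w = h u" using c j ab by (simp add: w_def J0.smult_assoc[symmetric])
  have "x \<odot>\<^bsub>J 1\<^esub> d 0 w = \<zero>\<^bsub>J 1\<^esub>" if x: "x \<in> carrier A" "x \<otimes> b = \<zero>" for x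
  proof -
    obtain y where y: "y \<in> carrier A" "x \<otimes> e = y \<otimes> a" using ker_b[OF x] by blast
    have "x \<odot>\<^bsub>J 1\<^esub> d 0 w = d 0 ((x \<otimes> e) \<odot>\<^bsub>J 0\<^esub> j)"
      using x c j w by (simp add: lhom_smult[OF d] J0.smult_assoc w_def)
    also have "(x \<otimes> e) \<odot>\<^bsub>J 0\<^esub> j = h (y \<otimes> u)" using y c j by (simp add: J0.smult_assoc hs)
    finally show ?thesis using dh y c by simp
  qed
  \<comment> \<open>Whatever kills \<open>b\<close> kills \<open>d 0 w\<close>, so
    \<open>d 0 w\<close> is divisible by \<open>b\<close>. A preimage \<open>i\<close> of the
    quotient puts w - b i into the image of \<open>h\<close>, and multiplication by \<open>a\<close>
    removes the term b i.\<close>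
  then obtain z where z: "z \<in> carrier (J 1)" "b \<odot>\<^bsub>J 1\<^esub> z = d 0 w"
    using injective_divides[OF inj c(2) dc[OF w]] by blast
  then obtain i where i: "i \<in> carrier (J 0)" "z = d 0 i" using onto by (metis imageE)
  have bi: "b \<odot>\<^bsub>J 0\<^esub> i \<in> carrier (J 0)" using c i by (simp add: J0.smult_closed)
  let ?v = "\<ominus>\<^bsub>J 0\<^esub> (b \<odot>\<^bsub>J 0\<^esub> i)"
  have vc: "?v \<in> carrier (J 0)" using bi by simp
  have "d 0 w \<oplus>\<^bsub>J 1\<^esub> d 0 ?v = d 0 (b \<odot>\<^bsub>J 0\<^esub> i) \<oplus>\<^bsub>J 1\<^esub> d 0 ?v" using z i c by (simp add: lhom_smult[OF d])
  also have "\<dots> = d 0 (b \<odot>\<^bsub>J 0\<^esub> i \<oplus>\<^bsub>J 0\<^esub> ?v)" by (rule lhom_add[OF d bi vc, symmetric])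
  also have "\<dots> = d 0 (\<zero>\<^bsub>J 0\<^esub>)" using bi by (simp add: J0.M.r_neg)
  also have "\<dots> = \<zero>\<^bsub>J 1\<^esub>" by (rule lhom_zero[OF J0.left_module_axioms J1.left_module_axioms d])
  finally have "w \<oplus>\<^bsub>J 0\<^esub> ?v \<in> a_kernel (J 0) (J 1) (d 0)"
    using w vc by (simp add: a_kernelD lhom_add[OF d])
  then have "w \<oplus>\<^bsub>J 0\<^esub> ?v \<in> h ` carrier A" using ex0 by (simp add: regular_def)
  then obtain y where y: "y \<in> carrier A" "h y = w \<oplus>\<^bsub>J 0\<^esub> ?v" by (metis imageE)
  have wy: "w = h y \<oplus>\<^bsub>J 0\<^esub> b \<odot>\<^bsub>J 0\<^esub> i" using y w bi by (simp add: J0.M.a_assoc J0.M.l_neg)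
  have "h u = a \<odot>\<^bsub>J 0\<^esub> h y \<oplus>\<^bsub>J 0\<^esub> (a \<otimes> b) \<odot>\<^bsub>J 0\<^esub> i"
  proof -
    have "h u = a \<odot>\<^bsub>J 0\<^esub> (h y \<oplus>\<^bsub>J 0\<^esub> b \<odot>\<^bsub>J 0\<^esub> i)" using aw wy by metis
    then show ?thesis using J0.smult_r_distr[OF c(1) hc[OF y(1)] bi] J0.smult_assoc[OF c(1,2) i(1)] by simp
  qed
  also have "\<dots> = h (a \<otimes> y)" using ab c y(1) i hc by (simp add: J0.smult_zero_l hs J0.smult_closed)
  finally have "h u = h (a \<otimes> y)" .
  then have "u = a \<otimes> y" using inj_onD[OF h(2), of u "a \<otimes> y"] c y by (simp add: regular_def)
  then show ?thesis using y by auto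
qed

text \<open>By \<open>exl\<close> the right multiplications by the \<open>b n\<close> form a
  projective resolution. Under Hom(A s, A) = s A its dual consists of left multiplications by the
  same elements, and \<open>exr\<close> is the exactness of that complex.\<close>

lemma cohen_macaulay_mm:
  fixes b s :: "nat \<Rightarrow> 'a"
  assumes c: "\<And>n. b n \<in> carrier A" "\<And>n. s n \<in> carrier A"
    and idem: "\<And>n. s n \<otimes> s n = s n" and sb: "\<And>n. s n \<otimes> b n = b n"
    and bs: "\<And>n. b (Suc n) \<otimes> s n = b (Suc n)" and bb: "\<And>n. b (Suc n) \<otimes> b n = \<zero>"
    and exl: "\<And>n x. x \<in> carrier A \<Longrightarrow> x \<otimes> b n = \<zero> \<Longrightarrow> \<exists>y\<in>carrier A. x \<otimes> s n = y \<otimes> b (Suc n)"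
    and exr: "\<And>n y. y \<in> carrier A \<Longrightarrow> b (Suc n) \<otimes> y = \<zero> \<Longrightarrow> \<exists>z\<in>carrier A. s n \<otimes> y = b n \<otimes> z"
  shows "cohen_macaulay A (mm (b 0))"
proof -
  define P where "P n = mm (s n)" for n
  define d where "d n = rmul (s (Suc n)) (b (Suc n))" for n
  define e where "e = rmul (s 0) (b 0)"
  have ker: "a_kernel (mm (s n)) (pm X) (rmul (s n) (b n)) = carrier (mm (b (Suc n)))" for n X
  proof -
    have "{(x \<otimes> s n, \<zero>) | x. x \<in> carrier A \<and> x \<otimes> (s n \<otimes> b n) = \<zero>} = lgen (b (Suc n)) \<zero>"
    proof (intro equalityI subsetI)
      fix w assume "w \<in> {(x \<otimes> s n, \<zero>) | x. x \<in> carrier A \<and> x \<otimes> (s n \<otimes> b n) = \<zero>}"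
      then obtain x where x: "x \<in> carrier A" "w = (x \<otimes> s n, \<zero>)" "x \<otimes> b n = \<zero>" by (auto simp: sb)
      then show "w \<in> lgen (b (Suc n)) \<zero>" using exl[OF x(1,3)] c(1) by (simp add: lgen0_iff)
    next
      fix w assume "w \<in> lgen (b (Suc n)) \<zero>"
      then obtain y where y: "y \<in> carrier A" "w = (y \<otimes> b (Suc n), \<zero>)" using c by (auto simp: lgen_def)
      have "y \<otimes> b (Suc n) = (y \<otimes> b (Suc n)) \<otimes> s n" using y c by (simp add: m_assoc bs)
      moreover have "(y \<otimes> b (Suc n)) \<otimes> (s n \<otimes> b n) = \<zero>" using y c by (simp add: m_assoc sb bb)
      moreover have "y \<otimes> b (Suc n) \<in> carrier A" using y c by simp
      ultimately show "w \<in> {(x \<otimes> s n, \<zero>) | x. x \<in> carrier A \<and> x \<otimes> (s n \<otimes> b n) = \<zero>}"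
        unfolding y(2) by blast
    qed
    then show ?thesis using c by (simp add: rmul_kernel)
  qed
  have img: "rmul (s n) (b n) ` carrier (mm (s n)) = carrier (mm (b n))" for n
    using rmul_image[OF c(2,1), of n n] by (simp add: sb)
  have res: "proj_resolution A (mm (b 0)) P d e"
    unfolding proj_resolution_def
  proof (intro conjI allI)
    fix n
    show "projective A (P n)" unfolding P_def by (rule projective_mm[OF c(2) idem])
    show "d n \<in> lhom A (P (Suc n)) (P n)" unfolding P_def d_def
    proof (rule rmul_lhom[OF c(2,1) subm_lgen[OF c(2) zero_closed]])
      show "(s (Suc n) \<otimes> b (Suc n), \<zero>) \<in> lgen (s n) \<zero>"
        using c bs[of n] by (auto simp: lgen0_iff sb intro!: bexI[of _ "b (Suc n)"])
    qed
    show "d (Suc n) ` carrier (P (Suc (Suc n))) = a_kernel (P (Suc n)) (P n) (d n)"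
      unfolding P_def d_def using img ker by simp
  next
    show "e \<in> lhom A (P 0) (mm (b 0))" unfolding P_def e_def
      by (rule rmul_lhom[OF c(2,1) subm_lgen[OF c(1) zero_closed]]) (use c in \<open>auto simp: sb intro: lgen_fst\<close>)
    show "e ` carrier (P 0) = carrier (mm (b 0))" unfolding P_def e_def by (rule img)
    show "d 0 ` carrier (P 1) = a_kernel (P 0) (mm (b 0)) e"
      unfolding P_def d_def e_def using img ker by simp
  qed
  have "ext_vanishes A i (mm (b 0)) (regular A)" if i: "i > 0" for i
    unfolding ext_vanishes_def
  proof (intro exI conjI subsetI, rule res)
    fix f assume "f \<in> {f \<in> lhom A (P i) (regular A). \<forall>x\<in>carrier (P (i + 1)). f (d i x) = \<zero>\<^bsub>regular A\<^esub>}"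
    then have f: "f \<in> lhom A (mm (s i)) (regular A)" and f0: "\<forall>x\<in>carrier (mm (s (Suc i))). f (d i x) = \<zero>"
      by (auto simp: P_def regular_def)
    \<comment> \<open>The cocycle \<open>f\<close> corresponds to \<open>y\<close> in s A; the
      cocycle condition becomes \<open>b (Suc i) \<otimes> y = \<zero>\<close>.\<close>
    define y where "y = f (\<iota> (s i, \<zero>))"
    note fy = lhom_eq_ev[OF c(2) idem f, folded y_def]
    obtain n where n: "i = Suc n" using i by (cases i) auto
    have "b (Suc i) \<otimes> y = \<zero>"
    proof -
      have "f (d i (\<iota> (s (Suc i), \<zero>))) = \<zero>" using f0 mm_gen[OF c(2), of "Suc i"] by (metis pm_simps(1))
      moreover have "d i (\<iota> (s (Suc i), \<zero>)) = \<iota> (b (Suc i) \<otimes> s i, \<zero>)"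
        using rmul_apply[OF one_closed c(2,1), of "Suc i" "Suc i"] c by (simp add: d_def sb bs)
      moreover have "f (\<iota> (b (Suc i) \<otimes> s i, \<zero>)) = b (Suc i) \<otimes> y"
        using ev_apply[OF c(1)[of "Suc i"] c(2)[of i] fy(1)] fy(2,3) by metis
      ultimately show ?thesis by simp
    qed
    then obtain z where z: "z \<in> carrier A" "s i \<otimes> y = b i \<otimes> z" using exr fy(1) by blast
    have yz: "y = b i \<otimes> z" using z fy by simp
    \<comment> \<open>Since y = b z with b = \<open>b i\<close>, the cocycle is the coboundary of
      the homomorphism given by \<open>z\<close>.\<close>
    have "f = compose (carrier (P i)) (ev (s n) z) (d n)"
    proof -
      have "compose (carrier (P i)) (ev (s n) z) (d n) = ev (s i) y"
      proof (rule ev_eqI[OF c(2) _ _ fy(1)])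
        fix x assume x: "x \<in> carrier A"
        have "d n (\<iota> (x \<otimes> s i, \<zero>)) = \<iota> ((x \<otimes> b i) \<otimes> s n, \<zero>)"
          using x c bs[of n] by (simp add: d_def n rmul_apply sb m_assoc)
        then have "compose (carrier (P i)) (ev (s n) z) (d n) (\<iota> (x \<otimes> s i, \<zero>)) = (x \<otimes> b i) \<otimes> (s n \<otimes> z)"
          using x c z by (simp add: compose_def P_def ev_apply)
        also have "\<dots> = x \<otimes> ((b i \<otimes> s n) \<otimes> z)" using x c z by (simp add: m_assoc)
        also have "\<dots> = x \<otimes> (s i \<otimes> y)" using z n bs[of n] by simp
        finally show "compose (carrier (P i)) (ev (s n) z) (d n) (\<iota> (x \<otimes> s i, \<zero>)) = x \<otimes> (s i \<otimes> y)" .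
      qed (simp add: compose_def P_def)
      then show ?thesis using fy by simp
    qed
    moreover have "ev (s n) z \<in> lhom A (P (i - 1)) (regular A)" "i - 1 = n"
      using ev_lhom[OF c(2) z(1), of n] by (simp_all add: n P_def)
    ultimately show "f \<in> {compose (carrier (P i)) g (d (i - 1)) |g. g \<in> lhom A (P (i - 1)) (regular A)}"
      by blast
  qed
  then show ?thesis unfolding cohen_macaulay_def using fg_module_mm[OF c(1)] by auto
qed

end

section \<open>Covering the Auslander-Reiten translate\<close>

text \<open>
  Here \<open>A z \<rightarrow> A z0\<close>, right multiplication by \<open>a\<close>, presents a module \<open>M\<close>. Since \<open>Hom(A z, A) = z A\<close>,
  the transpose of \<open>M\<close> is \<open>z A / a A\<close>, and an element \<open>x\<close> of \<open>A v\<close> gives the functional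
  \<open>y \<mapsto> \<phi> (y x)\<close> on it. By assumption \<open>phi_repr\<close> every functional arises in this way.
\<close>

locale minimal_presentation = pair_modules A \<iota>
  for A :: "('k::field, 'a) module" (structure) and \<iota> +
  fixes z z0 a v :: 'a and \<phi> :: "'a \<Rightarrow> 'k"
  assumes c: "z \<in> carrier A" "z0 \<in> carrier A" "a \<in> carrier A" "v \<in> carrier A"
    and idem: "z \<otimes> z = z" "z0 \<otimes> z0 = z0" "v \<otimes> v = v"
    and za: "z \<otimes> a = a" and az: "a \<otimes> z0 = a"
    and scal_closed: "\<And>t. t \<odot>\<^bsub>A\<^esub> \<one> \<in> carrier A"
    and phi_add: "\<And>x y. x \<in> carrier A \<Longrightarrow> y \<in> carrier A \<Longrightarrow> \<phi> (x \<oplus> y) = \<phi> x + \<phi> y"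
    and phi_a: "\<And>y. y \<in> carrier A \<Longrightarrow> \<phi> (a \<otimes> y) = 0"
    and phi_scal: "\<And>t x y. x \<in> carrier A \<Longrightarrow> y \<in> carrier A \<Longrightarrow> \<phi> ((y \<otimes> (t \<odot>\<^bsub>A\<^esub> \<one>)) \<otimes> x) = t * \<phi> (y \<otimes> x)"
    and phi_repr: "\<And>G. \<lbrakk>\<And>x y. x \<in> carrier A \<Longrightarrow> y \<in> carrier A \<Longrightarrow> G (x \<oplus> y) = G x + G y;
       \<And>y. y \<in> carrier A \<Longrightarrow> G (a \<otimes> y) = 0;
       \<And>t y. y \<in> carrier A \<Longrightarrow> G (y \<otimes> (t \<odot>\<^bsub>A\<^esub> \<one>)) = t * G y;
       \<And>y. y \<in> carrier A \<Longrightarrow> G (z \<otimes> y) = G y\<rbrakk>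
       \<Longrightarrow> \<exists>x\<in>carrier A. \<forall>y\<in>carrier A. G y = \<phi> (z \<otimes> y \<otimes> x) \<and> x \<otimes> v = x"
begin

section \<open>The transpose as a quotient of right ideals\<close>

abbreviation "H \<equiv> hom_dual A (mm z)"

definition "N = (\<lambda>f. compose (carrier (mm z)) f (rmul z a)) ` carrier (hom_dual A (mm z0))"

abbreviation "Tr \<equiv> transpose_of A (mm z) (rmul z a) (mm z0)"

lemma ev_in_H: "y \<in> carrier A \<Longrightarrow> ev z y \<in> carrier H"
  by (simp add: hom_dual_def ev_lhom c)

lemma H_elem:
  assumes "f \<in> carrier H" obtains y where "y \<in> carrier A" "f = ev z y"
  using lhom_eq_ev[OF c(1) idem(1), of f] assms by (auto simp: hom_dual_def)

lemma ev_gen: "y \<in> carrier A \<Longrightarrow> ev z y (\<iota> (z, \<zero>)) = z \<otimes> y"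
  using ev_apply[OF one_closed c(1), of y] c by simp

lemma H_add:
  assumes y: "y \<in> carrier A" "y' \<in> carrier A"
  shows "ev z y \<oplus>\<^bsub>H\<^esub> ev z y' = ev z (y \<oplus> y')"
proof (rule ev_eqI[OF c(1)])
  fix x assume "x \<in> carrier A"
  then show "(ev z y \<oplus>\<^bsub>H\<^esub> ev z y') (\<iota> (x \<otimes> z, \<zero>)) = x \<otimes> (z \<otimes> (y \<oplus> y'))"
    using c y by (simp add: hom_dual_def ev_apply r_distr)
qed (use y in \<open>auto simp: hom_dual_def\<close>)

lemma H_zero: "\<zero>\<^bsub>H\<^esub> = ev z \<zero>"
  by (rule ev_eqI[OF c(1)]) (use c in \<open>auto simp: hom_dual_def\<close>)

lemma H_smult:
  assumes y: "y \<in> carrier A" "b \<in> carrier A"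
  shows "b \<odot>\<^bsub>H\<^esub> ev z y = ev z (y \<otimes> b)"
proof (rule ev_eqI[OF c(1)])
  fix x assume "x \<in> carrier A"
  then show "(b \<odot>\<^bsub>H\<^esub> ev z y) (\<iota> (x \<otimes> z, \<zero>)) = x \<otimes> (z \<otimes> (y \<otimes> b))"
    using c y by (simp add: hom_dual_def ev_apply m_assoc)
qed (use y in \<open>auto simp: hom_dual_def\<close>)

lemma H_group: "abelian_group H"
proof (rule abelian_groupI, goal_cases)
  case (1 x y) then show ?case by (elim H_elem) (simp add: H_add ev_in_H)
next
  case 2 show ?case by (simp add: H_zero ev_in_H)
next
  case (3 x y z) then show ?case by (elim H_elem) (simp add: H_add a_assoc)
next
  case (4 x y) then show ?case by (elim H_elem) (simp add: H_add a_comm)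
next
  case (5 x) then show ?case by (elim H_elem) (simp add: H_add H_zero)
next
  case (6 x)
  then obtain y where "y \<in> carrier A" "x = ev z y" by (rule H_elem)
  then show ?case by (intro bexI[of _ "ev z (\<ominus> y)"]) (simp_all add: H_add H_zero l_neg ev_in_H)
qed

text \<open>In terms of Hom(A z, A) = z A the denominator of the transpose is the right ideal a
  A.\<close>

lemma N_eq: "N = (\<lambda>y. ev z (a \<otimes> y)) ` carrier A"
proof -
  have 1: "compose (carrier (mm z)) (ev z0 y) (rmul z a) = ev z (a \<otimes> y)" if y: "y \<in> carrier A" for y
  proof (rule ev_eqI[OF c(1)])
    fix x assume x: "x \<in> carrier A"
    have "rmul z a (\<iota> (x \<otimes> z, \<zero>)) = \<iota> ((x \<otimes> a) \<otimes> z0, \<zero>)" using x c by (simp add: rmul_apply za az m_assoc)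
    then have "compose (carrier (mm z)) (ev z0 y) (rmul z a) (\<iota> (x \<otimes> z, \<zero>)) = (x \<otimes> a) \<otimes> (z0 \<otimes> y)"
      using x c y by (simp add: compose_def ev_apply)
    also have "\<dots> = x \<otimes> ((a \<otimes> z0) \<otimes> y)" using x c y by (simp add: m_assoc)
    also have "\<dots> = x \<otimes> (z \<otimes> (a \<otimes> y))" using x c y by (simp add: az za m_assoc[symmetric])
    finally show "compose (carrier (mm z)) (ev z0 y) (rmul z a) (\<iota> (x \<otimes> z, \<zero>)) = x \<otimes> (z \<otimes> (a \<otimes> y))" .
  qed (use c y in \<open>auto simp: compose_def\<close>)
  have 2: "carrier (hom_dual A (mm z0)) = ev z0 ` carrier A"
  proof (intro equalityI subsetI)
    fix f assume "f \<in> carrier (hom_dual A (mm z0))"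
    then have "f \<in> lhom A (mm z0) (regular A)" by (simp add: hom_dual_def)
    from lhom_eq_ev(3,1)[OF c(2) idem(2) this] show "f \<in> ev z0 ` carrier A" by (rule image_eqI)
  qed (use ev_lhom[OF c(2)] in \<open>auto simp: hom_dual_def\<close>)
  show ?thesis unfolding N_def 2 image_image by (rule image_cong[OF refl 1])
qed

lemma N_subgroup: "abelian_subgroup N H"
proof -
  interpret H: abelian_group H by (rule H_group)
  show ?thesis
  proof (rule abelian_subgroupI3[OF _ H_group])
    show "additive_subgroup N H"
    proof (intro additive_subgroup.intro subgroup.intro)
      show "N \<subseteq> carrier (add_monoid H)" using c by (auto simp: N_eq intro!: ev_in_H)
      show "\<one>\<^bsub>add_monoid H\<^esub> \<in> N" using c by (auto simp: N_eq H_zero intro!: image_eqI[of _ _ \<zero>])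
    next
      fix f g assume "f \<in> N" "g \<in> N"
      then obtain y y' where "y \<in> carrier A" "y' \<in> carrier A" "f = ev z (a \<otimes> y)" "g = ev z (a \<otimes> y')"
        by (auto simp: N_eq)
      then show "f \<otimes>\<^bsub>add_monoid H\<^esub> g \<in> N"
        using c by (auto simp: H_add N_eq r_distr intro!: image_eqI[of _ _ "y \<oplus> y'"])
    next
      fix f assume "f \<in> N"
      then obtain y where y: "y \<in> carrier A" "f = ev z (a \<otimes> y)" by (auto simp: N_eq)
      have "\<ominus>\<^bsub>H\<^esub> f = ev z (a \<otimes> (\<ominus> y))"
        using y c by (intro H.minus_equality) (simp_all add: H_add H_zero ev_in_H r_distr[symmetric] l_neg)
      then show "inv\<^bsub>add_monoid H\<^esub> f \<in> N" using y by (simp add: a_inv_def N_eq)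
    qed
  qed
qed

definition cls :: "'a \<Rightarrow> ((nat \<Rightarrow> 'k) \<Rightarrow> 'a) set" where
  "cls y = N +>\<^bsub>H\<^esub> ev z y"

lemma Tr_eq: "Tr = quot H N"
  by (simp only: transpose_of_def N_def)

lemma carrier_Tr: "carrier Tr = cls ` carrier A"
proof -
  have "carrier Tr = (\<lambda>f. N +>\<^bsub>H\<^esub> f) ` carrier H"
    unfolding Tr_eq by (auto simp: quot_def FactRing_def A_RCOSETS_def RCOSETS_def a_r_coset_def)
  also have "carrier H = ev z ` carrier A" using H_elem ev_in_H by (auto elim!: H_elem)
  finally show ?thesis by (simp add: image_image cls_def)
qed

lemma cls_add: "y \<in> carrier A \<Longrightarrow> y' \<in> carrier A \<Longrightarrow> cls y \<oplus>\<^bsub>Tr\<^esub> cls y' = cls (y \<oplus> y')"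
  using abelian_subgroup.a_rcos_sum[OF N_subgroup ev_in_H ev_in_H, of y y']
  unfolding Tr_eq by (simp add: quot_def FactRing_def cls_def H_add)

lemma cls_memD:
  assumes y: "y \<in> carrier A" and f: "f \<in> cls y"
  obtains y' where "y' \<in> carrier A" "f = ev z (a \<otimes> y' \<oplus> y)"
proof -
  obtain g where "g \<in> N" "f = g \<oplus>\<^bsub>H\<^esub> ev z y"
    using f by (auto simp: cls_def a_r_coset_def r_coset_def)
  then obtain y' where "y' \<in> carrier A" "f = ev z (a \<otimes> y') \<oplus>\<^bsub>H\<^esub> ev z y" by (auto simp: N_eq)
  then show ?thesis using that[of y'] y c by (simp add: H_add)
qed

lemma cls_self: "y \<in> carrier A \<Longrightarrow> ev z y \<in> cls y"
  using abelian_subgroup.a_rcos_self[OF N_subgroup ev_in_H] by (simp add: cls_def)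

lemma cls_shift:
  assumes "y \<in> carrier A" "y' \<in> carrier A" shows "cls (a \<otimes> y' \<oplus> y) = cls y"
proof -
  have "ev z (a \<otimes> y' \<oplus> y) \<in> N +>\<^bsub>H\<^esub> ev z y"
    unfolding a_r_coset_def r_coset_def using assms c by (auto simp: N_eq H_add)
  then show ?thesis
    using abelian_subgroup.a_repr_independence'[OF N_subgroup _ ev_in_H[OF assms(1)]]
    by (simp add: cls_def)
qed

text \<open>The scalar action of \<open>quot\<close> is a union over all representatives of the
  coset. The members of this union coincide because a A is a right ideal.\<close>

lemma cls_smult:
  assumes y: "y \<in> carrier A" and b: "b \<in> carrier A"
  shows "b \<odot>\<^bsub>Tr\<^esub> cls y = cls (y \<otimes> b)"
proof -
  have "N +>\<^bsub>H\<^esub> (b \<odot>\<^bsub>H\<^esub> f) = cls (y \<otimes> b)" if "f \<in> cls y" for f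
  proof -
    obtain y' where y': "y' \<in> carrier A" "f = ev z (a \<otimes> y' \<oplus> y)" using cls_memD[OF y \<open>f \<in> cls y\<close>] by metis
    have "N +>\<^bsub>H\<^esub> (b \<odot>\<^bsub>H\<^esub> f) = cls (a \<otimes> (y' \<otimes> b) \<oplus> y \<otimes> b)"
      using y' y b c by (simp add: H_smult l_distr m_assoc cls_def)
    then show ?thesis using cls_shift y y' b by simp
  qed
  then have "(\<Union>f\<in>cls y. N +>\<^bsub>H\<^esub> (b \<odot>\<^bsub>H\<^esub> f)) = cls (y \<otimes> b)" using cls_self[OF y] by auto
  then show ?thesis unfolding Tr_eq by (simp add: quot_def)
qed

section \<open>The dual of the transpose and a map onto it\<close>

abbreviation "T \<equiv> dual (opp A) Tr"

text \<open>Evaluating a representative at the generator gives its element of z A. As \<phi>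
  vanishes on a A, the chosen representative does not matter.\<close>

definition \<theta> :: "'a \<Rightarrow> ((nat \<Rightarrow> 'k) \<Rightarrow> 'a) set \<Rightarrow> 'k" where
  "\<theta> x = (\<lambda>U\<in>carrier Tr. \<phi> ((SOME f. f \<in> U) (\<iota> (z, \<zero>)) \<otimes> x))"

lemma theta_cls:
  assumes x: "x \<in> carrier A" and y: "y \<in> carrier A"
  shows "\<theta> x (cls y) = \<phi> (z \<otimes> y \<otimes> x)"
proof -
  have "(SOME f. f \<in> cls y) \<in> cls y" using someI[of "\<lambda>f. f \<in> cls y", OF cls_self[OF y]] .
  then obtain y' where y': "y' \<in> carrier A" "(SOME f. f \<in> cls y) = ev z (a \<otimes> y' \<oplus> y)"
    by (rule cls_memD[OF y])
  have "ev z (a \<otimes> y' \<oplus> y) (\<iota> (z, \<zero>)) \<otimes> x = (z \<otimes> a) \<otimes> (y' \<otimes> x) \<oplus> z \<otimes> y \<otimes> x"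
    using y y' x c by (simp add: ev_gen l_distr r_distr m_assoc)
  then have "\<phi> (ev z (a \<otimes> y' \<oplus> y) (\<iota> (z, \<zero>)) \<otimes> x) = \<phi> (z \<otimes> y \<otimes> x)"
    using x y y' c by (simp add: phi_add phi_a za)
  then show ?thesis using y y' by (simp add: \<theta>_def carrier_Tr)
qed

lemma cls_in_Tr: "y \<in> carrier A \<Longrightarrow> cls y \<in> carrier Tr"
  by (simp add: carrier_Tr)

lemma T_eqI:
  assumes "f \<in> extensional (carrier Tr)" "g \<in> extensional (carrier Tr)"
    "\<And>y. y \<in> carrier A \<Longrightarrow> f (cls y) = g (cls y)"
  shows "f = g"
  using assms by (intro extensionalityI[OF assms(1,2)]) (auto simp: carrier_Tr)

lemma theta_ext: "\<theta> x \<in> extensional (carrier Tr)"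
  by (simp add: \<theta>_def)

lemma theta_closed:
  assumes x: "x \<in> carrier A" shows "\<theta> x \<in> carrier T"
proof -
  have "\<theta> x (U \<oplus>\<^bsub>Tr\<^esub> V) = \<theta> x U + \<theta> x V" if "U \<in> carrier Tr" "V \<in> carrier Tr" for U V
  proof -
    obtain y y' where "y \<in> carrier A" "y' \<in> carrier A" "U = cls y" "V = cls y'" using \<open>U \<in> _\<close> \<open>V \<in> _\<close> by (auto simp: carrier_Tr)
    then show ?thesis using x c by (simp add: cls_add theta_cls r_distr l_distr phi_add)
  qed
  moreover have "\<theta> x ((t \<odot>\<^bsub>A\<^esub> \<one>) \<odot>\<^bsub>Tr\<^esub> U) = t * \<theta> x U" if "U \<in> carrier Tr" for t U
  proof -
    obtain y where y: "y \<in> carrier A" "U = cls y" using \<open>U \<in> _\<close> by (auto simp: carrier_Tr)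
    have "z \<otimes> (y \<otimes> (t \<odot>\<^bsub>A\<^esub> \<one>)) = (z \<otimes> y) \<otimes> (t \<odot>\<^bsub>A\<^esub> \<one>)" using y c scal_closed by (simp add: m_assoc)
    then show ?thesis using y x c scal_closed phi_scal[OF x, of "z \<otimes> y"] by (simp add: cls_smult theta_cls)
  qed
  ultimately show ?thesis using theta_ext by (simp add: dual_def opp_def PiE_def)
qed

lemma theta_add:
  assumes x: "x \<in> carrier A" "x' \<in> carrier A"
  shows "\<theta> (x \<oplus> x') = \<theta> x \<oplus>\<^bsub>T\<^esub> \<theta> x'"
  by (rule T_eqI[OF theta_ext]) (use x c in \<open>auto simp: dual_def theta_cls r_distr phi_add cls_in_Tr\<close>)

lemma theta_smult:
  assumes x: "x \<in> carrier A" "b \<in> carrier A"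
  shows "\<theta> (b \<otimes> x) = b \<odot>\<^bsub>T\<^esub> \<theta> x"
  by (rule T_eqI[OF theta_ext])
    (use x c in \<open>auto simp: dual_def opp_def theta_cls cls_smult cls_in_Tr m_assoc\<close>)

text \<open>Pulled back along \<open>cls\<close>, a functional on the transpose satisfies the
  hypotheses of \<open>phi_repr\<close>, which returns the preimage.\<close>

lemma theta_surj:
  assumes G: "G \<in> carrier T"
  shows "\<exists>x\<in>carrier A. x \<otimes> v = x \<and> \<theta> x = G"
proof -
  have Gext: "G \<in> extensional (carrier Tr)" using G by (auto simp: dual_def PiE_def)
  have Gadd: "G (U \<oplus>\<^bsub>Tr\<^esub> V) = G U + G V" if "U \<in> carrier Tr" "V \<in> carrier Tr" for U V
    using G that by (simp add: dual_def)
  have Gscal: "G ((t \<odot>\<^bsub>A\<^esub> \<one>) \<odot>\<^bsub>Tr\<^esub> U) = t * G U" if "U \<in> carrier Tr" for U t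
    using G that by (simp add: dual_def opp_def)
  have G0: "G (cls \<zero>) = 0"
    using Gadd[OF cls_in_Tr[OF zero_closed] cls_in_Tr[OF zero_closed]] cls_add[OF zero_closed zero_closed]
    by (metis add_cancel_left_left l_zero zero_closed)
  have "\<exists>x\<in>carrier A. \<forall>y\<in>carrier A. G (cls y) = \<phi> (z \<otimes> y \<otimes> x) \<and> x \<otimes> v = x"
  proof (rule phi_repr)
    fix x y assume xy: "x \<in> carrier A" "y \<in> carrier A"
    then show "G (cls (x \<oplus> y)) = G (cls x) + G (cls y)" using Gadd[of "cls x" "cls y"] by (simp add: cls_add cls_in_Tr)
    show "G (cls (a \<otimes> y)) = 0" using cls_shift[OF zero_closed xy(2)] xy c G0 by simp
    show "G (cls (y \<otimes> (t \<odot>\<^bsub>A\<^esub> \<one>))) = t * G (cls y)" for t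
      using Gscal[OF cls_in_Tr[OF xy(2)]] cls_smult[OF xy(2) scal_closed] by simp
    have "ev z (z \<otimes> y) = ev z y"
      by (rule ev_eqI[OF c(1) ev_extensional]) (use xy c idem in \<open>auto simp: ev_apply m_assoc[symmetric]\<close>)
    then show "G (cls (z \<otimes> y)) = G (cls y)" by (simp add: cls_def)
  qed
  then obtain x where x: "x \<in> carrier A" "\<forall>y\<in>carrier A. G (cls y) = \<phi> (z \<otimes> y \<otimes> x) \<and> x \<otimes> v = x" by blast
  have "\<theta> x = G" by (rule T_eqI[OF theta_ext Gext]) (use x in \<open>auto simp: theta_cls\<close>)
  then show ?thesis using x by auto
qed

definition tcover :: "(nat \<Rightarrow> 'k) \<Rightarrow> ((nat \<Rightarrow> 'k) \<Rightarrow> 'a) set \<Rightarrow> 'k" where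
  "tcover = lift (lgen v \<zero>) (\<lambda>(x, _). \<theta> x)"

lemma tcover_apply: "x \<in> carrier A \<Longrightarrow> x \<otimes> v = x \<Longrightarrow> tcover (\<iota> (x, \<zero>)) = \<theta> x"
proof -
  assume x: "x \<in> carrier A" "x \<otimes> v = x"
  then have "(x, \<zero>) \<in> lgen v \<zero>" using lgenI[OF x(1) zero_closed, of v \<zero>] by simp
  then show ?thesis unfolding tcover_def using lgen_carrier[OF c(4) zero_closed] by simp
qed

lemma tcover_lhom: "tcover \<in> lhom A (mm v) T"
  unfolding tcover_def
proof (rule lift_lhom[OF subm_lgen[OF c(4) zero_closed]])
  fix x y assume "(x, y) \<in> lgen v \<zero>"
  then have x: "x \<in> carrier A" using c by (auto simp: lgen0_iff)
  show "(\<lambda>(x, _). \<theta> x) (x, y) \<in> carrier T" using theta_closed[OF x] by simp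
  fix x' y' assume "(x', y') \<in> lgen v \<zero>"
  then have x': "x' \<in> carrier A" using c by (auto simp: lgen0_iff)
  show "(\<lambda>(x, _). \<theta> x) (x \<oplus> x', y \<oplus> y') = (\<lambda>(x, _). \<theta> x) (x, y) \<oplus>\<^bsub>T\<^esub> (\<lambda>(x, _). \<theta> x) (x', y')"
    using theta_add[OF x x'] by simp
next
  fix b x y assume "b \<in> carrier A" "(x, y) \<in> lgen v \<zero>"
  then show "(\<lambda>(x, _). \<theta> x) (b \<otimes> x, b \<otimes> y) = b \<odot>\<^bsub>T\<^esub> (\<lambda>(x, _). \<theta> x) (x, y)"
    using c by (auto simp: lgen0_iff theta_smult)
qed

lemma tcover_surj: "tcover ` carrier (mm v) = carrier T"
proof (intro equalityI subsetI)
  fix G assume "G \<in> tcover ` carrier (mm v)"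
  then show "G \<in> carrier T" using lhom_closed[OF tcover_lhom] by blast
next
  fix G assume "G \<in> carrier T"
  then obtain x where x: "x \<in> carrier A" "x \<otimes> v = x" "\<theta> x = G" using theta_surj by blast
  then have "G = tcover (\<iota> (x, \<zero>))" by (simp add: tcover_apply)
  moreover have "\<iota> (x, \<zero>) \<in> carrier (mm v)" using mm_mem[OF x(1) c(4)] x(2) by simp
  ultimately show "G \<in> tcover ` carrier (mm v)" by (rule image_eqI)
qed

text \<open>The annihilator of z A inside A v for the pairing (y, x) \<mapsto> \<phi> (y x).\<close>

definition ker :: "('a \<times> 'a) set" where
  "ker = {(x, \<zero>) | x. x \<in> carrier A \<and> x \<otimes> v = x \<and> (\<forall>y\<in>carrier A. \<phi> (z \<otimes> y \<otimes> x) = 0)}"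

lemma theta_zero_iff:
  assumes "x \<in> carrier A"
  shows "\<theta> x = \<zero>\<^bsub>T\<^esub> \<longleftrightarrow> (\<forall>y\<in>carrier A. \<phi> (z \<otimes> y \<otimes> x) = 0)"
proof
  assume "\<theta> x = \<zero>\<^bsub>T\<^esub>"
  then have "\<theta> x (cls y) = 0" if "y \<in> carrier A" for y using that by (simp add: dual_def cls_in_Tr)
  then show "\<forall>y\<in>carrier A. \<phi> (z \<otimes> y \<otimes> x) = 0" using assms by (simp add: theta_cls)
next
  assume "\<forall>y\<in>carrier A. \<phi> (z \<otimes> y \<otimes> x) = 0"
  then show "\<theta> x = \<zero>\<^bsub>T\<^esub>"
    using assms by (intro T_eqI[OF theta_ext]) (auto simp: dual_def theta_cls cls_in_Tr)
qed

lemma tcover_kernel: "a_kernel (mm v) T tcover = \<iota> ` ker"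
proof (intro equalityI subsetI)
  fix u assume "u \<in> a_kernel (mm v) T tcover"
  then have u: "u \<in> carrier (mm v)" "tcover u = \<zero>\<^bsub>T\<^esub>" by (auto simp: a_kernelD)
  obtain x where x: "x \<in> carrier A" "u = \<iota> (x \<otimes> v, \<zero>)" using u(1) c(4) by (rule mm_elem)
  have xv: "(x \<otimes> v) \<otimes> v = x \<otimes> v" using x c idem by (simp add: m_assoc)
  then have "\<theta> (x \<otimes> v) = \<zero>\<^bsub>T\<^esub>" using u(2) x c by (simp add: tcover_apply)
  then show "u \<in> \<iota> ` ker" unfolding x(2) ker_def using x xv c by (auto simp: theta_zero_iff)
next
  fix u assume "u \<in> \<iota> ` ker"
  then obtain x where x: "u = \<iota> (x, \<zero>)" "x \<in> carrier A" "x \<otimes> v = x" "\<forall>y\<in>carrier A. \<phi> (z \<otimes> y \<otimes> x) = 0"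
    by (auto simp: ker_def)
  moreover have "\<iota> (x, \<zero>) \<in> carrier (mm v)" using mm_mem[OF x(2) c(4)] x(3) by simp
  ultimately show "u \<in> a_kernel (mm v) T tcover" by (simp add: a_kernelD tcover_apply theta_zero_iff)
qed

lemma subm_ker: "subm ker"
  unfolding subm_def
proof (intro conjI allI impI)
  show "ker \<subseteq> carrier A \<times> carrier A" by (auto simp: ker_def)
  show "(\<zero>, \<zero>) \<in> ker" using phi_a[of \<zero>] c by (auto simp: ker_def)
next
  fix x y x' y' assume "(x, y) \<in> ker" "(x', y') \<in> ker"
  then show "(x \<oplus> x', y \<oplus> y') \<in> ker" using c by (auto simp: ker_def l_distr r_distr phi_add)
next
  fix b x y assume b: "b \<in> carrier A" and "(x, y) \<in> ker"
  then have x: "x \<in> carrier A" "x \<otimes> v = x" "y = \<zero>" "\<And>y. y \<in> carrier A \<Longrightarrow> \<phi> (z \<otimes> y \<otimes> x) = 0"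
    by (auto simp: ker_def)
  have "\<phi> (z \<otimes> y \<otimes> (b \<otimes> x)) = 0" if "y \<in> carrier A" for y
    using x(4)[of "y \<otimes> b"] that b c x(1) by (simp add: m_assoc)
  then show "(b \<otimes> x, b \<otimes> y) \<in> ker" using b x c by (simp add: ker_def m_assoc)
qed

end

section \<open>Algebras with a basis of paths\<close>

locale quiver_relations =
  fixes Q :: "('v, 'e) pre_digraph" and S :: "('e \<times> 'e) set"
  assumes tail_vert: "\<And>a. a \<in> arcs Q \<Longrightarrow> tail Q a \<in> verts Q"
    and head_vert: "\<And>a. a \<in> arcs Q \<Longrightarrow> head Q a \<in> verts Q"
    and S_sub: "\<And>a b. (a, b) \<in> S \<Longrightarrow> a \<in> arcs Q \<and> b \<in> arcs Q \<and> head Q a = tail Q b"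
begin

definition nz :: "'e list \<Rightarrow> bool" where
  "nz p \<longleftrightarrow> set p \<subseteq> arcs Q \<and> successively (\<lambda>a b. head Q a = tail Q b \<and> (a, b) \<notin> S) p"

definition tgt :: "'v \<Rightarrow> 'e list \<Rightarrow> 'v" where
  "tgt u p = (if p = [] then u else head Q (last p))"

definition B :: "('v \<times> 'e list) set" where
  "B = {(u, p). u \<in> verts Q \<and> nz p \<and> (p \<noteq> [] \<longrightarrow> tail Q (hd p) = u)}"

lemma tgt_simps [simp]: "tgt u [] = u" "tgt u (p @ [a]) = head Q a" "tgt u [a] = head Q a"
  by (auto simp: tgt_def)

lemma tgt_append: "tgt u (p @ q) = tgt (tgt u p) q"
  by (auto simp: tgt_def)

lemma nz_append: "nz (p @ q) \<longleftrightarrow> nz p \<and> nz q \<and>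
    (p \<noteq> [] \<and> q \<noteq> [] \<longrightarrow> head Q (last p) = tail Q (hd q) \<and> (last p, hd q) \<notin> S)"
  by (auto simp: nz_def successively_append_iff)

lemma tgt_vert: "(u, p) \<in> B \<Longrightarrow> tgt u p \<in> verts Q"
  by (auto simp: B_def tgt_def nz_def intro!: head_vert)

lemma B_append: "(u, p @ q) \<in> B \<longleftrightarrow> (u, p) \<in> B \<and> (tgt u p, q) \<in> B \<and>
    (p \<noteq> [] \<and> q \<noteq> [] \<longrightarrow> (last p, hd q) \<notin> S)"
proof (cases "p = [] \<or> q = []")
  case True
  then show ?thesis using tgt_vert[of u p] by (auto simp: B_def nz_def)
next
  case False
  then have "hd q \<in> arcs Q" if "nz q" using that by (auto simp: nz_def)
  with False show ?thesis using tail_vert by (auto simp: B_def nz_append tgt_def)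
qed

lemma B_Nil [simp]: "(u, []) \<in> B \<longleftrightarrow> u \<in> verts Q"
  by (simp add: B_def nz_def)

lemma B_single: "(u, [a]) \<in> B \<longleftrightarrow> a \<in> arcs Q \<and> u = tail Q a"
  by (auto simp: B_def nz_def tail_vert)

lemma B_Cons: "(u, a # p) \<in> B \<longleftrightarrow> a \<in> arcs Q \<and> u = tail Q a \<and> (head Q a, p) \<in> B \<and>
    (p \<noteq> [] \<longrightarrow> (a, hd p) \<notin> S)"
  using B_append[of u "[a]" p] by (auto simp: B_single)

lemma B_snoc: "(u, p @ [a]) \<in> B \<longleftrightarrow> (u, p) \<in> B \<and> a \<in> arcs Q \<and> tgt u p = tail Q a \<and>
    (p \<noteq> [] \<longrightarrow> (last p, a) \<notin> S)"
  using B_append[of u p "[a]"] by (auto simp: B_single)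

lemma B_take_drop:
  assumes "(u, p) \<in> B" shows "(u, take i p) \<in> B" "(tgt u (take i p), drop i p) \<in> B"
  using assms B_append[of u "take i p" "drop i p"] by auto

end

text \<open>
  \<open>B\<close> is the set of paths that contain no relation, with their sources, and \<open>coef x\<close> is the coordinate
  vector of \<open>x\<close> in this basis.
\<close>

locale path_basis = quiver_relations Q S + ring A
  for Q :: "('v, 'e) pre_digraph" and S and A :: "('k::field, 'a) module" (structure) +
  fixes coef :: "'a \<Rightarrow> 'v \<times> 'e list \<Rightarrow> 'k"
  assumes finite_B: "finite B"
    and coef_inj: "\<And>x y. x \<in> carrier A \<Longrightarrow> y \<in> carrier A \<Longrightarrow> (\<And>w. w \<in> B \<Longrightarrow> coef x w = coef y w) \<Longrightarrow> x = y"
    and coef_ex: "\<And>f. \<exists>x\<in>carrier A. \<forall>w\<in>B. coef x w = f w"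
    and coef_add: "\<And>x y w. x \<in> carrier A \<Longrightarrow> y \<in> carrier A \<Longrightarrow> w \<in> B \<Longrightarrow> coef (x \<oplus> y) w = coef x w + coef y w"
    and coef_one: "\<And>u p. (u, p) \<in> B \<Longrightarrow> coef \<one> (u, p) = (if p = [] then 1 else 0)"
    and coef_mult: "\<And>x y u p. x \<in> carrier A \<Longrightarrow> y \<in> carrier A \<Longrightarrow> (u, p) \<in> B \<Longrightarrow>
      coef (x \<otimes> y) (u, p) = (\<Sum>i\<le>length p. coef x (u, take i p) * coef y (tgt u (take i p), drop i p))"
    and scal_carrier: "\<And>t x. x \<in> carrier A \<Longrightarrow> t \<odot> x \<in> carrier A"
    and coef_scal: "\<And>t x w. x \<in> carrier A \<Longrightarrow> w \<in> B \<Longrightarrow> coef (t \<odot> x) w = t * coef x w"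
begin

section \<open>Coordinates, encoding and length filtration\<close>

lemma coef_zero [simp]: "w \<in> B \<Longrightarrow> coef \<zero> w = 0"
  using coef_add[of \<zero> \<zero> w] by (metis add_cancel_left_left l_zero zero_closed)

definition el :: "('v \<times> 'e list \<Rightarrow> 'k) \<Rightarrow> 'a" where
  "el f = (SOME x. x \<in> carrier A \<and> (\<forall>w\<in>B. coef x w = f w))"

lemma el: "el f \<in> carrier A" "w \<in> B \<Longrightarrow> coef (el f) w = f w"
proof -
  have "el f \<in> carrier A \<and> (\<forall>w\<in>B. coef (el f) w = f w)"
    unfolding el_def by (rule someI_ex) (use coef_ex in blast)
  then show "el f \<in> carrier A" "w \<in> B \<Longrightarrow> coef (el f) w = f w" by auto
qed

text \<open>Zero if the path is not in \<open>B\<close>, since then all its coordinates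
  vanish.\<close>

definition mon :: "'v \<Rightarrow> 'e list \<Rightarrow> 'a" where
  "mon u p = el (\<lambda>w. if w = (u, p) then 1 else 0)"

lemma mon_closed [simp, intro]: "mon u p \<in> carrier A"
  by (simp add: mon_def el)

lemma coef_mon: "w \<in> B \<Longrightarrow> coef (mon u p) w = (if w = (u, p) then 1 else 0)"
  by (simp add: mon_def el)

text \<open>Interleaves two coordinate vectors: the first component occupies the even positions, the
  second the odd ones.\<close>

definition iota :: "'a \<times> 'a \<Rightarrow> nat \<Rightarrow> 'k" where
  "iota xy n = coef ((if even n then fst else snd) xy) (from_nat_into B (n div 2))"

lemma inj_iota: "inj_on iota (carrier A \<times> carrier A)"
proof (rule inj_onI, clarify)
  fix x y x' y' assume c: "x \<in> carrier A" "y \<in> carrier A" "x' \<in> carrier A" "y' \<in> carrier A"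
    and eq: "iota (x, y) = iota (x', y')"
  have "coef x w = coef x' w" "coef y w = coef y' w" if w: "w \<in> B" for w
  proof -
    have "from_nat_into B (to_nat_on B w) = w" using w finite_B by (simp add: countable_finite)
    then show "coef x w = coef x' w" "coef y w = coef y' w"
      using fun_cong[OF eq, of "2 * to_nat_on B w"] fun_cong[OF eq, of "2 * to_nat_on B w + 1"]
      by (auto simp: iota_def)
  qed
  then show "x = x' \<and> y = y'" using c coef_inj by blast
qed

text \<open>The span of the nonzero paths of length at least n, that is, the n-th power of the
  radical.\<close>

definition filt :: "nat \<Rightarrow> 'a set" where
  "filt n = {x \<in> carrier A. \<forall>(u, p)\<in>B. length p < n \<longrightarrow> coef x (u, p) = 0}"

lemma filtD: "x \<in> filt n \<Longrightarrow> (u, p) \<in> B \<Longrightarrow> length p < n \<Longrightarrow> coef x (u, p) = 0"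
  unfolding filt_def by blast

lemma filt_nilpotent: "\<exists>m. filt m = {\<zero>}"
proof -
  define m where "m = Suc (Max ((\<lambda>(u, p). length p) ` B))"
  have m: "length p < m" if "(u, p) \<in> B" for u p
  proof -
    have "length p \<le> Max ((\<lambda>(u, p). length p) ` B)" using finite_B that by (intro Max_ge) force+
    then show ?thesis by (simp add: m_def)
  qed
  have "x = \<zero>" if "x \<in> filt m" for x
  proof (rule coef_inj)
    fix w assume w: "w \<in> B"
    obtain u p where "w = (u, p)" by force
    then show "coef x w = coef \<zero> w" using filtD[OF that] m w by simp
  qed (use that in \<open>auto simp: filt_def\<close>)
  moreover have "\<zero> \<in> filt m" by (auto simp: filt_def)
  ultimately have "filt m = {\<zero>}" by blast
  then show ?thesis ..
qed

text \<open>Cutting a path of length at most n in two leaves a left part shorter than n or a trivial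
  right part.\<close>

lemma filt_mult:
  assumes x: "x \<in> filt n" and y: "y \<in> filt 1" shows "x \<otimes> y \<in> filt (Suc n)"
proof -
  have c: "x \<in> carrier A" "y \<in> carrier A" using x y by (auto simp: filt_def)
  have "coef (x \<otimes> y) (u, p) = 0" if B: "(u, p) \<in> B" and len: "length p < Suc n" for u p
  proof -
    have "coef x (u, take i p) * coef y (tgt u (take i p), drop i p) = 0" if i: "i \<le> length p" for i
    proof (cases "i < n")
      case True
      then have "length (take i p) < n" using i by simp
      then show ?thesis using filtD[OF x B_take_drop(1)[OF B]] by simp
    next
      case False
      then have "length (drop i p) < 1" using i len by simp
      then show ?thesis using filtD[OF y B_take_drop(2)[OF B]] by simp
    qed
    then show ?thesis unfolding coef_mult[OF c B] by (intro sum.neutral) auto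
  qed
  then show ?thesis using c by (auto simp: filt_def)
qed

sublocale filtered_pair_modules A iota filt
proof unfold_locales
  show "inj_on iota (carrier A \<times> carrier A)" by (rule inj_iota)
  show "\<exists>m. filt m = {\<zero>}" by (rule filt_nilpotent)
  show "x \<otimes> y \<in> filt (Suc n)" if "x \<in> filt n" "y \<in> filt 1" for x y n using that by (rule filt_mult)
  show "x \<oplus> y \<in> filt n" if "x \<in> filt n" "y \<in> filt n" for x y n
    using filtD[OF that(1)] filtD[OF that(2)] that by (auto simp: filt_def coef_add)
qed (auto simp: filt_def)

section \<open>Products with paths\<close>

lemma coef_mult_mon:
  assumes x: "x \<in> carrier A" and pq: "(u, p @ q) \<in> B" and w: "tgt u p = w"
  shows "coef (x \<otimes> mon w q) (u, p @ q) = coef x (u, p)"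
proof -
  \<comment> \<open>Only the cut at \<open>length p\<close> leaves \<open>q\<close> on the right, so
    one summand survives.\<close>
  have "coef x (u, take i (p @ q)) * coef (mon w q) (tgt u (take i (p @ q)), drop i (p @ q)) =
     (if i = length p then coef x (u, p) else 0)" if i: "i \<le> length (p @ q)" for i
  proof (cases "i = length p")
    case True
    then show ?thesis using pq w B_append by (simp add: coef_mon)
  next
    case False
    then have "length (drop i (p @ q)) \<noteq> length q" using i by simp
    then have "drop i (p @ q) \<noteq> q" by metis
    then show ?thesis using False B_take_drop(2)[OF pq, of i] by (simp add: coef_mon)
  qed
  then have "coef (x \<otimes> mon w q) (u, p @ q) = (\<Sum>i\<le>length (p @ q). if i = length p then coef x (u, p) else 0)"
    unfolding coef_mult[OF x mon_closed pq] by (intro sum.cong) auto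
  then show ?thesis by simp
qed

lemma coef_mult_mon_0:
  assumes x: "x \<in> carrier A" and p: "(u, p) \<in> B" and n: "\<And>r. p = r @ q \<Longrightarrow> tgt u r \<noteq> w"
  shows "coef (x \<otimes> mon w q) (u, p) = 0"
proof -
  have "coef (mon w q) (tgt u (take i p), drop i p) = 0" for i
    using n[of "take i p"] B_take_drop(2)[OF p, of i] append_take_drop_id[of i p]
    by (auto simp: coef_mon)
  then show ?thesis unfolding coef_mult[OF x mon_closed p] by simp
qed

lemma coef_mon_mult:
  assumes y: "y \<in> carrier A" and pq: "(u, p @ q) \<in> B"
  shows "coef (mon u p \<otimes> y) (u, p @ q) = coef y (tgt u p, q)"
proof -
  have "coef (mon u p) (u, take i (p @ q)) * coef y (tgt u (take i (p @ q)), drop i (p @ q)) =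
     (if i = length p then coef y (tgt u p, q) else 0)" if i: "i \<le> length (p @ q)" for i
  proof (cases "i = length p")
    case True
    then show ?thesis using pq B_append by (simp add: coef_mon)
  next
    case False
    then have "length (take i (p @ q)) \<noteq> length p" using i by simp
    then have "take i (p @ q) \<noteq> p" by metis
    then show ?thesis using False B_take_drop(1)[OF pq, of i] by (simp add: coef_mon)
  qed
  then have "coef (mon u p \<otimes> y) (u, p @ q) = (\<Sum>i\<le>length (p @ q). if i = length p then coef y (tgt u p, q) else 0)"
    unfolding coef_mult[OF mon_closed y pq] by (intro sum.cong) auto
  then show ?thesis by simp
qed

lemma coef_mon_mult_0:
  assumes y: "y \<in> carrier A" and q: "(u, q) \<in> B" and n: "\<not> (u = w \<and> prefix p q)"
  shows "coef (mon w p \<otimes> y) (u, q) = 0"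
proof -
  have "coef (mon w p) (u, take i q) = 0" for i
    using n B_take_drop(1)[OF q, of i] take_is_prefix[of i q] by (auto simp: coef_mon)
  then show ?thesis unfolding coef_mult[OF mon_closed y q] by simp
qed

lemma mon_mult:
  assumes p: "(u, p) \<in> B" and w: "tgt u p = w"
  shows "mon u p \<otimes> mon w q = (if (u, p @ q) \<in> B then mon u (p @ q) else \<zero>)"
proof (rule coef_inj)
  fix v assume v: "v \<in> B"
  obtain u' r where ur: "v = (u', r)" by force
  show "coef (mon u p \<otimes> mon w q) v = coef (if (u, p @ q) \<in> B then mon u (p @ q) else \<zero>) v"
  proof (cases "u' = u \<and> prefix p r")
    case True
    then obtain s where s: "r = p @ s" by (auto simp: prefix_def)
    then have "coef (mon u p \<otimes> mon w q) v = coef (mon w q) (tgt u p, s)"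
      using True v ur by (simp add: coef_mon_mult)
    also have "\<dots> = (if s = q then 1 else 0)" using v ur s w True by (simp add: coef_mon B_append)
    finally show ?thesis using v ur s True by (auto simp: coef_mon)
  next
    case False
    then have "coef (mon u p \<otimes> mon w q) v = 0" using v ur coef_mon_mult_0[OF mon_closed] by blast
    moreover have "v \<noteq> (u, p @ q)" using False ur by (auto simp: prefix_def)
    ultimately show ?thesis using v by (auto simp: coef_mon)
  qed
qed auto

lemma mon_mult_0:
  assumes "tgt u p \<noteq> w"
  shows "mon u p \<otimes> mon w q = \<zero>"
proof (rule coef_inj)
  fix v assume v: "v \<in> B"
  obtain u' r where ur: "v = (u', r)" by force
  show "coef (mon u p \<otimes> mon w q) v = coef \<zero> v"
  proof (cases "u' = u \<and> prefix p r")
    case True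
    then obtain s where s: "r = p @ s" by (auto simp: prefix_def)
    then have "coef (mon u p \<otimes> mon w q) v = coef (mon w q) (tgt u p, s)"
      using True v ur by (simp add: coef_mon_mult)
    also have "\<dots> = 0" using v ur s assms True by (simp add: coef_mon B_append)
    finally show ?thesis using v by simp
  next
    case False
    then show ?thesis using v ur coef_mon_mult_0[OF mon_closed] by simp
  qed
qed auto

abbreviation vt :: "'v \<Rightarrow> 'a" where "vt v \<equiv> mon v []"
abbreviation ar :: "'e \<Rightarrow> 'a" where "ar a \<equiv> mon (tail Q a) [a]"

lemma vt_idem: "v \<in> verts Q \<Longrightarrow> vt v \<otimes> vt v = vt v"
  by (simp add: mon_mult)

lemma vt_mon: "(u, p) \<in> B \<Longrightarrow> vt u \<otimes> mon u p = mon u p"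
  using B_append[of u "[]" p] by (simp add: mon_mult)

lemma mon_vt: "(u, p) \<in> B \<Longrightarrow> tgt u p = w \<Longrightarrow> mon u p \<otimes> vt w = mon u p"
  by (simp add: mon_mult)

lemma coef_mult_vt:
  assumes "x \<in> carrier A" "(u, p) \<in> B"
  shows "coef (x \<otimes> vt w) (u, p) = (if tgt u p = w then coef x (u, p) else 0)"
  using coef_mult_mon[of x u p "[]" w] coef_mult_mon_0[of x u p "[]" w] assms by auto

lemma coef_vt_mult:
  assumes "x \<in> carrier A" "(u, p) \<in> B"
  shows "coef (vt w \<otimes> x) (u, p) = (if u = w then coef x (u, p) else 0)"
  using coef_mon_mult[of x u "[]" p] coef_mon_mult_0[of x u p w "[]"] assms by auto

lemma scal_mult: "x \<in> carrier A \<Longrightarrow> y \<in> carrier A \<Longrightarrow> (t \<odot> x) \<otimes> y = t \<odot> (x \<otimes> y)"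
  by (rule coef_inj) (auto simp: scal_carrier coef_scal coef_mult B_take_drop sum_distrib_left mult.assoc)

lemma mult_scal: "x \<in> carrier A \<Longrightarrow> y \<in> carrier A \<Longrightarrow> x \<otimes> (t \<odot> y) = t \<odot> (x \<otimes> y)"
  by (rule coef_inj) (auto simp: scal_carrier coef_scal coef_mult B_take_drop sum_distrib_left mult.left_commute)

lemma mult_scal_one: "x \<in> carrier A \<Longrightarrow> x \<otimes> (t \<odot> \<one>) = t \<odot> x"
  by (simp add: mult_scal)

text \<open>Linearity is assumed for right multiplication by multiples of 1 because scalars act in
  this way on a right module such as the transpose.\<close>

lemma additive_expand:
  fixes G :: "'a \<Rightarrow> 'k"
  assumes add: "\<And>x y. x \<in> carrier A \<Longrightarrow> y \<in> carrier A \<Longrightarrow> G (x \<oplus> y) = G x + G y"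
    and scal: "\<And>t y. y \<in> carrier A \<Longrightarrow> G (y \<otimes> (t \<odot> \<one>)) = t * G y"
    and y: "y \<in> carrier A"
  shows "G y = (\<Sum>(u, p)\<in>B. coef y (u, p) * G (mon u p))"
proof -
  have scal': "G (t \<odot> y) = t * G y" if "y \<in> carrier A" for t y
    using scal[OF that, of t] mult_scal_one[OF that, of t] by simp
  have "finite X \<Longrightarrow> X \<subseteq> B \<Longrightarrow> y \<in> carrier A \<Longrightarrow> (\<And>w. w \<in> B - X \<Longrightarrow> coef y w = 0) \<Longrightarrow>
    G y = (\<Sum>(u, p)\<in>X. coef y (u, p) * G (mon u p))" for X y
  proof (induction X arbitrary: y rule: finite_induct)
    case empty
    then have "y = \<zero>" by (intro coef_inj) auto
    have "G \<zero> = G \<zero> + G \<zero>" using add[OF zero_closed zero_closed] by (simp only: l_zero[OF zero_closed])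
    then have "G \<zero> = 0" by (rule iffD1[OF add_cancel_right_right])
    then show ?case using \<open>y = \<zero>\<close> by simp
  next
    case (insert w X)
    obtain u p where w: "w = (u, p)" by force
    let ?c = "coef y w"
    \<comment> \<open>Removing the component at \<open>w\<close> reduces the support to
      \<open>X\<close>.\<close>
    define y' where "y' = y \<oplus> (- ?c) \<odot> mon u p"
    have y'c: "y' \<in> carrier A" using insert.prems by (simp add: y'_def scal_carrier)
    have cy': "coef y' v = (if v = w then 0 else coef y v)" if "v \<in> B" for v
      using that insert.prems w by (auto simp: y'_def coef_add coef_scal scal_carrier coef_mon)
    have "G y' = (\<Sum>(u, p)\<in>X. coef y' (u, p) * G (mon u p))"
      using insert.prems y'c by (intro insert.IH) (auto simp: cy')
    also have "\<dots> = (\<Sum>(u, p)\<in>X. coef y (u, p) * G (mon u p))"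
      using insert.prems insert.hyps by (intro sum.cong) (auto simp: cy')
    finally have 1: "G y' = (\<Sum>(u, p)\<in>X. coef y (u, p) * G (mon u p))" .
    have "y = y' \<oplus> ?c \<odot> mon u p"
      using insert.prems y'c w by (intro coef_inj) (auto simp: cy' coef_add coef_scal scal_carrier coef_mon)
    then have "G y = G (y' \<oplus> ?c \<odot> mon u p)" by (rule arg_cong)
    also have "\<dots> = G y' + ?c * G (mon u p)"
      unfolding add[OF y'c scal_carrier[OF mon_closed]] scal'[OF mon_closed] ..
    finally have "G y = G y' + ?c * G (mon u p)" .
    then show ?case using 1 insert.hyps w by simp
  qed
  from this[OF finite_B subset_refl y] show ?thesis by simp
qed

end

section \<open>Left ideals generated by arrows\<close>

lemma at_most_one_other:
  assumes "card X \<le> 2" "finite X" "w \<in> X" "x \<in> X" "y \<in> X" "x \<noteq> w" "y \<noteq> w"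
  shows "x = y"
proof (rule ccontr)
  assume "x \<noteq> y"
  then have "card {w, x, y} = 3" using assms by simp
  moreover have "card {w, x, y} \<le> card X" using assms by (intro card_mono) auto
  ultimately show False using assms by simp
qed

locale gentle_relations = quiver_relations Q S for Q :: "('v, 'e) pre_digraph" and S +
  assumes finite_arcs: "finite (arcs Q)"
    and S_pred: "\<And>a a' b. (a, b) \<in> S \<Longrightarrow> (a', b) \<in> S \<Longrightarrow> a = a'"
    and S_succ: "\<And>a b b'. (a, b) \<in> S \<Longrightarrow> (a, b') \<in> S \<Longrightarrow> b = b'"
    and nS_pred: "\<And>a a' b. \<lbrakk>a \<in> arcs Q; a' \<in> arcs Q; b \<in> arcs Q; head Q a = tail Q b; head Q a' = tail Q b;
      (a, b) \<notin> S; (a', b) \<notin> S\<rbrakk> \<Longrightarrow> a = a'"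
    and nS_succ: "\<And>a b b'. \<lbrakk>a \<in> arcs Q; b \<in> arcs Q; b' \<in> arcs Q; head Q a = tail Q b; head Q a = tail Q b';
      (a, b) \<notin> S; (a, b') \<notin> S\<rbrakk> \<Longrightarrow> b = b'"
    and in_deg: "\<And>v. v \<in> verts Q \<Longrightarrow> card {a \<in> arcs Q. head Q a = v} \<le> 2"
    and out_deg: "\<And>v. v \<in> verts Q \<Longrightarrow> card {a \<in> arcs Q. tail Q a = v} \<le> 2"
begin

lemma nz_Cons: "nz (a # p) \<longleftrightarrow> a \<in> arcs Q \<and> nz p \<and> (p \<noteq> [] \<longrightarrow> head Q a = tail Q (hd p) \<and> (a, hd p) \<notin> S)"
  using nz_append[of "[a]" p] by (auto simp: nz_def)

lemma nz_snoc: "nz (p @ [a]) \<longleftrightarrow> a \<in> arcs Q \<and> nz p \<and> (p \<noteq> [] \<longrightarrow> head Q (last p) = tail Q a \<and> (last p, a) \<notin> S)"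
  using nz_append[of p "[a]"] by (auto simp: nz_def)

text \<open>By (G4) an arrow has at most one continuation without relation, so the nonzero paths
  with a given first arrow form a chain.\<close>

lemma nz_prefix_comparable: "nz (a # p) \<Longrightarrow> nz (a # q) \<Longrightarrow> prefix p q \<or> prefix q p"
proof (induction p arbitrary: a q)
  case (Cons b p)
  show ?case
  proof (cases q)
    case q: (Cons c r)
    have "b = c" using Cons.prems q by (intro nS_succ[of a]) (auto simp: nz_Cons)
    then show ?thesis using Cons.IH[of b r] Cons.prems q by (auto simp: nz_Cons)
  qed simp
qed simp

lemma nz_suffix_comparable: "nz (p @ [a]) \<Longrightarrow> nz (q @ [a]) \<Longrightarrow> suffix p q \<or> suffix q p"
proof (induction p arbitrary: a q rule: rev_induct)
  case (snoc b p)
  show ?case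
  proof (cases q rule: rev_cases)
    case q: (snoc r c)
    have 1: "nz (p @ [b])" "nz (r @ [c])" using snoc.prems q nz_snoc by blast+
    have "b \<in> arcs Q" "c \<in> arcs Q" "a \<in> arcs Q" "head Q b = tail Q a" "head Q c = tail Q a" "(b, a) \<notin> S" "(c, a) \<notin> S"
      using snoc.prems nz_append[of p "[b]"] nz_append[of r "[c]"] unfolding q nz_snoc by (auto simp: nz_def)
    then have "b = c" by (intro nS_pred[of b c a])
    then show ?thesis using snoc.IH[of b r] 1 q by auto
  qed simp
qed simp

end

locale gentle_basis = path_basis Q S A coef + gentle_relations Q S
  for Q :: "('v, 'e) pre_digraph" and S and A :: "('k::field, 'a) module" (structure) and coef
begin

section \<open>Annihilators of paths\<close>

lemma ar_closed: "a \<in> arcs Q \<Longrightarrow> (tail Q a, [a]) \<in> B"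
  by (simp add: B_single)

text \<open>The path r b p is nonzero, and its coefficient in the product is the coefficient of r in
  x.\<close>

lemma mult_mon_zero_coef:
  assumes x: "x \<in> carrier A" "x \<otimes> mon (tail Q b) (b # p) = \<zero>" and b: "(tail Q b, b # p) \<in> B"
    and u: "(u, r) \<in> B" "tgt u r = tail Q b" "r \<noteq> [] \<Longrightarrow> (last r, b) \<notin> S"
  shows "coef x (u, r) = 0"
proof -
  have "(u, r @ b # p) \<in> B" using u b by (auto simp: B_append)
  then show ?thesis using coef_mult_mon[OF x(1) _ u(2), of "b # p"] x(2) by simp
qed

text \<open>The left annihilator of a path depends only on its first arrow: a path into the tail of
  b dies only if its last arrow is the unique predecessor a. The witness strips this a.\<close>

lemma mult_mon_eq_zeroD:
  assumes ab: "(a, b) \<in> S" and x: "x \<in> carrier A" "x \<otimes> mon (tail Q b) (b # p) = \<zero>"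
    and b: "(tail Q b, b # p) \<in> B"
  shows "\<exists>y\<in>carrier A. x \<otimes> vt (tail Q b) = y \<otimes> ar a"
proof (rule bexI[OF _ el(1)], rule coef_inj)
  let ?y = "el (\<lambda>(u, r). coef x (u, r @ [a]))"
  show "x \<otimes> vt (tail Q b) \<in> carrier A" "?y \<otimes> ar a \<in> carrier A" using x el by auto
  fix w assume w: "w \<in> B"
  obtain u r where ur: "w = (u, r)" by force
  have aS: "a \<in> arcs Q" "head Q a = tail Q b" using S_sub[OF ab] by auto
  show "coef (x \<otimes> vt (tail Q b)) w = coef (?y \<otimes> ar a) w"
  proof (cases "\<exists>r'. r = r' @ [a]")
    case True
    then obtain r' where r: "r = r' @ [a]" by blast
    then have "coef (?y \<otimes> ar a) w = coef ?y (u, r')"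
      using w ur by (simp add: coef_mult_mon el(1) B_snoc)
    then show ?thesis using w ur r x aS by (simp add: el(2) coef_mult_vt B_snoc)
  next
    case False
    then have "coef (?y \<otimes> ar a) w = 0" unfolding ur using w ur by (intro coef_mult_mon_0 el(1)) auto
    moreover have "coef x (u, r) = 0" if "tgt u r = tail Q b"
    proof (rule mult_mon_zero_coef[OF x b _ that])
      show "(u, r) \<in> B" using w ur by simp
      assume "r \<noteq> []"
      then have "last r \<noteq> a" using False append_butlast_last_id[of r] by metis
      then show "(last r, b) \<notin> S" using S_pred[OF ab] by blast
    qed
    ultimately show ?thesis using w ur x by (simp add: coef_mult_vt)
  qed
qed

lemma mult_mon_eq_zeroD':
  assumes nS: "\<And>a. (a, b) \<notin> S" and x: "x \<in> carrier A" "x \<otimes> mon (tail Q b) (b # p) = \<zero>"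
    and b: "(tail Q b, b # p) \<in> B"
  shows "x \<otimes> vt (tail Q b) = \<zero>"
proof (rule coef_inj)
  fix w assume w: "w \<in> B"
  obtain u r where ur: "w = (u, r)" by force
  show "coef (x \<otimes> vt (tail Q b)) w = coef \<zero> w"
    using mult_mon_zero_coef[OF x b] nS w ur x by (simp add: coef_mult_vt)
qed (use x in auto)

text \<open>Mirror image of the left annihilator: b is the only arrow with which a has a relation,
  and the witness strips a leading b.\<close>

lemma ar_mult_eq_zeroD:
  assumes ab: "(a, b) \<in> S" and y: "y \<in> carrier A" "ar a \<otimes> y = \<zero>"
  shows "\<exists>z\<in>carrier A. vt (head Q a) \<otimes> y = ar b \<otimes> z"
proof (rule bexI[OF _ el(1)], rule coef_inj)
  let ?z = "el (\<lambda>(u, r). coef y (tail Q b, b # r))"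
  show "vt (head Q a) \<otimes> y \<in> carrier A" "ar b \<otimes> ?z \<in> carrier A" using y el by auto
  fix w assume w: "w \<in> B"
  obtain u r where ur: "w = (u, r)" by force
  have aS: "a \<in> arcs Q" "b \<in> arcs Q" "head Q a = tail Q b" using S_sub[OF ab] by auto
  show "coef (vt (head Q a) \<otimes> y) w = coef (ar b \<otimes> ?z) w"
  proof (cases "u = tail Q b \<and> prefix [b] r")
    case True
    then obtain r' where r: "r = [b] @ r'" by (auto simp: prefix_def)
    then have "coef (ar b \<otimes> ?z) w = coef ?z (head Q b, r')"
      using w ur coef_mon_mult[OF el(1), of u "[b]" r'] True by simp
    then show ?thesis using w ur r y aS by (simp add: el(2) coef_vt_mult B_Cons)
  next
    case False
    then have "coef (ar b \<otimes> ?z) w = 0" unfolding ur using w ur by (intro coef_mon_mult_0 el(1)) auto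
    moreover have "coef y (u, r) = 0" if u: "u = head Q a"
    proof -
      have "r \<noteq> [] \<Longrightarrow> hd r \<noteq> b" using False u aS by (cases r) auto
      then have "r \<noteq> [] \<Longrightarrow> (a, hd r) \<notin> S" using S_succ[OF ab] by blast
      then have "(tail Q a, [a] @ r) \<in> B" unfolding B_append using w ur u aS by (auto simp: B_single)
      then show ?thesis using coef_mon_mult[OF y(1), of "tail Q a" "[a]" r] y u by simp
    qed
    ultimately show ?thesis using w ur y by (simp add: coef_vt_mult)
  qed
qed

lemma ar_mult_ar: "(a, b) \<in> S \<Longrightarrow> ar a \<otimes> ar b = \<zero>"
  using S_sub[of a b] mon_mult[of "tail Q a" "[a]" "tail Q b" "[b]"] by (auto simp: B_Cons tail_vert)

lemma vt_ar: "a \<in> arcs Q \<Longrightarrow> vt (tail Q a) \<otimes> ar a = ar a"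
  by (simp add: vt_mon ar_closed)

lemma ar_vt: "a \<in> arcs Q \<Longrightarrow> ar a \<otimes> vt (head Q a) = ar a"
  by (rule mon_vt) (auto simp: ar_closed)

text \<open>Without a predecessor of a, whatever kills a also kills the idempotent at its tail.
  Divisibility would then yield a y equal to that idempotent, but a product starting with a has no
  trivial path in it.\<close>

lemma inj_dim_le_1_pred:
  assumes res: "inj_resolution A (regular A) J d h" and triv: "\<And>m. m > 1 \<Longrightarrow> carrier (J m) = {\<zero>\<^bsub>J m\<^esub>}"
    and ab: "(a, b) \<in> S"
  shows "\<exists>c. (c, a) \<in> S"
proof (rule ccontr)
  assume n: "\<nexists>c. (c, a) \<in> S"
  have arcs: "a \<in> arcs Q" "b \<in> arcs Q" "head Q a = tail Q b" using S_sub[OF ab] by auto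
  have "\<exists>y\<in>carrier A. ar a \<otimes> y = vt (tail Q a)"
  proof (rule inj_dim_le_1_divides[OF res triv mon_closed mon_closed mon_closed mon_closed])
    show "ar a \<otimes> ar b = \<zero>" by (rule ar_mult_ar[OF ab])
    show "ar a \<otimes> vt (tail Q b) = ar a" using ar_vt arcs by metis
    show "vt (tail Q b) \<otimes> ar b = ar b" by (rule vt_ar[OF arcs(2)])
    show "\<exists>y\<in>carrier A. x \<otimes> vt (tail Q b) = y \<otimes> ar a" if "x \<in> carrier A" "x \<otimes> ar b = \<zero>" for x
      by (rule mult_mon_eq_zeroD[OF ab that ar_closed[OF arcs(2)]])
    show "x \<otimes> vt (tail Q a) = \<zero>" if "x \<in> carrier A" "x \<otimes> ar a = \<zero>" for x
      by (rule mult_mon_eq_zeroD'[OF _ that ar_closed[OF arcs(1)]]) (use n in blast)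
  qed
  then obtain y where y: "y \<in> carrier A" "ar a \<otimes> y = vt (tail Q a)" by blast
  have "coef (ar a \<otimes> y) (tail Q a, []) = 0" using y arcs tail_vert by (intro coef_mon_mult_0) auto
  then show False using y arcs tail_vert by (simp add: coef_mon)
qed

section \<open>Left ideals of arrows: presentations and resolutions\<close>

lemma proj_cover_ar:
  assumes ab: "(a, b) \<in> S"
  shows "proj_cover A (mm (vt (tail Q b))) (rmul (vt (tail Q b)) (ar b)) (mm (ar b))"
    and "a_kernel (mm (vt (tail Q b))) (mm (ar b)) (rmul (vt (tail Q b)) (ar b)) = carrier (mm (ar a))"
proof -
  have arcs: "a \<in> arcs Q" "b \<in> arcs Q" "head Q a = tail Q b" using S_sub[OF ab] by auto
  let ?e = "vt (tail Q b)"
  have idem: "?e \<otimes> ?e = ?e" using arcs tail_vert by (simp add: vt_idem)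
  have eb: "?e \<otimes> ar b = ar b" by (rule vt_ar[OF arcs(2)])
  have ae: "ar a \<otimes> ?e = ar a" using ar_vt[OF arcs(1)] arcs by simp
  have "{(x \<otimes> ?e, \<zero>) | x. x \<in> carrier A \<and> x \<otimes> (?e \<otimes> ar b) = \<zero>} = lgen (ar a) \<zero>"
  proof (intro equalityI subsetI)
    fix w assume "w \<in> {(x \<otimes> ?e, \<zero>) | x. x \<in> carrier A \<and> x \<otimes> (?e \<otimes> ar b) = \<zero>}"
    then obtain x where x: "x \<in> carrier A" "w = (x \<otimes> ?e, \<zero>)" "x \<otimes> ar b = \<zero>" by (auto simp: eb)
    then show "w \<in> lgen (ar a) \<zero>"
      using mult_mon_eq_zeroD[OF ab x(1,3) ar_closed[OF arcs(2)]] by (simp add: lgen0_iff)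
  next
    fix w assume "w \<in> lgen (ar a) \<zero>"
    then obtain x where x: "x \<in> carrier A" "w = (x \<otimes> ar a, \<zero>)" by (auto simp: lgen_def)
    have "x \<otimes> ar a = (x \<otimes> ar a) \<otimes> ?e" using x ae by (simp add: m_assoc)
    moreover have "(x \<otimes> ar a) \<otimes> (?e \<otimes> ar b) = \<zero>" using x ar_mult_ar[OF ab] eb by (simp add: m_assoc)
    moreover have "x \<otimes> ar a \<in> carrier A" using x by simp
    ultimately show "w \<in> {(x \<otimes> ?e, \<zero>) | x. x \<in> carrier A \<and> x \<otimes> (?e \<otimes> ar b) = \<zero>}" unfolding x(2) by blast
  qed
  then show ker: "a_kernel (mm ?e) (mm (ar b)) (rmul ?e (ar b)) = carrier (mm (ar a))"
    by (simp add: rmul_kernel)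
  have "superfluous A (mm ?e) (iota ` lgen (ar a) \<zero>)"
  proof (rule superfluous_lgen)
    show "subm (lgen (ar a) \<zero>)" by (simp add: subm_lgen)
    show "lgen (ar a) \<zero> \<subseteq> lgen ?e \<zero>"
      by (rule lgen_minimal) (use ae lgenI[of "ar a" \<zero> ?e \<zero>] in \<open>auto simp: subm_lgen intro: lgen_snd\<close>)
    show "lgen (ar a) \<zero> \<subseteq> filt 1 \<times> filt 1"
      by (auto simp: lgen0_iff filt_def intro!: coef_mult_mon_0)
  qed (auto simp: idem)
  moreover have "rmul ?e (ar b) \<in> lhom A (mm ?e) (mm (ar b))"
    by (rule rmul_lhom) (auto simp: subm_lgen eb intro: lgen_fst)
  moreover have "rmul ?e (ar b) ` carrier (mm ?e) = carrier (mm (ar b))"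
    using rmul_image[of ?e "ar b"] eb by simp
  ultimately show "proj_cover A (mm ?e) (rmul ?e (ar b)) (mm (ar b))"
    unfolding proj_cover_def ker using projective_mm[OF mon_closed idem] by simp
qed

lemma min_proj_presentation_ar:
  assumes "(c, a) \<in> S" "(a, b) \<in> S"
  shows "min_proj_presentation A (mm (vt (tail Q a))) (rmul (vt (tail Q a)) (ar a))
    (mm (vt (tail Q b))) (rmul (vt (tail Q b)) (ar b)) (mm (ar b))"
  unfolding min_proj_presentation_def proj_cover_ar(2)[OF assms(2)]
  using proj_cover_ar(1)[OF assms(1)] proj_cover_ar(1)[OF assms(2)] by simp

text \<open>As domain and range agree, predecessors can be taken indefinitely; the resulting
  sequence of arrows is exact under left and under right multiplication.\<close>

lemma cohen_macaulay_ar: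
  assumes dr: "Domain S = Range S" and b: "b \<in> Range S"
  shows "cohen_macaulay A (mm (ar b))"
proof -
  define pr where "pr = (\<lambda>c. SOME a. (a, c) \<in> S)"
  have pr: "(pr c, c) \<in> S" if "c \<in> Range S" for c
    using that unfolding pr_def by (auto intro: someI)
  define bs where "bs n = (pr ^^ n) b" for n
  have bsR: "bs n \<in> Range S" for n
  proof (induction n)
    case (Suc n)
    then have "bs (Suc n) \<in> Domain S" using pr[OF Suc] by (auto simp: bs_def)
    then show ?case using dr by simp
  qed (simp add: bs_def b)
  have S: "(bs (Suc n), bs n) \<in> S" for n using pr[OF bsR[of n]] by (simp add: bs_def)
  have arcs: "bs n \<in> arcs Q" "head Q (bs (Suc n)) = tail Q (bs n)" for n using S_sub[OF S[of n]] by auto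
  have "cohen_macaulay A (mm (ar (bs 0)))"
  proof (rule cohen_macaulay_mm[where s = "\<lambda>n. vt (tail Q (bs n))"])
    fix n
    show "vt (tail Q (bs n)) \<otimes> vt (tail Q (bs n)) = vt (tail Q (bs n))" using arcs tail_vert by (simp add: vt_idem)
    show "vt (tail Q (bs n)) \<otimes> ar (bs n) = ar (bs n)" by (rule vt_ar[OF arcs(1)])
    show "ar (bs (Suc n)) \<otimes> vt (tail Q (bs n)) = ar (bs (Suc n))" using ar_vt[OF arcs(1)] arcs(2) by metis
    show "ar (bs (Suc n)) \<otimes> ar (bs n) = \<zero>" by (rule ar_mult_ar[OF S])
  next
    fix n x assume x: "x \<in> carrier A" "x \<otimes> ar (bs n) = \<zero>"
    show "\<exists>y\<in>carrier A. x \<otimes> vt (tail Q (bs n)) = y \<otimes> ar (bs (Suc n))"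
      by (rule mult_mon_eq_zeroD[OF S x ar_closed[OF arcs(1)]])
  next
    fix n y assume y: "y \<in> carrier A" "ar (bs (Suc n)) \<otimes> y = \<zero>"
    show "\<exists>z\<in>carrier A. vt (tail Q (bs n)) \<otimes> y = ar (bs n) \<otimes> z"
      using ar_mult_eq_zeroD[OF S y] arcs(2) by simp
  qed auto
  then show ?thesis by (simp add: bs_def)
qed

section \<open>Left ideals of arrows: indecomposability and isomorphisms\<close>

lemma coef_mult_ar:
  assumes "x \<in> carrier A" "b \<in> arcs Q"
  shows "coef (x \<otimes> ar b) (tail Q b, [b]) = coef x (tail Q b, [])"
  using coef_mult_mon[OF assms(1), of "tail Q b" "[]" "[b]" "tail Q b"] ar_closed[OF assms(2)] by simp

text \<open>A section of the cover sends b to y e, where y has coefficient 1 at the trivial path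
  because y b = b. Then a y e has coefficient 1 at a, although it is the image of a b = 0.\<close>

lemma not_projective_ar:
  assumes ab: "(a, b) \<in> S"
  shows "\<not> projective A (mm (ar b))"
proof
  assume P: "projective A (mm (ar b))"
  have arcs: "a \<in> arcs Q" "b \<in> arcs Q" "head Q a = tail Q b" using S_sub[OF ab] by auto
  let ?e = "vt (tail Q b)" and ?M = "mm (ar b)"
  let ?g = "rmul ?e (ar b)" and ?f = "\<lambda>x\<in>carrier ?M. x"
  have eb: "?e \<otimes> ar b = ar b" by (rule vt_ar[OF arcs(2)])
  interpret M: left_module A ?M by (rule left_module_mm) auto
  have g: "?g \<in> lhom A (mm ?e) ?M" "?g ` carrier (mm ?e) = carrier ?M"
    using proj_cover_ar(1)[OF ab] by (auto simp: proj_cover_def)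
  have f: "?f \<in> lhom A ?M ?M" by (auto simp: lhom_def M.smult_closed simp del: pm_simps)
  obtain h where h: "h \<in> lhom A ?M (mm ?e)" "\<forall>x\<in>carrier ?M. ?g (h x) = ?f x"
    using P f g fg_module_mm[of ?e] fg_module_mm[of "ar b"] unfolding projective_def by blast
  have gen: "iota (ar b, \<zero>) \<in> carrier ?M" using mm_gen by simp
  obtain y where y: "y \<in> carrier A" "h (iota (ar b, \<zero>)) = iota (y \<otimes> ?e, \<zero>)"
    using lhom_closed[OF h(1) gen] by (rule mm_elem) auto
  have "?g (h (iota (ar b, \<zero>))) = iota (ar b, \<zero>)" using bspec[OF h(2) gen] gen by simp
  then have "y \<otimes> ar b = ar b" using y by (simp add: rmul_apply eb)
  then have "coef y (tail Q b, []) = 1"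
    using coef_mult_ar[OF y(1) arcs(2)] ar_closed[OF arcs(2)] by (simp add: coef_mon)
  moreover have "ar a \<otimes> (y \<otimes> ?e) = \<zero>"
  proof -
    have "h (iota (\<zero>, \<zero>)) = iota (\<zero>, \<zero>)"
      using lhom_zero[OF M.left_module_axioms left_module_mm[OF mon_closed] h(1)] by simp
    moreover have "ar a \<odot>\<^bsub>?M\<^esub> iota (ar b, \<zero>) = iota (\<zero>, \<zero>)" using ar_mult_ar[OF ab] by simp
    ultimately have "ar a \<odot>\<^bsub>mm ?e\<^esub> h (iota (ar b, \<zero>)) = iota (\<zero>, \<zero>)"
      using lhom_smult[OF h(1) mon_closed gen] by metis
    then show ?thesis using y by simp
  qed
  moreover have "coef (ar a \<otimes> (y \<otimes> ?e)) (tail Q a, [a]) = coef (y \<otimes> ?e) (head Q a, [])"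
    using coef_mon_mult[of "y \<otimes> ?e" "tail Q a" "[a]" "[]"] y ar_closed[OF arcs(1)] by simp
  ultimately show False using y arcs tail_vert ar_closed[OF arcs(1)] by (simp add: coef_mult_vt)
qed

text \<open>A b has a unique maximal submodule, the elements without b-term: Nakayama's lemma
  applies to the preimage \<open>L\<close> of \<open>Y\<close> under right multiplication by
  b.\<close>

lemma subm_ar_eq:
  assumes b: "b \<in> arcs Q" and Y: "subm Y" "Y \<subseteq> lgen (ar b) \<zero>"
    and y: "(y, y') \<in> Y" "coef y (tail Q b, [b]) \<noteq> 0"
  shows "Y = lgen (ar b) \<zero>"
proof -
  let ?e = "vt (tail Q b)"
  have idem: "?e \<otimes> ?e = ?e" using b tail_vert by (simp add: vt_idem)
  have eb: "?e \<otimes> ar b = ar b" by (rule vt_ar[OF b])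
  obtain x where x: "x \<in> carrier A" "y = x \<otimes> ar b" "y' = \<zero>"
    using subsetD[OF Y(2) y(1)] by (auto simp: lgen0_iff)
  define t where "t = inverse (coef x (tail Q b, []))"
  have t: "t * coef x (tail Q b, []) = 1" using y x coef_mult_ar[OF x(1) b] by (simp add: t_def)
  define L where "L = {(w, \<zero>) | w. w \<in> carrier A \<and> (w \<otimes> ar b, \<zero>) \<in> Y}"
  have L: "subm L" unfolding subm_def
  proof (intro conjI allI impI)
    fix x y x' y' assume "(x, y) \<in> L" "(x', y') \<in> L"
    then show "(x \<oplus> x', y \<oplus> y') \<in> L" using submD(4)[OF Y(1)] by (fastforce simp: L_def l_distr)
  next
    fix a x y assume "a \<in> carrier A" "(x, y) \<in> L"
    then show "(a \<otimes> x, a \<otimes> y) \<in> L" using submD(5)[OF Y(1), of a "x \<otimes> ar b" \<zero>] by (auto simp: L_def m_assoc)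
  qed (use submD(3)[OF Y(1)] in \<open>auto simp: L_def\<close>)
  \<comment> \<open>x is rescaled to have coefficient 1 at the trivial path and cut by the
    idempotent on both sides, so that it differs from the idempotent by an element of the
    radical.\<close>
  define l where "l = (t \<odot> ?e) \<otimes> (x \<otimes> ?e)"
  have lc: "l \<in> carrier A" using x by (simp add: l_def scal_carrier)
  have "l \<otimes> ar b = (t \<odot> ?e) \<otimes> y" using x eb by (simp add: l_def m_assoc scal_carrier)
  moreover have "((t \<odot> ?e) \<otimes> y, (t \<odot> ?e) \<otimes> y') \<in> Y" by (rule submD(5)[OF Y(1) scal_carrier[OF mon_closed] y(1)])
  ultimately have lL: "(l, \<zero>) \<in> L" using x lc by (simp add: L_def scal_carrier)
  have cl: "coef l (u, []) = (if u = tail Q b then 1 else 0)" if "(u, []) \<in> B" for u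
    using that x t tail_vert[OF b] by (simp add: l_def scal_mult coef_scal coef_vt_mult[of "x \<otimes> ?e"] coef_mult_vt)
  have "lgen ?e \<zero> \<subseteq> L"
  proof (rule nakayama_lgen[OF mon_closed zero_closed idem _ L _ lL _ _ _ submD(3)[OF L]])
    have le: "l \<otimes> ?e = l" using x idem by (simp add: l_def m_assoc scal_carrier)
    then have "?e \<ominus> l = (?e \<ominus> l) \<otimes> ?e" using lc idem by (simp add: minus_eq l_distr l_minus)
    then show "(?e \<ominus> l, \<zero>) \<in> lgen ?e \<zero>" using lc by (auto simp: lgen0_iff)
    show "?e = (?e \<ominus> l) \<oplus> l" using lc by (simp add: minus_eq a_assoc l_neg)
    have "coef (?e \<ominus> l) (u, []) = 0" if "(u, []) \<in> B" for u
    proof -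
      have "coef (?e \<ominus> l) (u, []) + coef l (u, []) = coef ?e (u, [])"
        using coef_add[of "?e \<ominus> l" l "(u, [])"] lc that by (simp add: minus_eq a_assoc l_neg)
      then show ?thesis using cl that by (auto simp: coef_mon split: if_splits)
    qed
    then show "?e \<ominus> l \<in> filt 1" using lc by (auto simp: filt_def)
    show "(\<zero>, \<zero>) \<in> lgen ?e \<zero>" using submD(3)[OF subm_lgen] by simp
  qed (auto simp: filt_def)
  moreover have "(?e, \<zero>) \<in> lgen ?e \<zero>" by (rule lgen_fst) auto
  ultimately have "(?e \<otimes> ar b, \<zero>) \<in> Y" by (auto simp: L_def)
  then have "lgen (ar b) \<zero> \<subseteq> Y" using submD(3)[OF Y(1)] by (intro lgen_minimal[OF Y(1)]) (auto simp: eb)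
  then show ?thesis using Y(2) by blast
qed

text \<open>Write b = y + z along the two summands. One of y and z has a nonzero b-term, so its
  summand is all of A b, which is not projective.\<close>

lemma no_projective_summand_ar:
  assumes ab: "(a, b) \<in> S"
  shows "no_projective_summand A (mm (ar b))"
  unfolding no_projective_summand_def
proof (intro allI impI, elim conjE)
  have b: "b \<in> arcs Q" using S_sub[OF ab] by auto
  let ?M = "mm (ar b)"
  have sM: "subm (lgen (ar b) \<zero>)" by (simp add: subm_lgen)
  fix N L assume N: "submodule N A ?M" and L: "submodule L A ?M" and NL: "N \<inter> L = {\<zero>\<^bsub>?M\<^esub>}"
    and sum: "N <+>\<^bsub>?M\<^esub> L = carrier ?M" and proj: "projective A (?M\<lparr>carrier := N\<rparr>)"
  obtain Y where Y: "subm Y" "Y \<subseteq> lgen (ar b) \<zero>" "N = iota ` Y" using N submodule_pm[OF sM] by auto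
  obtain Z where Z: "subm Z" "Z \<subseteq> lgen (ar b) \<zero>" "L = iota ` Z" using L submodule_pm[OF sM] by auto
  have "iota (ar b, \<zero>) \<in> N <+>\<^bsub>?M\<^esub> L" unfolding sum using mm_gen by simp
  then obtain y y' z z' where yz: "(y, y') \<in> Y" "(z, z') \<in> Z" "iota (ar b, \<zero>) = iota (y, y') \<oplus>\<^bsub>?M\<^esub> iota (z, z')"
    unfolding set_add_def set_mult_def Y(3) Z(3) by auto
  have yzc: "y \<in> carrier A" "y' \<in> carrier A" "z \<in> carrier A" "z' \<in> carrier A"
    using submD(1,2)[OF Y(1) yz(1)] submD(1,2)[OF Z(1) yz(2)] by auto
  then have "ar b = y \<oplus> z" using yz(3) by simp
  then have "coef y (tail Q b, [b]) + coef z (tail Q b, [b]) = 1"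
    using coef_add[OF yzc(1,3) ar_closed[OF b]] coef_mon[OF ar_closed[OF b], of "tail Q b" "[b]"] by metis
  then consider "coef y (tail Q b, [b]) \<noteq> 0" | "coef z (tail Q b, [b]) \<noteq> 0" by fastforce
  then show "N = {\<zero>\<^bsub>?M\<^esub>}"
  proof cases
    case 1
    then have "Y = lgen (ar b) \<zero>" by (rule subm_ar_eq[OF b Y(1,2) yz(1)])
    then show ?thesis using proj Y(3) not_projective_ar[OF ab] by simp
  next
    case 2
    then have "Z = lgen (ar b) \<zero>" by (rule subm_ar_eq[OF b Z(1,2) yz(2)])
    then have "N \<subseteq> L" using Y Z by auto
    then show ?thesis using NL by auto
  qed
qed

text \<open>The image of c has a nonzero b-term because b is a multiple of it, and b starts where c
  does. It is annihilated by p since p c = 0; for c \<noteq> b the path p b would be nonzero, a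
  contradiction.\<close>

lemma lmod_iso_ar_eq:
  assumes iso: "lmod_iso A (mm (ar c)) (mm (ar b))" and pc: "(p, c) \<in> S" and b: "b \<in> arcs Q"
  shows "c = b"
proof (rule ccontr)
  assume ne: "c \<noteq> b"
  obtain f where f: "f \<in> lhom A (mm (ar c)) (mm (ar b))" "f ` carrier (mm (ar c)) = carrier (mm (ar b))"
    using iso by (auto simp: lmod_iso_def bij_betw_def)
  have arcs: "p \<in> arcs Q" "c \<in> arcs Q" "head Q p = tail Q c" using S_sub[OF pc] by auto
  have gen: "iota (ar c, \<zero>) \<in> carrier (mm (ar c))" using mm_gen by simp
  obtain y where y: "y \<in> carrier A" "f (iota (ar c, \<zero>)) = iota (y \<otimes> ar b, \<zero>)"
    using lhom_closed[OF f(1) gen] by (rule mm_elem) auto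
  let ?w = "y \<otimes> ar b"
  have wc: "?w \<in> carrier A" using y by simp
  have fx: "f (iota (x \<otimes> ar c, \<zero>)) = iota (x \<otimes> ?w, \<zero>)" if "x \<in> carrier A" for x
    using lhom_smult[OF f(1) that gen] y that by simp
  have w0: "coef ?w (head Q b, []) = 0"
    using y b head_vert by (intro coef_mult_mon_0) auto
  have "iota (ar b, \<zero>) \<in> f ` carrier (mm (ar c))" unfolding f(2) using mm_gen by simp
  then obtain v where v: "v \<in> carrier (mm (ar c))" "iota (ar b, \<zero>) = f v" by blast
  obtain x where x: "x \<in> carrier A" "v = iota (x \<otimes> ar c, \<zero>)" using v(1) mon_closed by (rule mm_elem)
  have "ar b = x \<otimes> ?w" using v(2) x wc by (simp add: fx)
  then have "coef (x \<otimes> ?w) (tail Q b, [b]) = 1" using ar_closed[OF b] by (metis coef_mon)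
  moreover have "coef (x \<otimes> ?w) (tail Q b, [b]) = coef x (tail Q b, []) * coef ?w (tail Q b, [b])"
    using coef_mult[OF x(1) wc ar_closed[OF b]] w0 by simp
  ultimately have wb: "coef ?w (tail Q b, [b]) \<noteq> 0" by auto
  have "vt (tail Q c) \<otimes> ?w = ?w"
    using fx[OF mon_closed, of "tail Q c" "[]"] y wc vt_ar[OF arcs(2)] by simp
  then have tbc: "tail Q b = tail Q c"
    using wb coef_vt_mult[OF wc ar_closed[OF b], of "tail Q c"] by (auto split: if_splits)
  have "(tail Q p, [p] @ [b]) \<in> B" using ne tbc arcs b S_succ[OF pc, of b] by (auto simp: B_Cons head_vert)
  then have "coef (ar p \<otimes> ?w) (tail Q p, [p] @ [b]) = coef ?w (head Q p, [b])"
    using coef_mon_mult[OF wc, of "tail Q p" "[p]" "[b]"] by simp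
  moreover have "ar p \<otimes> ?w = \<zero>"
  proof -
    have "iota (ar p \<otimes> ?w, \<zero>) = f (iota (\<zero>, \<zero>))" using fx[of "ar p"] ar_mult_ar[OF pc] by simp
    also have "\<dots> = iota (\<zero>, \<zero>)"
      using lhom_zero[OF left_module_mm[OF mon_closed] left_module_mm[OF mon_closed] f(1)] by simp
    finally show ?thesis using wc by simp
  qed
  ultimately show False using wb tbc arcs \<open>(tail Q p, [p] @ [b]) \<in> B\<close> by simp
qed

end

section \<open>The second syzygy of the translate\<close>

text \<open>
  \<open>a' p\<close> is the longest nonzero path starting with \<open>a'\<close>; the functional \<open>\<phi>\<close> is the coefficient of \<open>p\<close>,
  which on \<open>a' A\<close> becomes the coefficient of the socle element \<open>a' p\<close>.
\<close>

locale arrow_chain = gentle_basis Q S A coef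
  for Q :: "('v, 'e) pre_digraph" and S and A :: "('k::field, 'a) module" (structure) and coef +
  fixes a'' a' a b :: 'e and p :: "'e list"
  assumes ab: "(a, b) \<in> S" and a'a: "(a', a) \<in> S" and a''a': "(a'', a') \<in> S"
    and dom_ran: "Domain S = Range S"
    and pB: "(tail Q a', a' # p) \<in> B"
    and p_max: "\<And>q. (tail Q a', a' # q) \<in> B \<Longrightarrow> length q \<le> length p"
begin

lemma chain_arcs: "a'' \<in> arcs Q" "a' \<in> arcs Q" "a \<in> arcs Q" "b \<in> arcs Q"
  "head Q a'' = tail Q a'" "head Q a' = tail Q a" "head Q a = tail Q b"
  using S_sub[OF ab] S_sub[OF a'a] S_sub[OF a''a'] by auto

abbreviation "v \<equiv> tgt (tail Q a) p"
abbreviation "m \<equiv> mon (tail Q a') (a' # p)"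
text \<open>The last arrow is taken in \<open>a' # p\<close> because \<open>p\<close> may be
  empty.\<close>

abbreviation "w \<equiv> last (a' # p)"

lemma pB': "(tail Q a, p) \<in> B"
  using pB chain_arcs by (simp add: B_Cons)

lemma v_vert: "v \<in> verts Q"
  using tgt_vert[OF pB'] .

lemma tgt_m: "tgt (tail Q a') (a' # p) = v"
  using chain_arcs by (simp add: tgt_def)

lemma take_drop_p: "(tail Q a, take i p) \<in> B" "(tgt (tail Q a) (take i p), drop i p) \<in> B"
  by (rule B_take_drop[OF pB'])+

text \<open>The arrow a' can be put in front of such a path without creating a relation, so
  comparability and maximality apply. Hence the prefixes of p form a basis of the transpose.\<close>

lemma prefix_p:
  assumes q: "(tail Q a, q) \<in> B" "q \<noteq> [] \<Longrightarrow> hd q \<noteq> a" shows "prefix q p"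
proof (cases q)
  case (Cons c r)
  have "(a', c) \<notin> S" using S_succ[OF a'a, of c] q Cons by auto
  then have aq: "(tail Q a', a' # q) \<in> B" using q Cons chain_arcs B_Cons[of "tail Q a'" a' q] by simp
  then have "nz (a' # q)" "nz (a' # p)" using pB by (auto simp: B_def)
  then have "prefix q p \<or> prefix p q" by (rule nz_prefix_comparable)
  then show ?thesis using p_max[OF aq] by (auto simp: prefix_def)
qed simp

text \<open>The functional pairs each prefix of p with its complementary suffix; this perfect
  pairing is what makes every functional representable.\<close>

lemma phi_mult:
  assumes y: "y \<in> carrier A" "x \<in> carrier A"
  shows "coef (vt (tail Q a) \<otimes> y \<otimes> x) (tail Q a, p) =
    (\<Sum>i\<le>length p. coef y (tail Q a, take i p) * coef x (tgt (tail Q a) (take i p), drop i p))"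
  using y by (simp add: coef_mult[OF _ _ pB'] coef_vt_mult take_drop_p)

lemma phi_repr_ex:
  assumes add: "\<And>x y. x \<in> carrier A \<Longrightarrow> y \<in> carrier A \<Longrightarrow> G (x \<oplus> y) = G x + G y"
    and G_a: "\<And>y. y \<in> carrier A \<Longrightarrow> G (ar a \<otimes> y) = (0::'k)"
    and scal: "\<And>t y. y \<in> carrier A \<Longrightarrow> G (y \<otimes> (t \<odot> \<one>)) = t * G y"
    and G_vt: "\<And>y. y \<in> carrier A \<Longrightarrow> G (vt (tail Q a) \<otimes> y) = G y"
  shows "\<exists>x\<in>carrier A. \<forall>y\<in>carrier A. G y = coef (vt (tail Q a) \<otimes> y \<otimes> x) (tail Q a, p) \<and> x \<otimes> vt v = x"
proof -
  let ?h = "tail Q a"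
  \<comment> \<open>At the suffix \<open>drop i p\<close> the coefficient is the value of
    \<open>G\<close> on the complementary prefix; \<open>length p - length q\<close> recovers i from
    the suffix q.\<close>
  define x where "x = el (\<lambda>(u, q). if \<exists>i\<le>length p. (u, q) = (tgt ?h (take i p), drop i p)
     then G (mon ?h (take (length p - length q) p)) else 0)"
  have xc: "x \<in> carrier A" by (simp add: x_def el)
  have cx: "coef x (tgt ?h (take i p), drop i p) = G (mon ?h (take i p))" if "i \<le> length p" for i
    using that take_drop_p(2)[of i] by (auto simp: x_def el)
  have G0: "G \<zero> = 0" using G_a[OF zero_closed] by simp
  let ?X = "(\<lambda>i. (?h, take i p)) ` {..length p}"
  have XB: "?X \<subseteq> B" using take_drop_p by auto
  have inj: "inj_on (\<lambda>i. (?h, take i p)) {..length p}"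
  proof (rule inj_onI)
    fix i j assume "i \<in> {..length p}" "j \<in> {..length p}" "(?h, take i p) = (?h, take j p)"
    then have "length (take i p) = length (take j p)" "i \<le> length p" "j \<le> length p" by auto
    then show "i = j" by simp
  qed
  \<comment> \<open>A basis path that is not a prefix of p starts at another vertex, where
    \<open>G_vt\<close> applies, or with the arrow a, where \<open>G_a\<close> applies.\<close>
  have vanish: "G (mon u q) = 0" if uq: "(u, q) \<in> B - ?X" for u q
  proof (cases "u = ?h")
    case False
    then have "vt ?h \<otimes> mon u q = \<zero>" by (intro mon_mult_0) simp
    then show ?thesis using G_vt[OF mon_closed, of u q] G0 by simp
  next
    case True
    have "\<not> prefix q p"
    proof
      assume "prefix q p"
      then have "q = take (length q) p" "length q \<le> length p" by (auto simp: prefix_def)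
      then have "(u, q) \<in> ?X" using True by auto
      then show False using uq by blast
    qed
    then obtain r where q: "q = a # r" using prefix_p[of q] uq True by (cases q) auto
    have "ar a \<otimes> mon (head Q a) r = mon u q"
      using uq True q mon_mult[of ?h "[a]" "head Q a" r] ar_closed[OF chain_arcs(3)] by simp
    then show ?thesis using G_a[OF mon_closed] by metis
  qed
  have "G y = coef (vt ?h \<otimes> y \<otimes> x) (?h, p)" if y: "y \<in> carrier A" for y
  proof -
    have "G y = (\<Sum>(u, q)\<in>B. coef y (u, q) * G (mon u q))" by (rule additive_expand[OF add scal y])
    also have "\<dots> = (\<Sum>(u, q)\<in>?X. coef y (u, q) * G (mon u q))"
      using finite_B XB vanish by (intro sum.mono_neutral_right) auto
    also have "\<dots> = (\<Sum>i\<le>length p. coef y (?h, take i p) * G (mon ?h (take i p)))"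
      by (simp add: sum.reindex[OF inj])
    also have "\<dots> = coef (vt ?h \<otimes> y \<otimes> x) (?h, p)" unfolding phi_mult[OF y xc] using cx by simp
    finally show ?thesis .
  qed
  moreover have "x \<otimes> vt v = x"
  proof (rule coef_inj)
    fix s assume s: "s \<in> B"
    obtain u q where uq: "s = (u, q)" by force
    have "coef x (u, q) = 0" if "tgt u q \<noteq> v"
    proof -
      have "\<not> (\<exists>i\<le>length p. (u, q) = (tgt ?h (take i p), drop i p))"
        using that tgt_append[of ?h "take i p" "drop i p" for i] by auto
      then show ?thesis using s unfolding x_def uq by (subst el) auto
    qed
    then show "coef (x \<otimes> vt v) s = coef x s" using s uq xc by (simp add: coef_mult_vt)
  qed (use xc in auto)
  ultimately show ?thesis using xc by blast
qed

sublocale minimal_presentation A iota "vt (tail Q a)" "vt (tail Q b)" "ar a" "vt v" "\<lambda>y. coef y (tail Q a, p)"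
proof unfold_locales
  show "vt (tail Q a) \<otimes> vt (tail Q a) = vt (tail Q a)" "vt (tail Q b) \<otimes> vt (tail Q b) = vt (tail Q b)"
    using chain_arcs tail_vert by (simp_all add: vt_idem)
  show "vt v \<otimes> vt v = vt v" by (rule vt_idem[OF v_vert])
  show "vt (tail Q a) \<otimes> ar a = ar a" by (rule vt_ar) (rule chain_arcs)
  show "ar a \<otimes> vt (tail Q b) = ar a" using ar_vt[OF chain_arcs(3)] chain_arcs by simp
  show "coef (ar a \<otimes> y) (tail Q a, p) = 0" if "y \<in> carrier A" for y
  proof (rule coef_mon_mult_0[OF that pB'])
    have "\<not> prefix [a] p" using pB a'a by (auto simp: B_Cons prefix_def)
    then show "\<not> (tail Q a = tail Q a \<and> prefix [a] p)" by simp
  qed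
  show "coef (y \<otimes> (t \<odot> \<one>) \<otimes> x) (tail Q a, p) = t * coef (y \<otimes> x) (tail Q a, p)"
    if "x \<in> carrier A" "y \<in> carrier A" for t x y
    using that by (simp add: mult_scal_one scal_mult coef_scal pB')
qed (auto simp: coef_add pB' scal_carrier intro!: phi_repr_ex)

text \<open>Testing against the prefix \<open>take i p\<close> isolates the coefficient at the
  complementary suffix.\<close>

lemma ker_iff: "(x, y) \<in> ker \<longleftrightarrow> y = \<zero> \<and> x \<in> carrier A \<and> x \<otimes> vt v = x \<and>
    (\<forall>i\<le>length p. coef x (tgt (tail Q a) (take i p), drop i p) = 0)"
proof -
  have "(\<forall>y\<in>carrier A. coef (vt (tail Q a) \<otimes> y \<otimes> x) (tail Q a, p) = 0) \<longleftrightarrow>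
    (\<forall>i\<le>length p. coef x (tgt (tail Q a) (take i p), drop i p) = 0)" (is "?L \<longleftrightarrow> ?R") if x: "x \<in> carrier A"
  proof (intro iffI ballI allI impI)
    fix y assume ?R "y \<in> carrier A"
    then show "coef (vt (tail Q a) \<otimes> y \<otimes> x) (tail Q a, p) = 0" using x by (simp add: phi_mult)
  next
    fix i assume L: ?L and i: "i \<le> length p"
    have "coef (mon (tail Q a) (take i p)) (tail Q a, take j p) * coef x (tgt (tail Q a) (take j p), drop j p) =
       (if j = i then coef x (tgt (tail Q a) (take i p), drop i p) else 0)" if "j \<le> length p" for j
    proof -
      have "take j p = take i p \<longleftrightarrow> j = i" using i that by (metis length_take min.absorb2)
      then show ?thesis using take_drop_p by (simp add: coef_mon)
    qed
    then have "(\<Sum>j\<le>length p. coef (mon (tail Q a) (take i p)) (tail Q a, take j p) *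
        coef x (tgt (tail Q a) (take j p), drop j p)) = coef x (tgt (tail Q a) (take i p), drop i p)"
      using i by simp
    then show "coef x (tgt (tail Q a) (take i p), drop i p) = 0"
      using phi_mult[OF mon_closed x, of "tail Q a" "take i p"] bspec[OF L mon_closed, of "tail Q a" "take i p"] by metis
  qed
  then show ?thesis unfolding ker_def by auto
qed

text \<open>The suffix for i = \<open>length p\<close> is the trivial path at v, and no other
  trivial path can occur in an element of A v.\<close>

lemma ker_filt: "ker \<subseteq> filt 1 \<times> filt 1"
proof (rule subrelI)
  fix x y assume "(x, y) \<in> ker"
  then have x: "y = \<zero>" "x \<in> carrier A" "x \<otimes> vt v = x" "coef x (v, []) = 0"
    by (auto simp: ker_iff)
  have "coef x (u, []) = 0" if "(u, []) \<in> B" for u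
    using coef_mult_vt[OF x(2) that, of v] x(3,4) by (auto split: if_splits)
  then show "(x, y) \<in> filt 1 \<times> filt 1" using x by (auto simp: filt_def)
qed

lemma ker_subset: "ker \<subseteq> lgen (vt v) \<zero>"
proof (rule subrelI)
  fix x y assume "(x, y) \<in> ker"
  then show "(x, y) \<in> lgen (vt v) \<zero>" using lgenI[of x \<zero> "vt v" \<zero>] by (simp add: ker_iff)
qed

lemma syzygy_translate: "syzygy A T (pm ker)"
  unfolding syzygy_def
proof (intro exI conjI)
  show "proj_cover A (mm (vt v)) tcover T"
    unfolding proj_cover_def tcover_kernel
    using projective_mm[OF mon_closed vt_idem[OF v_vert]] tcover_lhom tcover_surj
      superfluous_lgen[OF mon_closed zero_closed vt_idem[OF v_vert] _ subm_ker ker_subset ker_filt] by simp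
  show "pm ker = mm (vt v)\<lparr>carrier := a_kernel (mm (vt v)) T tcover\<rparr>"
    by (simp add: tcover_kernel)
qed

lemma ar_translate_T: "ar_translate A (mm (ar b)) T"
  unfolding ar_translate_def using min_proj_presentation_ar[OF a'a ab] by blast

text \<open>Nonzero paths with a common last arrow are comparable as suffixes. A path that ends with
  w and is no suffix of p must therefore end with all of a' p.\<close>

lemma path_end_cases:
  assumes uq: "(u, q) \<in> B" "tgt u q = v" and n: "\<And>i. i \<le> length p \<Longrightarrow> (u, q) \<noteq> (tgt (tail Q a) (take i p), drop i p)"
  shows "(\<exists>r. q = r @ a' # p) \<or> (\<exists>r d. q = r @ [d] \<and> d \<noteq> w)"
proof (cases q rule: rev_cases)
  case Nil
  then show ?thesis using uq n[of "length p"] by simp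
next
  case (snoc r d)
  show ?thesis
  proof (cases "d = w")
    case True
    define p' where "p' = butlast (a' # p)"
    have p': "a' # p = p' @ [w]" by (simp add: p'_def del: butlast.simps last.simps)
    have "nz (r @ [w])" using uq snoc True by (simp add: B_def del: last.simps)
    moreover have "nz (p' @ [w])" using pB unfolding p'[symmetric] by (simp add: B_def)
    ultimately have "suffix r p' \<or> suffix p' r" by (rule nz_suffix_comparable)
    then show ?thesis
    proof
      assume "suffix p' r"
      then obtain t where "r = t @ p'" by (auto simp: suffix_def)
      then have "q = t @ a' # p" using snoc True p' by simp
      then show ?thesis by blast
    next
      assume "suffix r p'"
      then have "suffix q (a' # p)" using snoc True p' by (auto simp: suffix_def)
      then consider "q = a' # p" | "suffix q p" by (auto simp: suffix_Cons)
      then show ?thesis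
      proof cases
        case 1 then show ?thesis by auto
      next
        case 2
        then obtain t where t: "p = t @ q" by (auto simp: suffix_def)
        have "(tgt (tail Q a) t, q) \<in> B" using pB' t by (simp add: B_append)
        then have "u = tgt (tail Q a) t" using uq snoc by (auto simp: B_def)
        then show ?thesis using n[of "length t"] t by simp
      qed
    qed
  qed (use snoc in auto)
qed

text \<open>The summand A d of the kernel with its cover A e. If no arrow other than w ends at v,
  both are zero, which keeps the later argument uniform. The last property extracts from x the terms
  ending in d.\<close>

lemma second_summand:
  obtains e d where "e \<in> carrier A" "d \<in> carrier A" "e \<otimes> e = e" "e \<otimes> d = d" "(d, \<zero>) \<in> ker"
    "\<And>x y. x \<in> carrier A \<Longrightarrow> y \<in> carrier A \<Longrightarrow> x \<otimes> m \<oplus> y \<otimes> d = \<zero> \<Longrightarrow> y \<otimes> e = \<zero>"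
    "\<And>x. x \<in> carrier A \<Longrightarrow> \<exists>y\<in>carrier A. \<forall>u q. (u, q) \<in> B \<longrightarrow> coef (y \<otimes> d) (u, q) =
      (if \<exists>r c. q = r @ [c] \<and> c \<noteq> w \<and> head Q c = v then coef x (u, q) else 0)"
proof (cases "\<exists>d\<in>arcs Q. head Q d = v \<and> d \<noteq> w")
  case False
  show ?thesis
  proof (rule that[of \<zero> \<zero>])
    show "(\<zero>, \<zero>) \<in> ker" by (rule submD(3)[OF subm_ker])
    fix x assume "x \<in> carrier A"
    show "\<exists>y\<in>carrier A. \<forall>u q. (u, q) \<in> B \<longrightarrow> coef (y \<otimes> \<zero>) (u, q) =
      (if \<exists>r c. q = r @ [c] \<and> c \<noteq> w \<and> head Q c = v then coef x (u, q) else 0)"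
      using False by (intro bexI[of _ \<zero>]) (auto simp: B_snoc simp del: last.simps)
  qed auto
next
  case True
  then obtain d where d: "d \<in> arcs Q" "head Q d = v" "d \<noteq> w" by blast
  have "w \<in> set (a' # p)" by (rule last_in_set) simp
  then have wa: "w \<in> arcs Q" using pB by (auto simp: B_def nz_def simp del: last.simps)
  have wv: "head Q w = v" using tgt_m by (simp add: tgt_def del: last.simps)
  have uniq: "c = d" if "c \<in> arcs Q" "head Q c = v" "c \<noteq> w" for c
    using in_deg[OF v_vert] finite_arcs d wa wv that
    by (intro at_most_one_other[of "{a \<in> arcs Q. head Q a = v}" w]) auto
  \<comment> \<open>This makes A d projective. A predecessor would give d a successor c'; as w is
    not the predecessor of c', the path a' p could be prolonged by c'.\<close>
  have no_pred: "(c, d) \<notin> S" for c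
  proof
    assume "(c, d) \<in> S"
    then obtain c' where c': "(d, c') \<in> S" using dom_ran by blast
    have "(w, c') \<notin> S" using S_pred[OF c', of w] d by metis
    moreover have "c' \<in> arcs Q" "v = tail Q c'" using S_sub[OF c'] d by auto
    ultimately have "(tail Q a', (a' # p) @ [c']) \<in> B"
      using pB tgt_m unfolding B_snoc by simp
    then show False using p_max[of "p @ [c']"] by simp
  qed
  have ev: "vt (tail Q d) \<otimes> ar d = ar d" "ar d \<otimes> vt v = ar d" using vt_ar[OF d(1)] ar_vt[OF d(1)] d(2) by auto
  show ?thesis
  proof (rule that[of "vt (tail Q d)" "ar d"])
    show "vt (tail Q d) \<otimes> vt (tail Q d) = vt (tail Q d)" using d tail_vert by (simp add: vt_idem)
    have "drop i p \<noteq> [d]" for i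
    proof
      assume "drop i p = [d]"
      then have "last p = d" "p \<noteq> []" by (metis last_drop last.simps drop_all not_le_imp_less list.discI, auto)
      then show False using d(3) by simp
    qed
    then show "(ar d, \<zero>) \<in> ker" using take_drop_p ev by (auto simp: ker_iff coef_mon)
  next
    fix x y assume x: "x \<in> carrier A" and y: "y \<in> carrier A" and 0: "x \<otimes> m \<oplus> y \<otimes> ar d = \<zero>"
    show "y \<otimes> vt (tail Q d) = \<zero>"
    proof (rule coef_inj)
      fix s assume s: "s \<in> B"
      obtain u r where ur: "s = (u, r)" by force
      have "coef y (u, r) = 0" if t: "tgt u r = tail Q d"
      proof -
        have B: "(u, r @ [d]) \<in> B" using s ur t d no_pred by (simp add: B_snoc)
        have "coef (x \<otimes> m) (u, r @ [d]) = 0"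
        proof (rule coef_mult_mon_0[OF x B])
          fix r' assume "r @ [d] = r' @ a' # p"
          then have "d = w" by (metis last_appendR last_snoc list.discI)
          then show "tgt u r' \<noteq> tail Q a'" using d by simp
        qed
        moreover have "coef (y \<otimes> ar d) (u, r @ [d]) = coef y (u, r)" by (rule coef_mult_mon[OF y B t])
        moreover have "coef (x \<otimes> m \<oplus> y \<otimes> ar d) (u, r @ [d]) = 0" unfolding 0 using B by simp
        ultimately show ?thesis using x y B by (simp add: coef_add)
      qed
      then show "coef (y \<otimes> vt (tail Q d)) s = coef \<zero> s" using s ur y by (simp add: coef_mult_vt)
    qed (use y in auto)
  next
    fix x assume x: "x \<in> carrier A"
    define y where "y = el (\<lambda>(u, r). coef x (u, r @ [d]))"
    have yc: "y \<in> carrier A" by (simp add: y_def el)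
    have "coef (y \<otimes> ar d) (u, q) = (if \<exists>r c. q = r @ [c] \<and> c \<noteq> w \<and> head Q c = v then coef x (u, q) else 0)"
      if uq: "(u, q) \<in> B" for u q
    proof (cases "\<exists>r. q = r @ [d]")
      case True
      then obtain r where r: "q = r @ [d]" by blast
      then have "coef (y \<otimes> ar d) (u, q) = coef y (u, r)" using uq coef_mult_mon[OF yc, of u r "[d]"] by (simp add: B_snoc)
      also have "\<dots> = coef x (u, q)" using uq r by (simp add: y_def el B_snoc)
      finally show ?thesis using r d by auto
    next
      case False
      then have "coef (y \<otimes> ar d) (u, q) = 0" using uq by (intro coef_mult_mon_0[OF yc]) auto
      moreover have "\<not> (\<exists>r c. q = r @ [c] \<and> c \<noteq> w \<and> head Q c = v)" using False uniq uq by (auto simp: B_snoc simp del: last.simps)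
      ultimately show ?thesis by (simp only: if_False)
    qed
    then show "\<exists>y\<in>carrier A. \<forall>u q. (u, q) \<in> B \<longrightarrow> coef (y \<otimes> ar d) (u, q) =
      (if \<exists>r c. q = r @ [c] \<and> c \<noteq> w \<and> head Q c = v then coef x (u, q) else 0)" using yc by blast
  qed (use ev in auto)
qed

text \<open>The path a' p is longer than every suffix of p.\<close>

lemma m_in_ker: "(m, \<zero>) \<in> ker"
proof -
  have "coef m (tgt (tail Q a) (take i p), drop i p) = 0" for i
  proof -
    have "length (drop i p) \<noteq> length (a' # p)" by simp
    then have "drop i p \<noteq> a' # p" by metis
    then show ?thesis using take_drop_p by (simp add: coef_mon)
  qed
  then show ?thesis using mon_vt[OF pB tgt_m] by (simp add: ker_iff)
qed

text \<open>The cover is (x, y) \<mapsto> x m + y d. In its kernel y vanishes because A d is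
  projective and meets A m trivially, while x is annihilated by a' p on the right exactly as by a',
  which leaves A a''.\<close>

lemma syzygy_ker: "syzygy A (pm ker) (mm (ar a''))"
proof -
  obtain e d where ed: "e \<in> carrier A" "d \<in> carrier A" "e \<otimes> e = e" "e \<otimes> d = d" "(d, \<zero>) \<in> ker"
    and zero: "\<And>x y. x \<in> carrier A \<Longrightarrow> y \<in> carrier A \<Longrightarrow> x \<otimes> m \<oplus> y \<otimes> d = \<zero> \<Longrightarrow> y \<otimes> e = \<zero>"
    and repr: "\<And>x. x \<in> carrier A \<Longrightarrow> \<exists>y\<in>carrier A. \<forall>u q. (u, q) \<in> B \<longrightarrow> coef (y \<otimes> d) (u, q) =
      (if \<exists>r c. q = r @ [c] \<and> c \<noteq> w \<and> head Q c = v then coef x (u, q) else 0)"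
    by (rule second_summand) blast
  let ?t = "vt (tail Q a')"
  have tt: "?t \<otimes> ?t = ?t" using chain_arcs tail_vert by (simp add: vt_idem)
  have tm: "?t \<otimes> m = m" by (rule vt_mon[OF pB])
  have at: "ar a'' \<otimes> ?t = ar a''" using ar_vt[OF chain_arcs(1)] chain_arcs by simp
  have am: "ar a'' \<otimes> m = \<zero>"
    using mon_mult[of "tail Q a''" "[a'']" "tail Q a'" "a' # p"] chain_arcs a''a' ar_closed tail_vert by (simp add: B_Cons)
  let ?P = "lgen ?t e"
  let ?f = "lift ?P (\<lambda>(x, y). iota (x \<otimes> m \<oplus> y \<otimes> d, \<zero>))"
  have sP: "subm ?P" using ed by (simp add: subm_lgen)
  have PC: "?P \<subseteq> carrier A \<times> carrier A" using ed by (simp add: lgen_carrier)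
  have in_ker: "(x \<otimes> m \<oplus> y \<otimes> d, \<zero>) \<in> ker" if "x \<in> carrier A" "y \<in> carrier A" for x y
    using submD(4)[OF subm_ker submD(5)[OF subm_ker that(1) m_in_ker] submD(5)[OF subm_ker that(2) ed(5)]] that by simp
  have f: "?f \<in> lhom A (pm ?P) (pm ker)"
  proof (rule lift_lhom[OF sP], goal_cases)
    case (1 x y) then show ?case using in_ker PC by auto
  next
    case (2 x y x' y')
    then have "x \<in> carrier A" "y \<in> carrier A" "x' \<in> carrier A" "y' \<in> carrier A" using PC by auto
    then show ?case using ed by (simp add: l_distr a_ac)
  next
    case (3 c x y)
    then have "x \<in> carrier A" "y \<in> carrier A" using PC by auto
    then show ?case using ed 3 by (simp add: r_distr m_assoc)
  qed
  have surj: "?f ` carrier (pm ?P) = carrier (pm ker)"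
  proof (intro equalityI subsetI)
    fix s assume "s \<in> ?f ` carrier (pm ?P)"
    then show "s \<in> carrier (pm ker)" using lhom_closed[OF f] by blast
  next
    fix s assume "s \<in> carrier (pm ker)"
    then obtain x where x: "s = iota (x, \<zero>)" "x \<in> carrier A" "x \<otimes> vt v = x"
      "\<And>i. i \<le> length p \<Longrightarrow> coef x (tgt (tail Q a) (take i p), drop i p) = 0"
      by (auto simp: ker_iff)
    \<comment> \<open>\<open>x1\<close> gathers the terms of x that end in a' p, with this end
      removed; \<open>y1\<close> accounts for those ending in the other arrow.\<close>
    define x1 where "x1 = el (\<lambda>(u, r). coef x (u, r @ a' # p))"
    have x1: "x1 \<in> carrier A" by (simp add: x1_def el)
    obtain y1 where y1: "y1 \<in> carrier A" "\<And>u q. (u, q) \<in> B \<Longrightarrow> coef (y1 \<otimes> d) (u, q) =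
      (if \<exists>r c. q = r @ [c] \<and> c \<noteq> w \<and> head Q c = v then coef x (u, q) else 0)" using repr[OF x(2)] by blast
    have "x = x1 \<otimes> m \<oplus> y1 \<otimes> d"
    proof (rule coef_inj)
      fix s assume s: "s \<in> B"
      obtain u q where uq: "s = (u, q)" by force
      have B: "(u, q) \<in> B" using s uq by simp
      have "coef x (u, q) = coef (x1 \<otimes> m) (u, q) + coef (y1 \<otimes> d) (u, q)"
      proof (cases "\<exists>r. q = r @ a' # p")
        case True
        then obtain r where r: "q = r @ a' # p" by blast
        then have "(u, r) \<in> B" "(tgt u r, a' # p) \<in> B" using B by (simp_all add: B_append)
        then have "coef (x1 \<otimes> m) (u, q) = coef x (u, q)"
          using B unfolding r by (subst coef_mult_mon[OF x1]) (auto simp: x1_def el B_Cons)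
        moreover have "\<not> (\<exists>r c. q = r @ [c] \<and> c \<noteq> w \<and> head Q c = v)"
        proof
          assume "\<exists>r c. q = r @ [c] \<and> c \<noteq> w \<and> head Q c = v"
          then obtain r' c where "r @ a' # p = r' @ [c]" "c \<noteq> w" using r by auto
          then show False by (metis last_appendR last_snoc list.discI)
        qed
        ultimately show ?thesis using y1(2)[OF B] by (simp only: if_False add_0_right)
      next
        case False
        then have "coef (x1 \<otimes> m) (u, q) = 0" using B by (intro coef_mult_mon_0[OF x1]) auto
        moreover have "coef x (u, q) = 0" if n: "\<not> (\<exists>r c. q = r @ [c] \<and> c \<noteq> w \<and> head Q c = v)"
        proof (cases "tgt u q = v")
          case t: True
          show ?thesis
          proof (rule ccontr)
            assume "coef x (u, q) \<noteq> 0"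
            then have "\<And>i. i \<le> length p \<Longrightarrow> (u, q) \<noteq> (tgt (tail Q a) (take i p), drop i p)" using x(4) by metis
            from path_end_cases[OF B t this] False n t show False by auto
          qed
        next
          case False
          then show ?thesis using coef_mult_vt[OF x(2) B, of v] x(3) by simp
        qed
        ultimately show ?thesis using y1(2)[OF B] by simp
      qed
      then show "coef x s = coef (x1 \<otimes> m \<oplus> y1 \<otimes> d) s"
        using coef_add[of "x1 \<otimes> m" "y1 \<otimes> d" "(u, q)"] x1 y1(1) ed B by (simp add: uq)
    qed (use x x1 y1 ed in auto)
    moreover have "?f (iota (x1 \<otimes> ?t, y1 \<otimes> e)) = iota (x1 \<otimes> m \<oplus> y1 \<otimes> d, \<zero>)"
      using lgenI[OF x1 y1(1), of ?t e] PC x1 y1(1) ed tm by (simp add: m_assoc)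
    ultimately have "s = ?f (iota (x1 \<otimes> ?t, y1 \<otimes> e))" using x(1) by simp
    moreover have "iota (x1 \<otimes> ?t, y1 \<otimes> e) \<in> carrier (pm ?P)" using lgenI[OF x1 y1(1)] by simp
    ultimately show "s \<in> ?f ` carrier (pm ?P)" by (rule image_eqI)
  qed
  have ker_f: "a_kernel (pm ?P) (pm ker) ?f = carrier (mm (ar a''))"
  proof (intro equalityI subsetI)
    fix s assume "s \<in> a_kernel (pm ?P) (pm ker) ?f"
    then have s: "s \<in> carrier (pm ?P)" "?f s = iota (\<zero>, \<zero>)" by (auto simp: a_kernelD)
    then obtain x y where xy: "(x, y) \<in> ?P" "s = iota (x, y)" by auto
    have id: "x \<otimes> ?t = x" "y \<otimes> e = y" "x \<in> carrier A" "y \<in> carrier A"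
      by (rule lgen_idem[OF mon_closed ed(1) tt ed(3) xy(1)])+
    have 0: "x \<otimes> m \<oplus> y \<otimes> d = \<zero>" using s(2) xy PC id ed by simp
    have y: "y = \<zero>" using zero[OF id(3,4) 0] id by simp
    then have "x \<otimes> m = \<zero>" using 0 id ed by simp
    from mult_mon_eq_zeroD[OF a''a' id(3) this pB] obtain x' where "x' \<in> carrier A" "x = x' \<otimes> ar a''" using id by auto
    then show "s \<in> carrier (mm (ar a''))" using xy y by simp
  next
    fix s assume "s \<in> carrier (mm (ar a''))"
    then obtain x where x: "x \<in> carrier A" "s = iota (x \<otimes> ar a'', \<zero>)" using mon_closed by (rule mm_elem)
    have "(x \<otimes> ar a'') \<otimes> ?t = x \<otimes> ar a''" using x at by (simp add: m_assoc)
    then have P: "(x \<otimes> ar a'', \<zero>) \<in> ?P" using lgenI[of "x \<otimes> ar a''" \<zero> ?t e] x ed by simp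
    have "(x \<otimes> ar a'') \<otimes> m = \<zero>" using x am by (simp add: m_assoc)
    then show "s \<in> a_kernel (pm ?P) (pm ker) ?f" using P x ed PC by (simp add: a_kernelD)
  qed
  have "superfluous A (pm ?P) (iota ` lgen (ar a'') \<zero>)"
  proof (rule superfluous_lgen)
    show "subm (lgen (ar a'') \<zero>)" by (simp add: subm_lgen)
    show "lgen (ar a'') \<zero> \<subseteq> ?P"
      by (rule lgen_minimal[OF sP]) (use at ed lgenI[of "ar a''" \<zero> ?t e] submD(3)[OF sP] in auto)
    show "lgen (ar a'') \<zero> \<subseteq> filt 1 \<times> filt 1"
      by (auto simp: lgen0_iff filt_def intro!: coef_mult_mon_0)
  qed (use ed tt in auto)
  then have "proj_cover A (pm ?P) ?f (pm ker)"
    unfolding proj_cover_def ker_f using f surj projective_lgen[OF mon_closed ed(1) tt ed(3)] by simp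
  moreover have "mm (ar a'') = (pm ?P)\<lparr>carrier := a_kernel (pm ?P) (pm ker) ?f\<rparr>" by (simp add: ker_f)
  ultimately show ?thesis unfolding syzygy_def by blast
qed

end

context gentle_basis
begin

lemma syzygy2_translate_ar:
  assumes "(a, b) \<in> S" "(a', a) \<in> S" "(a'', a') \<in> S" "Domain S = Range S"
  shows "\<exists>T K. ar_translate A (mm (ar b)) T \<and> syzygy A T K \<and> syzygy A K (mm (ar a''))"
proof -
  have a': "a' \<in> arcs Q" using S_sub[OF assms(2)] by simp
  \<comment> \<open>There are finitely many nonzero paths, so a longest continuation of a'
    exists.\<close>
  let ?X = "{q. (tail Q a', a' # q) \<in> B}"
  have "finite ((\<lambda>(u, q). tl q) ` B)" using finite_B by simp
  then have fin: "finite ?X" by (rule finite_subset[rotated]) force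
  have "[] \<in> ?X" using ar_closed[OF a'] by simp
  then obtain p where p: "p \<in> ?X" "\<forall>q\<in>?X. length q \<le> length p"
    using Max_in[of "length ` ?X"] Max_ge[of "length ` ?X"] fin by (metis (no_types, lifting) empty_iff finite_imageI imageE image_eqI image_is_empty)
  interpret arrow_chain Q S A coef a'' a' a b p
    by unfold_locales (use assms p in auto)
  show ?thesis using ar_translate_T syzygy_translate syzygy_ker by blast
qed

lemma pred3_eq:
  assumes syz: "\<And>(M :: ('k, 'a) fgmod) T K L. \<lbrakk>cohen_macaulay A M; no_projective_summand A M;
      ar_translate A M T; syzygy A T K; syzygy A K L\<rbrakk> \<Longrightarrow> lmod_iso A L M"
    and dr: "Domain S = Range S" and chain: "(a, b) \<in> S" "(a', a) \<in> S" "(a'', a') \<in> S"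
  shows "a'' = b"
proof -
  obtain T K where "ar_translate A (mm (ar b)) T" "syzygy A T K" "syzygy A K (mm (ar a''))"
    using syzygy2_translate_ar[OF chain dr] by blast
  then have iso: "lmod_iso A (mm (ar a'')) (mm (ar b))"
    using syz cohen_macaulay_ar[OF dr] no_projective_summand_ar[OF chain(1)] chain(1) by blast
  \<comment> \<open>The arrow is recovered from its left ideal by means of a predecessor.\<close>
  obtain c where "(c, a'') \<in> S" using chain(3) dr by blast
  then show ?thesis using lmod_iso_ar_eq[OF iso] S_sub[OF chain(1)] by blast
qed

end

section \<open>Assembling the blocks\<close>

locale block_setup = gentle_relations Q S for Q :: "('v, 'e) pre_digraph" and S +
  assumes finite_B: "finite B"
    and dom_ran: "Domain S = Range S"
    and pred3: "\<And>a'' a' a b. (a'', a') \<in> S \<Longrightarrow> (a', a) \<in> S \<Longrightarrow> (a, b) \<in> S \<Longrightarrow> a'' = b"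
    and no_isolated: "\<And>v. v \<in> verts Q \<Longrightarrow> \<exists>a\<in>arcs Q. tail Q a = v \<or> head Q a = v"
begin

text \<open>Without a relation at the joint all powers of the closed path would be nonzero, against
  the finiteness of \<open>B\<close>.\<close>

lemma nz_cycle_relation:
  assumes p: "nz p" "p \<noteq> []" "head Q (last p) = tail Q (hd p)"
  shows "(last p, hd p) \<in> S"
proof (rule ccontr)
  assume n: "(last p, hd p) \<notin> S"
  have hd_p: "hd (concat (replicate (Suc n) p)) = hd p" for n using p(2) by simp
  have nz: "nz (concat (replicate (Suc n) p))" for n
  proof (induction n)
    case (Suc n)
    have "concat (replicate (Suc (Suc n)) p) = p @ concat (replicate (Suc n) p)" by simp
    then show ?case using Suc p n hd_p[of n] by (simp only: nz_append) simp
  qed (simp add: p)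
  have "hd p \<in> arcs Q" using p by (auto simp: nz_def)
  then have "(tail Q (hd p), concat (replicate (Suc n) p)) \<in> B" for n
    using nz[of n] hd_p[of n] tail_vert by (simp add: B_def)
  then have "range (\<lambda>n. (tail Q (hd p), concat (replicate (Suc n) p))) \<subseteq> B" by blast
  then have "finite (range (\<lambda>n. (tail Q (hd p), concat (replicate (Suc n) p))))"
    using finite_B by (rule finite_subset)
  moreover have "inj (\<lambda>n. (tail Q (hd p), concat (replicate (Suc n) p)))"
  proof (rule injI)
    fix i j assume "(tail Q (hd p), concat (replicate (Suc i) p)) = (tail Q (hd p), concat (replicate (Suc j) p))"
    then have "length (concat (replicate (Suc i) p)) = length (concat (replicate (Suc j) p))" by (metis prod.inject)
    then have "Suc i * length p = Suc j * length p" by (simp only: length_concat map_replicate sum_list_replicate of_nat_id)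
    then show "i = j" using p by simp
  qed
  ultimately show False using finite_imageD infinite_UNIV_nat by blast
qed

lemma loop_relation: "a \<in> arcs Q \<Longrightarrow> head Q a = tail Q a \<Longrightarrow> (a, a) \<in> S"
  using nz_cycle_relation[of "[a]"] by (simp add: nz_def)

lemma two_cycle_relation:
  assumes "a \<in> arcs Q" "b \<in> arcs Q" "head Q a = tail Q b" "head Q b = tail Q a"
  shows "(a, b) \<in> S \<or> (b, a) \<in> S"
  using nz_cycle_relation[of "[a, b]"] assms by (auto simp: nz_def)

text \<open>The successor permutation, extended by the identity to the arrows without relations.\<close>

definition \<sigma> :: "'e \<Rightarrow> 'e" where
  "\<sigma> c = (if c \<in> Domain S then (THE d. (c, d) \<in> S) else c)"

lemma sigma_eq: "(c, d) \<in> S \<Longrightarrow> \<sigma> c = d"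
  unfolding \<sigma>_def using S_succ by auto

lemma sigma_rel: "c \<in> Domain S \<Longrightarrow> (c, \<sigma> c) \<in> S"
  using sigma_eq by blast

lemma sigma_dom: "c \<in> Domain S \<Longrightarrow> \<sigma> c \<in> Domain S"
  using sigma_rel dom_ran by blast

lemma sigma_id: "c \<notin> Domain S \<Longrightarrow> \<sigma> c = c"
  by (simp add: \<sigma>_def)

lemma sigma3: "\<sigma> (\<sigma> (\<sigma> c)) = c"
proof (cases "c \<in> Domain S")
  case True
  then show ?thesis using pred3[OF sigma_rel sigma_rel sigma_rel, OF _ sigma_dom sigma_dom] sigma_dom by metis
qed (simp add: sigma_id)

lemma S_arcs: "c \<in> Domain S \<Longrightarrow> c \<in> arcs Q"
  using S_sub by blast

lemma sigma_arcs: "c \<in> arcs Q \<Longrightarrow> \<sigma> c \<in> arcs Q"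
  using sigma_dom sigma_id S_arcs by metis

lemma head_eq: "c \<in> Domain S \<Longrightarrow> head Q c = tail Q (\<sigma> c)"
  using S_sub[OF sigma_rel] by blast

text \<open>Equal tails would make c a loop, and a loop is its own successor.\<close>

lemma sigma_tail_ne:
  assumes "c \<in> Domain S" "\<sigma> c \<noteq> c" shows "tail Q (\<sigma> c) \<noteq> tail Q c"
  using assms loop_relation[of c] head_eq[of c] S_arcs sigma_eq by metis

lemma sigma_inj: "\<sigma> c = \<sigma> d \<Longrightarrow> c = d"
  by (metis sigma3)

lemma sigma_distinct:
  assumes "\<sigma> c \<noteq> c"
  shows "\<sigma> (\<sigma> c) \<noteq> \<sigma> c" "\<sigma> (\<sigma> c) \<noteq> c"
  using assms sigma_inj sigma3 by metis+

lemma sigma_tails_distinct: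
  assumes "c \<in> Domain S" "\<sigma> c \<noteq> c"
  shows "tail Q (\<sigma> c) \<noteq> tail Q c" "tail Q (\<sigma> (\<sigma> c)) \<noteq> tail Q (\<sigma> c)" "tail Q (\<sigma> (\<sigma> c)) \<noteq> tail Q c"
  using sigma_tail_ne[OF assms] sigma_tail_ne[of "\<sigma> c"] sigma_tail_ne[of "\<sigma> (\<sigma> c)"] sigma_distinct[OF assms(2)]
    sigma_dom[OF assms(1)] sigma_dom[OF sigma_dom[OF assms(1)]] sigma3[of c] by metis+

section \<open>Orbits of the successor permutation and the list of blocks\<close>

definition ty :: "'e \<Rightarrow> block" where
  "ty c = (if c \<notin> Domain S then Type_I else if \<sigma> c = c then Type_loop else Type_II)"

definition orbit :: "'e \<Rightarrow> 'e set" where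
  "orbit c = {c, \<sigma> c, \<sigma> (\<sigma> c)}"

text \<open>The choice depends only on the orbit as a set, so it is constant on orbits and singles
  out one arrow per block.\<close>

definition rep :: "'e \<Rightarrow> 'e" where
  "rep c = (SOME d. d \<in> orbit c)"

lemma orbit_eq: "d \<in> orbit c \<Longrightarrow> orbit d = orbit c"
  by (auto simp: orbit_def sigma3)

lemma rep_orbit: "rep c \<in> orbit c"
  unfolding rep_def by (rule someI[of _ c]) (simp add: orbit_def)

lemma rep_rep: "d \<in> orbit (rep c) \<Longrightarrow> rep d = rep c"
  using orbit_eq[OF rep_orbit, of c] orbit_eq[of d "rep c"] by (simp add: rep_def)

definition rs :: "'e list" where
  "rs = (SOME xs. set xs = rep ` arcs Q \<and> distinct xs)"

lemma rs: "set rs = rep ` arcs Q" "distinct rs"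
proof -
  have "set rs = rep ` arcs Q \<and> distinct rs"
    unfolding rs_def by (rule someI_ex) (rule finite_distinct_list, simp add: finite_arcs)
  then show "set rs = rep ` arcs Q" "distinct rs" by auto
qed

definition bs :: "block list" where "bs = map ty rs"

lemma length_bs [simp]: "length bs = length rs"
  by (simp add: bs_def)

lemma bs_nth: "i < length rs \<Longrightarrow> bs ! i = ty (rs ! i)"
  by (simp add: bs_def)

lemma rs_rep: "i < length rs \<Longrightarrow> d \<in> orbit (rs ! i) \<Longrightarrow> rep d = rs ! i"
  using nth_mem[of i rs] rs(1) rep_rep by auto

lemma rs_arcs: "i < length rs \<Longrightarrow> d \<in> orbit (rs ! i) \<Longrightarrow> d \<in> arcs Q"
proof -
  assume i: "i < length rs" "d \<in> orbit (rs ! i)"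
  then obtain c where "c \<in> arcs Q" "rs ! i = rep c" using nth_mem[of i rs] rs(1) by auto
  then have "d \<in> orbit c" using orbit_eq[OF rep_orbit] i by metis
  then show "d \<in> arcs Q" using \<open>c \<in> arcs Q\<close> sigma_arcs by (auto simp: orbit_def)
qed

lemma rs_inj: "i < length rs \<Longrightarrow> j < length rs \<Longrightarrow> d \<in> orbit (rs ! i) \<Longrightarrow> d \<in> orbit (rs ! j) \<Longrightarrow> i = j"
  using rs_rep[of i d] rs_rep[of j d] nth_eq_iff_index_eq[OF rs(2)] by metis

lemma rs_cover: "c \<in> arcs Q \<Longrightarrow> \<exists>i<length rs. c \<in> orbit (rs ! i)"
proof -
  assume c: "c \<in> arcs Q"
  then obtain i where i: "i < length rs" "rs ! i = rep c" using rs(1) by (metis imageI in_set_conv_nth)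
  have "c \<in> orbit (rep c)" using orbit_eq[OF rep_orbit, of c] by (auto simp: orbit_def)
  then show ?thesis using i by auto
qed

section \<open>Outlets and their matching\<close>

definition arr :: "nat \<times> nat \<Rightarrow> 'e" where
  "arr = (\<lambda>(i, j). (\<sigma> ^^ j) (rs ! i))"

text \<open>The vertex of \<open>Q\<close> where an outlet lands. As in \<open>block_quiver\<close>,
  outlet j is the tail of the arrow j; only outlet 1 of a type I block is a head.\<close>

definition pos :: "nat \<times> nat \<Rightarrow> 'v" where
  "pos = (\<lambda>(i, j). if bs ! i = Type_I \<and> j = 1 then head Q (rs ! i) else tail Q (arr (i, j)))"

text \<open>An arrow that touches the outlet and stands for its block when blocks at a vertex are
  counted.\<close>

definition outarc :: "nat \<times> nat \<Rightarrow> 'e" where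
  "outarc = (\<lambda>(i, j). if bs ! i = Type_I then rs ! i else arr (i, j))"

definition gm :: "((nat \<times> nat) \<times> (nat \<times> nat)) set" where
  "gm = {(x, y). x \<in> outlets bs \<and> y \<in> outlets bs \<and> x \<noteq> y \<and> pos x = pos y}"

lemma arr_simps [simp]: "arr (i, 0) = rs ! i" "arr (i, Suc 0) = \<sigma> (rs ! i)" "arr (i, 2) = \<sigma> (\<sigma> (rs ! i))"
  by (simp_all add: arr_def numeral_2_eq_2)

lemma block_cases:
  assumes "i < length rs"
  obtains (I) "bs ! i = Type_I" "rs ! i \<notin> Domain S" "\<sigma> (rs ! i) = rs ! i" "tail Q (rs ! i) \<noteq> head Q (rs ! i)"
  | (II) "bs ! i = Type_II" "rs ! i \<in> Domain S" "\<sigma> (rs ! i) \<noteq> rs ! i"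
  | (loop) "bs ! i = Type_loop" "rs ! i \<in> Domain S" "\<sigma> (rs ! i) = rs ! i"
proof -
  have a: "rs ! i \<in> arcs Q" by (rule rs_arcs[OF assms]) (simp add: orbit_def)
  have "rs ! i \<notin> Domain S \<Longrightarrow> tail Q (rs ! i) \<noteq> head Q (rs ! i)" using loop_relation[OF a] by auto
  then show ?thesis
    using that bs_nth[OF assms] sigma_id[of "rs ! i"] unfolding ty_def
    by (metis (full_types))
qed

lemma orbit_simps [simp]: "c \<in> orbit c" "\<sigma> c \<in> orbit c" "\<sigma> (\<sigma> c) \<in> orbit c"
  by (auto simp: orbit_def)

lemma outarc_props:
  assumes x: "(i, j) \<in> outlets bs"
  shows "outarc (i, j) \<in> orbit (rs ! i)" (is ?A)
    and "tail Q (outarc (i, j)) = pos (i, j) \<or> head Q (outarc (i, j)) = pos (i, j)" (is ?B)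
proof -
  have i: "i < length rs" and j: "j \<in> verts (block_quiver (bs ! i))" using x by (auto simp: outlets_def)
  have "?A \<and> ?B"
    using i by (cases rule: block_cases) (use j in \<open>auto simp: outarc_def pos_def\<close>)
  then show ?A ?B by auto
qed

text \<open>A type I arrow is no loop, since loops carry relations; the arrows of a 3-cycle have
  distinct tails.\<close>

lemma pos_inj_block:
  assumes "(i, j) \<in> outlets bs" "(i, j') \<in> outlets bs" "pos (i, j) = pos (i, j')"
  shows "j = j'"
proof -
  have i: "i < length rs" and j: "j \<in> verts (block_quiver (bs ! i))" "j' \<in> verts (block_quiver (bs ! i))"
    using assms by (auto simp: outlets_def)
  from i show ?thesis
  proof (cases rule: block_cases)
    case I
    then show ?thesis using j assms(3) by (auto simp: pos_def)
  next
    case II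
    then show ?thesis using j assms(3) sigma_tails_distinct[OF II(2,3)] by (auto simp: pos_def)
  next
    case loop
    then show ?thesis using j by simp
  qed
qed

lemma S_orbit: "(c, d) \<in> S \<Longrightarrow> c \<in> orbit r \<Longrightarrow> d \<in> orbit r"
  using sigma_eq[of c d] by (auto simp: orbit_def sigma3)

text \<open>Each of the three arrows represents a block at the vertex \<open>v\<close>.\<close>

lemma no_triple:
  assumes c: "c1 \<in> arcs Q" "c2 \<in> arcs Q" "c3 \<in> arcs Q"
    and v: "tail Q c1 = v \<or> head Q c1 = v" "tail Q c2 = v \<or> head Q c2 = v" "tail Q c3 = v \<or> head Q c3 = v"
    and ne: "c1 \<noteq> c2" "c1 \<noteq> c3" "c2 \<noteq> c3"
    and nS: "(c1, c2) \<notin> S" "(c1, c3) \<notin> S" "(c2, c1) \<notin> S" "(c2, c3) \<notin> S" "(c3, c1) \<notin> S" "(c3, c2) \<notin> S"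
  shows False
proof -
  have vv: "v \<in> verts Q" using c v tail_vert head_vert by metis
  have card3: "card {c1, c2, c3} = 3" using ne by simp
  have "\<not> (tail Q c1 = v \<and> tail Q c2 = v \<and> tail Q c3 = v)"
    using card_mono[of "{a \<in> arcs Q. tail Q a = v}" "{c1, c2, c3}"] out_deg[OF vv] finite_arcs card3 c by auto
  moreover have "\<not> (head Q c1 = v \<and> head Q c2 = v \<and> head Q c3 = v)"
    using card_mono[of "{a \<in> arcs Q. head Q a = v}" "{c1, c2, c3}"] in_deg[OF vv] finite_arcs card3 c by auto
  \<comment> \<open>If the three arrows do not all point the same way, one of them points against
    the other two and, without relations, composes to nonzero paths with both, contrary to
    (G4).\<close>
  moreover have "\<not> (head Q x = v \<and> tail Q y = v \<and> tail Q z = v)"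
    if "x \<in> arcs Q" "y \<in> arcs Q" "z \<in> arcs Q" "(x, y) \<notin> S" "(x, z) \<notin> S" "y \<noteq> z" for x y z
    using nS_succ[of x y z] that by auto
  note this[OF c(1,2,3) nS(1,2) ne(3)] this[OF c(2,1,3) nS(3,4) ne(2)] this[OF c(3,1,2) nS(5,6) ne(1)]
  moreover have "\<not> (tail Q x = v \<and> head Q y = v \<and> head Q z = v)"
    if "x \<in> arcs Q" "y \<in> arcs Q" "z \<in> arcs Q" "(y, x) \<notin> S" "(z, x) \<notin> S" "y \<noteq> z" for x y z
    using nS_pred[of y z x] that by auto
  note this[OF c(1,2,3) nS(3,5) ne(3)] this[OF c(2,1,3) nS(1,6) ne(2)] this[OF c(3,1,2) nS(2,4) ne(1)]
  ultimately show False using v by blast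
qed

lemma orbits_unrelated:
  assumes "i < length rs" "j < length rs" "i \<noteq> j" "c \<in> orbit (rs ! i)" "d \<in> orbit (rs ! j)"
  shows "c \<noteq> d" "(c, d) \<notin> S" "(d, c) \<notin> S"
  using assms rs_inj S_orbit by metis+

text \<open>Three outlets at one vertex would supply arrows of three different blocks there, and
  different blocks have no relations with each other.\<close>

lemma gm_single_valued: "single_valued gm"
proof (rule single_valuedI)
  fix x y z assume "(x, y) \<in> gm" "(x, z) \<in> gm"
  then have o: "x \<in> outlets bs" "y \<in> outlets bs" "z \<in> outlets bs" "x \<noteq> y" "x \<noteq> z" "pos y = pos x" "pos z = pos x"
    by (auto simp: gm_def)
  show "y = z"
  proof (rule ccontr)
    assume yz: "y \<noteq> z"
    obtain i1 j1 i2 j2 i3 j3 where e: "x = (i1, j1)" "y = (i2, j2)" "z = (i3, j3)" by (cases x, cases y, cases z)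
    have l: "i1 < length rs" "i2 < length rs" "i3 < length rs" using o e by (auto simp: outlets_def)
    have ne: "i1 \<noteq> i2" "i1 \<noteq> i3" "i2 \<noteq> i3" using o yz e pos_inj_block by metis+
    note p1 = outarc_props[OF o(1)[unfolded e]]
    note p2 = outarc_props[OF o(2)[unfolded e]]
    note p3 = outarc_props[OF o(3)[unfolded e]]
    show False
      by (rule no_triple[OF rs_arcs[OF l(1) p1(1)] rs_arcs[OF l(2) p2(1)] rs_arcs[OF l(3) p3(1)] p1(2)])
        (use p2(2) p3(2) o(6,7) e orbits_unrelated[OF l(1,2) ne(1) p1(1) p2(1)]
          orbits_unrelated[OF l(1,3) ne(2) p1(1) p3(1)] orbits_unrelated[OF l(2,3) ne(3) p2(1) p3(1)] in auto)
  qed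
qed

lemma gm_matching: "outlet_matching bs gm"
  unfolding outlet_matching_def
proof (intro conjI allI impI)
  show "gm \<subseteq> outlets bs \<times> outlets bs" "sym gm" by (auto simp: gm_def sym_def)
  show "single_valued gm" by (rule gm_single_valued)
  fix i j i' j' assume "((i, j), (i', j')) \<in> gm"
  then have o: "(i, j) \<in> outlets bs" "(i', j') \<in> outlets bs" "(i, j) \<noteq> (i', j')" "pos (i, j) = pos (i', j')"
    by (auto simp: gm_def)
  show ne: "i \<noteq> i'" using o pos_inj_block by metis
  have l: "i < length rs" "i' < length rs" using o by (auto simp: outlets_def)
  show "\<not> (bs ! i = Type_loop \<and> bs ! i' = Type_loop)"
  proof
    assume b: "bs ! i = Type_loop \<and> bs ! i' = Type_loop"
    have 1: "rs ! i \<in> Domain S" "\<sigma> (rs ! i) = rs ! i" using l(1) by (cases rule: block_cases; use b in simp)+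
    have 2: "rs ! i' \<in> Domain S" "\<sigma> (rs ! i') = rs ! i'" using l(2) by (cases rule: block_cases; use b in simp)+
    have "j = 0" "j' = 0" using o(1,2) b by (auto simp: outlets_def)
    then have "tail Q (rs ! i) = tail Q (rs ! i')" using o(4) b by (simp add: pos_def)
    \<comment> \<open>Two loops at one vertex form a closed path of length two, so one of their
      products is a relation; but relations stay within a block.\<close>
    then have "(rs ! i, rs ! i') \<in> S \<or> (rs ! i', rs ! i) \<in> S"
      using head_eq[OF 1(1)] head_eq[OF 2(1)] 1 2 S_arcs by (intro two_cycle_relation) auto
    then show False using orbits_unrelated[OF l ne, of "rs ! i" "rs ! i'"] by simp
  qed
qed

section \<open>The isomorphism between the glued quiver and the given one\<close>

lemma glued_vertex_eq: "x \<in> outlets bs \<Longrightarrow> glued_vertex gm x = {y \<in> outlets bs. pos y = pos x}"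
  by (auto simp: glued_vertex_def gm_def)

abbreviation "GQ \<equiv> glued_quiver bs gm"

text \<open>\<open>pos\<close> is constant on glued classes, so any member may be chosen.
  \<open>app_iso\<close> takes head and tail from the record; using those of \<open>Q\<close> gives
  equality of the functions even off the arrows.\<close>

definition hiso :: "((nat \<times> nat) set, nat \<times> nat, 'v, 'e) digraph_isomorphism" where
  "hiso = \<lparr>iso_verts = (\<lambda>X. pos (SOME x. x \<in> X)), iso_arcs = arr, iso_head = head Q, iso_tail = tail Q\<rparr>"

lemma iso_verts_glued: "x \<in> outlets bs \<Longrightarrow> iso_verts hiso (glued_vertex gm x) = pos x"
proof -
  assume x: "x \<in> outlets bs"
  have "(SOME y. y \<in> glued_vertex gm x) \<in> glued_vertex gm x"
    by (rule someI[of "\<lambda>y. y \<in> glued_vertex gm x" x]) (simp add: glued_vertex_def)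
  then show ?thesis using x by (simp add: hiso_def glued_vertex_eq)
qed

lemma glued_arc_cases:
  assumes "a \<in> arcs GQ"
  obtains i j where "a = (i, j)" "i < length rs" "j \<in> arcs (block_quiver (bs ! i))"
  using assms by (auto simp: glued_quiver_def)

lemma glued_arc_props:
  assumes a: "(i, j) \<in> arcs GQ"
  shows "(i, tail (block_quiver (bs ! i)) j) \<in> outlets bs" (is ?A)
    and "(i, head (block_quiver (bs ! i)) j) \<in> outlets bs" (is ?B)
    and "pos (i, tail (block_quiver (bs ! i)) j) = tail Q (arr (i, j))" (is ?C)
    and "pos (i, head (block_quiver (bs ! i)) j) = head Q (arr (i, j))" (is ?D)
    and "arr (i, j) \<in> orbit (rs ! i)" (is ?E)
proof -
  have i: "i < length rs" and j: "j \<in> arcs (block_quiver (bs ! i))" using a by (auto simp: glued_quiver_def)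
  have "?A \<and> ?B \<and> ?C \<and> ?D \<and> ?E"
    using i
  proof (cases rule: block_cases)
    case I
    then show ?thesis using i j by (auto simp: outlets_def pos_def)
  next
    case II
    have "head Q (rs ! i) = tail Q (\<sigma> (rs ! i))" "head Q (\<sigma> (rs ! i)) = tail Q (\<sigma> (\<sigma> (rs ! i)))"
      "head Q (\<sigma> (\<sigma> (rs ! i))) = tail Q (rs ! i)"
      using II(2) head_eq sigma_dom sigma3 by metis+
    then show ?thesis using II i j by (auto simp: outlets_def pos_def numeral_2_eq_2[symmetric])
  next
    case loop
    then show ?thesis using i j head_eq[OF loop(2)] by (auto simp: outlets_def pos_def)
  qed
  then show ?A ?B ?C ?D ?E by auto
qed

lemma arr_inj: "inj_on arr (arcs GQ)"
proof (rule inj_onI)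
  fix x y assume xy: "x \<in> arcs GQ" "y \<in> arcs GQ" "arr x = arr y"
  obtain i j where x: "x = (i, j)" "i < length rs" "j \<in> arcs (block_quiver (bs ! i))" using xy(1) by (rule glued_arc_cases)
  obtain i' j' where y: "y = (i', j')" "i' < length rs" "j' \<in> arcs (block_quiver (bs ! i'))" using xy(2) by (rule glued_arc_cases)
  have ii: "i = i'"
    using rs_inj[OF x(2) y(2)] glued_arc_props(5)[OF xy(1)[unfolded x]] glued_arc_props(5)[OF xy(2)[unfolded y]] xy(3) x y by metis
  from x(2) have "j = j'"
  proof (cases rule: block_cases)
    case II
    then show ?thesis using x y ii xy(3) sigma_distinct[OF II(3)] II(3) sigma_distinct[of "rs ! i"] by auto
  qed (use x y ii in auto)
  then show "x = y" using x y ii by simp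
qed

lemma arr_surj: "c \<in> arcs Q \<Longrightarrow> \<exists>x\<in>arcs GQ. arr x = c"
proof -
  assume "c \<in> arcs Q"
  then obtain i where i: "i < length rs" "c \<in> orbit (rs ! i)" using rs_cover by blast
  have mem: "(i, j) \<in> arcs GQ \<longleftrightarrow> j \<in> arcs (block_quiver (bs ! i))" for j using i by (simp add: glued_quiver_def)
  from i(1) show ?thesis
  proof (cases rule: block_cases)
    case I
    then show ?thesis using i mem by (intro bexI[of _ "(i, 0)"]) (auto simp: orbit_def)
  next
    case II
    consider "c = arr (i, 0)" | "c = arr (i, Suc 0)" | "c = arr (i, 2)" using i by (auto simp: orbit_def)
    then show ?thesis
    proof cases
      case 1 then show ?thesis using mem II by (intro bexI[of _ "(i, 0)"]) auto
    next
      case 2 then show ?thesis using mem II by (intro bexI[of _ "(i, Suc 0)"]) auto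
    next
      case 3 then show ?thesis using mem II by (intro bexI[of _ "(i, 2)"]) auto
    qed
  next
    case loop
    then show ?thesis using i mem by (intro bexI[of _ "(i, 0)"]) (auto simp: orbit_def)
  qed
qed

lemma glued_simps:
  "(i, j) \<in> arcs GQ \<Longrightarrow> tail GQ (i, j) = glued_vertex gm (i, tail (block_quiver (bs ! i)) j)"
  "(i, j) \<in> arcs GQ \<Longrightarrow> head GQ (i, j) = glued_vertex gm (i, head (block_quiver (bs ! i)) j)"
  "verts GQ = glued_vertex gm ` outlets bs"
  by (simp_all add: glued_quiver_def)

lemma iso_verts_inj: "inj_on (iso_verts hiso) (verts GQ)"
proof (rule inj_onI)
  fix X Y assume "X \<in> verts GQ" "Y \<in> verts GQ" and eq: "iso_verts hiso X = iso_verts hiso Y"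
  then obtain x y where xy: "x \<in> outlets bs" "X = glued_vertex gm x" "y \<in> outlets bs" "Y = glued_vertex gm y"
    by (auto simp only: glued_simps)
  then have "pos x = pos y" using eq by (simp only: iso_verts_glued)
  then show "X = Y" using xy by (simp only: glued_vertex_eq)
qed

lemma arr_arcs: "x \<in> arcs GQ \<Longrightarrow> arr x \<in> arcs Q"
  using glued_arc_props(5) rs_arcs by (metis glued_arc_cases)

lemma iso_ends:
  assumes "x \<in> arcs GQ"
  shows "tail GQ x \<in> verts GQ" (is ?A) and "head GQ x \<in> verts GQ" (is ?B)
    and "iso_verts hiso (tail GQ x) = tail Q (arr x)" (is ?C) and "iso_verts hiso (head GQ x) = head Q (arr x)" (is ?D)
proof -
  obtain i j where x: "x = (i, j)" by force
  note p = glued_arc_props[OF assms[unfolded x]]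
  show ?A ?B ?C ?D
    using p assms by (simp_all add: x glued_simps iso_verts_glued)
qed

lemma hiso_isomorphism: "pre_digraph.digraph_isomorphism GQ hiso"
  unfolding pre_digraph.digraph_isomorphism_def
proof (intro conjI ballI)
  show "wf_digraph GQ" by (rule wf_digraph.intro) (rule iso_ends, assumption)+
  show "inj_on (iso_arcs hiso) (arcs GQ)" using arr_inj by (simp add: hiso_def)
qed (use iso_verts_inj iso_ends in \<open>auto simp: hiso_def\<close>)

lemma hiso_app: "Q = app_iso hiso GQ"
proof (rule pre_digraph.equality)
  show "verts Q = verts (app_iso hiso GQ)"
  proof (intro equalityI subsetI)
    fix v assume "v \<in> verts Q"
    \<comment> \<open>The blocks cover arrows, so a vertex is reached through an arrow at
      it.\<close>
    then obtain c where c: "c \<in> arcs Q" "tail Q c = v \<or> head Q c = v" using no_isolated by blast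
    obtain x where x: "x \<in> arcs GQ" "arr x = c" using arr_surj[OF c(1)] by blast
    have "v = iso_verts hiso (tail GQ x) \<or> v = iso_verts hiso (head GQ x)" using iso_ends[OF x(1)] x(2) c(2) by auto
    then show "v \<in> verts (app_iso hiso GQ)" using iso_ends(1,2)[OF x(1)] unfolding verts_app_iso by blast
  next
    fix v assume "v \<in> verts (app_iso hiso GQ)"
    then obtain i j where x: "(i, j) \<in> outlets bs" "v = pos (i, j)" by (auto simp: glued_simps iso_verts_glued)
    then show "v \<in> verts Q"
      using outarc_props[OF x(1)] tail_vert[of "outarc (i, j)"] head_vert[of "outarc (i, j)"]
        rs_arcs[of i "outarc (i, j)"] x by (auto simp: outlets_def)
  qed
  show "arcs Q = arcs (app_iso hiso GQ)" using arr_surj arr_arcs by (force simp: hiso_def)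
qed (simp_all add: hiso_def)

text \<open>One of two opposite arrows would be the \<sigma>-successor of the other. The third arrow
  of the orbit would then start where the first one does, although the tails in a 3-cycle are
  distinct.\<close>

lemma no_opposite: "\<not> has_opposite_arrows GQ"
proof
  assume "has_opposite_arrows GQ"
  then obtain x y where xy: "x \<in> arcs GQ" "y \<in> arcs GQ" "tail GQ x \<noteq> head GQ x" "tail GQ y = head GQ x" "head GQ y = tail GQ x"
    unfolding has_opposite_arrows_def by blast
  define c d where "c = arr x" and "d = arr y"
  have cd: "c \<in> arcs Q" "d \<in> arcs Q" using arr_arcs xy by (auto simp: c_def d_def)
  have e: "head Q c = tail Q d" "head Q d = tail Q c" using iso_ends[OF xy(1)] iso_ends[OF xy(2)] xy by (metis c_def d_def)+
  have ne: "tail Q c \<noteq> head Q c"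
    using inj_onD[OF iso_verts_inj, of "tail GQ x" "head GQ x"] iso_ends[OF xy(1)] xy(3) by (auto simp: c_def)
  have *: False if "(c, d) \<in> S" "head Q d = tail Q c" "tail Q c \<noteq> head Q c" for c d
  proof -
    have c: "c \<in> Domain S" "d = \<sigma> c" using that sigma_eq by auto
    have "\<sigma> c \<noteq> c" using head_eq[OF c(1)] that by auto
    from sigma_tails_distinct(3)[OF c(1) this] show False using head_eq[OF sigma_dom[OF c(1)]] c that by simp
  qed
  from two_cycle_relation[OF cd e] show False using *[of c d] *[of d c] e ne by auto
qed

lemma glued_relations_image: "{(arr x, arr y) | x y. (x, y) \<in> glued_relations bs} = S"
proof (intro equalityI subrelI)
  fix c d assume "(c, d) \<in> {(arr x, arr y) | x y. (x, y) \<in> glued_relations bs}"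
  then obtain i j k where x: "c = arr (i, j)" "d = arr (i, k)" "i < length rs" "(j, k) \<in> block_relations (bs ! i)"
    by (auto simp: glued_relations_def)
  from x(3) show "(c, d) \<in> S"
  proof (cases rule: block_cases)
    case II
    then show ?thesis using x sigma_rel[of "rs ! i"] sigma_rel[of "\<sigma> (rs ! i)"] sigma_rel[of "\<sigma> (\<sigma> (rs ! i))"]
        sigma_dom sigma3 by auto
  next
    case loop
    then show ?thesis using x sigma_rel[of "rs ! i"] by auto
  qed (use x in auto)
next
  fix c d assume cd: "(c, d) \<in> S"
  have c: "c \<in> Domain S" "d = \<sigma> c" "c \<in> arcs Q" using cd sigma_eq S_sub by auto
  obtain i where i: "i < length rs" "c \<in> orbit (rs ! i)" using rs_cover[OF c(3)] by blast
  have rel: "(c, d) \<in> {(arr x, arr y) | x y. (x, y) \<in> glued_relations bs}"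
    if "(j, k) \<in> block_relations (bs ! i)" "c = arr (i, j)" "d = arr (i, k)" for j k
    using that i by (auto simp: glued_relations_def)
  from i(1) show "(c, d) \<in> {(arr x, arr y) | x y. (x, y) \<in> glued_relations bs}"
  proof (cases rule: block_cases)
    case I
    then show ?thesis using i c by (auto simp: orbit_def)
  next
    case II
    consider "c = rs ! i" | "c = \<sigma> (rs ! i)" | "c = \<sigma> (\<sigma> (rs ! i))" using i by (auto simp: orbit_def)
    then show ?thesis
      using rel[of 0 "Suc 0"] rel[of "Suc 0" 2] rel[of 2 0] II c by cases (auto simp: sigma3)
  next
    case loop
    then show ?thesis using rel[of 0 0] i c by (auto simp: orbit_def)
  qed
qed

lemma block_decomposable:
  assumes I: "I = genideal (path_algebra Q) {two_path Q a b | a b. (a, b) \<in> S}"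
  shows "gentle_block_decomposable Q (I :: ('v \<times> 'e list \<Rightarrow> 'k::field) set)"
proof -
  have rel: "(a, b) \<in> S \<longleftrightarrow> (\<exists>x y. a = arr x \<and> b = arr y \<and> (x, y) \<in> glued_relations bs)" for a b
    using glued_relations_image by blast
  have [simp]: "iso_arcs hiso = arr" by (simp add: hiso_def)
  have "{two_path Q a b | a b. (a, b) \<in> S} =
    {two_path Q (iso_arcs hiso a) (iso_arcs hiso b) | a b. (a, b) \<in> glued_relations bs}"
    using rel by (simp only: \<open>iso_arcs hiso = arr\<close>) blast
  then have "I = genideal (path_algebra Q)
    {two_path Q (iso_arcs hiso a) (iso_arcs hiso b) | a b. (a, b) \<in> glued_relations bs}"
    using I by (rule back_subst[of "\<lambda>X. I = genideal (path_algebra Q) X", rotated])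
  then show ?thesis
    unfolding gentle_block_decomposable_def
    using gm_matching no_opposite hiso_isomorphism hiso_app by blast
qed

end

section \<open>The bound quiver algebra\<close>

locale gentle_bound_quiver =
  fixes Q :: "('v, 'e) pre_digraph" and I :: "('v \<times> 'e list \<Rightarrow> 'k::field) set"
  assumes gentle: "gentle Q I"
begin

text \<open>All paths of length two in the ideal, not just a chosen generating set, since (G3) and
  (G4) speak of membership in the ideal.\<close>

definition S :: "('e \<times> 'e) set" where
  "S = {(a, b). a \<in> arcs Q \<and> b \<in> arcs Q \<and> head Q a = tail Q b \<and> two_path Q a b \<in> I}"

abbreviation R :: "('k, 'v \<times> 'e list \<Rightarrow> 'k) module" where "R \<equiv> path_algebra Q"

lemma fin_Q: "fin_digraph Q" and ideal_I: "ideal I R"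
  using gentle by (auto simp: gentle_def bound_quiver_def admissible_def)

sublocale Q: fin_digraph Q by (rule fin_Q)
sublocale I: ideal I R by (rule ideal_I)

sublocale quiver_relations Q S
  by unfold_locales (auto simp: S_def)

section \<open>Paths and factors of paths\<close>

lemma awlast_tgt: "Q.awlast u p = tgt u p"
  by (simp add: Q.awalk_verts_conv tgt_def)

lemma cas_iff: "(\<exists>v. Q.cas u p v) \<longleftrightarrow> successively (\<lambda>a b. head Q a = tail Q b) p \<and> (p \<noteq> [] \<longrightarrow> tail Q (hd p) = u)"
proof (induction p arbitrary: u)
  case (Cons a p)
  have "(\<exists>v. Q.cas u (a # p) v) \<longleftrightarrow> tail Q a = u \<and> (\<exists>v. Q.cas (head Q a) p v)" by simp
  then show ?case using Cons.IH[of "head Q a"] by (cases "p = []") (auto simp: successively_Cons)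
next
  case Nil
  have "Q.cas u [] u" by simp
  then have "\<exists>v. Q.cas u [] v" by (rule exI)
  then show ?case by simp
qed

lemma paths_iff: "(u, p) \<in> paths Q \<longleftrightarrow> u \<in> verts Q \<and> set p \<subseteq> arcs Q \<and>
    successively (\<lambda>a b. head Q a = tail Q b) p \<and> (p \<noteq> [] \<longrightarrow> tail Q (hd p) = u)"
  using cas_iff[of u p] by (auto simp: paths_def Q.awalk_def)

lemma B_paths: "B \<subseteq> paths Q"
proof (rule subrelI)
  fix u p assume "(u, p) \<in> B"
  then have B: "u \<in> verts Q" "set p \<subseteq> arcs Q" "p \<noteq> [] \<longrightarrow> tail Q (hd p) = u"
    "successively (\<lambda>a b. head Q a = tail Q b \<and> (a, b) \<notin> S) p" by (auto simp: B_def nz_def)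
  from B(4) have "successively (\<lambda>a b. head Q a = tail Q b) p" by (rule successively_mono) simp
  then show "(u, p) \<in> paths Q" using B by (simp add: paths_iff)
qed

lemma paths_append: "(u, p @ q) \<in> paths Q \<Longrightarrow> (u, p) \<in> paths Q \<and> (tgt u p, q) \<in> paths Q"
proof -
  assume pq: "(u, p @ q) \<in> paths Q"
  have lp: "p \<noteq> [] \<Longrightarrow> last p \<in> arcs Q" using pq last_in_set[of p] by (auto simp: paths_iff)
  show ?thesis
  proof (cases "p = [] \<or> q = []")
    case True
    moreover have "tgt u p \<in> verts Q" using pq head_vert[of "last p"] lp by (auto simp: paths_iff tgt_def)
    ultimately show ?thesis using pq by (auto simp: paths_iff)
  next
    case False
    then have "last p \<in> arcs Q" using lp by simp
    with False show ?thesis using pq head_vert[of "last p"] by (simp add: paths_iff successively_append_iff tgt_def)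
  qed
qed

lemma paths_not_B:
  assumes "(u, p) \<in> paths Q" "(u, p) \<notin> B"
  obtains r a b q where "p = r @ [a, b] @ q" "(a, b) \<in> S"
proof -
  have "\<not> successively (\<lambda>a b. (a, b) \<notin> S) p"
    using assms by (auto simp: paths_iff B_def nz_def successively_conv_nth)
  then obtain i where i: "Suc i < length p" "(p ! i, p ! Suc i) \<in> S" by (auto simp: successively_conv_nth)
  then have "p = take i p @ [p ! i, p ! Suc i] @ drop (Suc (Suc i)) p"
    by (simp add: Cons_nth_drop_Suc)
  then show ?thesis using that i by blast
qed

section \<open>The path algebra\<close>

lemma R_carrier: "f \<in> carrier R \<longleftrightarrow> finite {x. f x \<noteq> 0} \<and> {x. f x \<noteq> 0} \<subseteq> paths Q"
  by (simp add: path_algebra_def)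

lemma R_add: "f \<oplus>\<^bsub>R\<^esub> g = (\<lambda>x. f x + g x)"
  by (simp add: path_algebra_def)

lemma R_zero: "\<zero>\<^bsub>R\<^esub> = (\<lambda>_. 0)"
  by (simp add: path_algebra_def)

lemma R_mult: "(f \<otimes>\<^bsub>R\<^esub> g) (u, p) = (\<Sum>i\<le>length p. f (u, take i p) * g (tgt u (take i p), drop i p))"
  by (simp add: path_algebra_def awlast_tgt)

lemma R_one: "\<one>\<^bsub>R\<^esub> (u, p) = (if u \<in> verts Q \<and> p = [] then 1 else 0)"
  by (simp add: path_algebra_def)

lemma R_smult: "c \<odot>\<^bsub>R\<^esub> f = (\<lambda>x. c * f x)"
  by (simp add: path_algebra_def)

lemma path_elem_carrier: "(u, p) \<in> paths Q \<Longrightarrow> (\<lambda>x. c * path_elem u p x) \<in> carrier R"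
  by (auto simp: R_carrier path_elem_def intro: finite_subset[of _ "{(u, p)}"])

lemma path_elem_carrier1: "(u, p) \<in> paths Q \<Longrightarrow> path_elem u p \<in> carrier R"
  using path_elem_carrier[of u p 1] by simp

lemma path_elem_mult:
  assumes "tgt u p = w"
  shows "(\<lambda>x. c * path_elem u p x) \<otimes>\<^bsub>R\<^esub> path_elem w q = (\<lambda>x. c * path_elem u (p @ q) x)"
proof (rule ext, clarify)
  fix u' r
  have "c * path_elem u p (u', take i r) * path_elem w q (tgt u' (take i r), drop i r) =
    (if i = length p then c * path_elem u (p @ q) (u', r) else 0)" if i: "i \<le> length r" for i
  proof (cases "take i r = p \<and> drop i r = q \<and> u' = u")
    case True
    then have "i = length p" "r = p @ q" using i by auto
    then show ?thesis using True assms by (simp add: path_elem_def)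
  next
    case False
    then have "path_elem u p (u', take i r) = 0 \<or> path_elem w q (tgt u' (take i r), drop i r) = (0 :: 'k)"
      by (auto simp: path_elem_def)
    moreover have "path_elem u (p @ q) (u', r) = (0 :: 'k)" if "i = length p"
    proof -
      have "(u', r) \<noteq> (u, p @ q)" using False that by auto
      then show ?thesis by (simp only: path_elem_def if_False)
    qed
    ultimately show ?thesis by (simp only: mult_zero_left mult_zero_right split: if_split) auto
  qed
  then have "((\<lambda>x. c * path_elem u p x) \<otimes>\<^bsub>R\<^esub> path_elem w q) (u', r) =
     (\<Sum>i\<le>length r. if i = length p then c * path_elem u (p @ q) (u', r) else 0)"
    unfolding R_mult by (intro sum.cong) auto
  also have "\<dots> = c * path_elem u (p @ q) (u', r)" by (auto simp: path_elem_def)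
  finally show "((\<lambda>x. c * path_elem u p x) \<otimes>\<^bsub>R\<^esub> path_elem w q) (u', r) = c * path_elem u (p @ q) (u', r)" .
qed

lemma path_elem_mult1:
  assumes "tgt u p = w"
  shows "path_elem u p \<otimes>\<^bsub>R\<^esub> path_elem w q = path_elem u (p @ q)"
  using path_elem_mult[OF assms, of 1 q] by simp

abbreviation gens :: "('e \<times> 'e) set \<Rightarrow> ('v \<times> 'e list \<Rightarrow> 'k) set" where
  "gens X \<equiv> {two_path Q a b | a b. (a, b) \<in> X}"

lemma two_path_carrier: "(a, b) \<in> S \<Longrightarrow> two_path Q a b \<in> carrier R"
  using S_sub[of a b] by (auto simp: two_path_def paths_iff intro!: path_elem_carrier1)

text \<open>The generators provided by (G2) lie in \<open>S\<close>, and the paths of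
  \<open>S\<close> lie in the ideal, so both sets generate it.\<close>

lemma I_eq_genideal: "I = genideal R (gens S)"
proof -
  obtain S' where S': "S' \<subseteq> {(a, b). a \<in> arcs Q \<and> b \<in> arcs Q \<and> head Q a = tail Q b}"
    "I = genideal R (gens S')"
    using gentle unfolding gentle_def by (elim conjE exE) (rule that)
  have "gens S' \<subseteq> carrier R"
    using S'(1) by (auto simp: two_path_def paths_iff intro!: path_elem_carrier1)
  then have gI: "gens S' \<subseteq> I"
    using I.genideal_self[of "gens S'"] by (simp only: S'(2)[symmetric])
  have "S' \<subseteq> S"
  proof (rule subrelI)
    fix a b assume ab: "(a, b) \<in> S'"
    then have "two_path Q a b \<in> I" using gI by blast
    then show "(a, b) \<in> S" using ab S'(1) by (auto simp: S_def)
  qed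
  then have sub: "gens S' \<subseteq> gens S" by blast
  have "gens S \<subseteq> carrier R" using two_path_carrier by auto
  then have id: "ideal (genideal R (gens S)) R"
    and self: "gens S \<subseteq> genideal R (gens S)"
    using I.genideal_ideal[of "gens S"] I.genideal_self[of "gens S"]
    by simp_all
  show ?thesis
  proof
    show "I \<subseteq> genideal R (gens S)"
      using I.genideal_minimal[OF id subset_trans[OF sub self]] by (simp only: S'(2)[symmetric])
    show "genideal R (gens S) \<subseteq> I"
      by (rule I.genideal_minimal[OF ideal_I]) (auto simp: S_def)
  qed
qed

section \<open>The ideal in coordinates\<close>

definition Z :: "('v \<times> 'e list \<Rightarrow> 'k) set" where
  "Z = {f \<in> carrier R. \<forall>w\<in>B. f w = 0}"

text \<open>Both parts of a cut path of \<open>B\<close> are again in \<open>B\<close>, so every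
  term of the convolution has a vanishing factor.\<close>

lemma mult_Z:
  assumes "f \<in> carrier R" "g \<in> carrier R" "f \<in> Z \<or> g \<in> Z"
  shows "f \<otimes>\<^bsub>R\<^esub> g \<in> Z"
proof -
  have "(f \<otimes>\<^bsub>R\<^esub> g) (u, p) = 0" if "(u, p) \<in> B" for u p
    unfolding R_mult using assms(3) B_take_drop[OF that] by (intro sum.neutral) (auto simp: Z_def)
  then show ?thesis using assms by (auto simp: Z_def)
qed

lemma ideal_Z: "ideal Z R"
proof (rule idealI)
  show "ring R" by (rule ideal.axioms(2)[OF ideal_I])
  show "subgroup Z (add_monoid R)"
  proof (rule subgroup.intro)
    fix f assume f: "f \<in> Z"
    have "\<ominus>\<^bsub>R\<^esub> f = (\<lambda>x. - f x)"
      using f by (intro I.minus_equality) (auto simp: R_add R_zero Z_def R_carrier)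
    then have "\<ominus>\<^bsub>R\<^esub> f \<in> Z" using f by (auto simp: Z_def R_carrier)
    then show "inv\<^bsub>add_monoid R\<^esub> f \<in> Z" by (simp add: a_inv_def)
  next
    fix f g assume "f \<in> Z" "g \<in> Z"
    then have "f \<oplus>\<^bsub>R\<^esub> g \<in> carrier R" "\<forall>w\<in>B. (f \<oplus>\<^bsub>R\<^esub> g) w = 0"
      using I.add.m_closed[of f g] by (auto simp: Z_def) (simp add: R_add)
    then show "f \<otimes>\<^bsub>add_monoid R\<^esub> g \<in> Z" by (simp add: Z_def)
  next
    show "\<one>\<^bsub>add_monoid R\<^esub> \<in> Z" using I.zero_closed by (simp add: Z_def R_zero R_carrier)
  qed (auto simp: Z_def)
  fix f g assume "f \<in> Z" "g \<in> carrier R"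
  then show "g \<otimes>\<^bsub>R\<^esub> f \<in> Z" "f \<otimes>\<^bsub>R\<^esub> g \<in> Z" using mult_Z[of f g] mult_Z[of g f] by (auto simp: Z_def)
qed

lemma I_sub_Z: "I \<subseteq> Z"
proof -
  have "two_path Q a b \<in> Z" if "(a, b) \<in> S" for a b
  proof -
    have "(tail Q a, [a, b]) \<notin> B" using that by (auto simp: B_def nz_def)
    then show ?thesis using two_path_carrier[OF that] by (auto simp: Z_def two_path_def path_elem_def)
  qed
  then show ?thesis
    by (subst I_eq_genideal) (rule I.genideal_minimal[OF ideal_Z], auto)
qed

text \<open>Such a path contains a relation, and multiplying it by the two outer pieces stays in the
  ideal. The scalar is put into the left piece, because the ideal is a ring ideal.\<close>

lemma path_elem_in_I:
  assumes "(u, p) \<in> paths Q" "(u, p) \<notin> B" shows "(\<lambda>x. c * path_elem u p x) \<in> I"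
proof -
  obtain r a b q where p: "p = r @ [a, b] @ q" "(a, b) \<in> S" by (rule paths_not_B[OF assms])
  have c: "(u, r) \<in> paths Q" "(tgt u r, [a, b] @ q) \<in> paths Q" using assms(1) paths_append unfolding p by blast+
  then have t: "tgt u r = tail Q a" and q: "(head Q b, q) \<in> paths Q"
    using paths_append[of "tgt u r" "[a, b]" q] by (auto simp: paths_iff tgt_def)
  have "(\<lambda>x. c * path_elem u r x) \<otimes>\<^bsub>R\<^esub> two_path Q a b \<in> I"
    using p path_elem_carrier[OF c(1)] by (intro I.I_l_closed) (auto simp: S_def)
  then have "((\<lambda>x. c * path_elem u r x) \<otimes>\<^bsub>R\<^esub> two_path Q a b) \<otimes>\<^bsub>R\<^esub> path_elem (head Q b) q \<in> I"
    by (rule I.I_r_closed) (rule path_elem_carrier1[OF q])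
  also have "(\<lambda>x. c * path_elem u r x) \<otimes>\<^bsub>R\<^esub> two_path Q a b = (\<lambda>x. c * path_elem u (r @ [a, b]) x)"
    unfolding two_path_def by (rule path_elem_mult[OF t])
  also have "(\<lambda>x. c * path_elem u (r @ [a, b]) x) \<otimes>\<^bsub>R\<^esub> path_elem (head Q b) q = (\<lambda>x. c * path_elem u p x)"
    using path_elem_mult[of u "r @ [a, b]" "head Q b" c q] by (simp add: p tgt_def)
  finally show ?thesis .
qed

text \<open>Induction on the support: all its paths lie outside \<open>B\<close> and are split off
  one at a time.\<close>

lemma Z_sub_I: "Z \<subseteq> I"
proof
  fix f assume f: "f \<in> Z"
  have "finite X \<Longrightarrow> X \<subseteq> paths Q - B \<Longrightarrow> {x. f x \<noteq> 0} \<subseteq> X \<Longrightarrow> f \<in> I" for X f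
  proof (induction X arbitrary: f rule: finite_induct)
    case empty
    then have "f = \<zero>\<^bsub>R\<^esub>" by (auto simp: R_zero)
    then show ?case by (simp only: additive_subgroup.zero_closed[OF ideal.axioms(1)[OF ideal_I]])
  next
    case (insert w X)
    obtain u p where w: "w = (u, p)" by force
    have "f(w := 0) \<in> I" using insert.prems by (intro insert.IH) auto
    moreover have "(\<lambda>x. f w * path_elem u p x) \<in> I" using insert.prems w by (intro path_elem_in_I) auto
    ultimately have "f(w := 0) \<oplus>\<^bsub>R\<^esub> (\<lambda>x. f w * path_elem u p x) \<in> I" by (rule additive_subgroup.a_closed[OF ideal.axioms(1)[OF ideal_I]])
    moreover have "f(w := 0) \<oplus>\<^bsub>R\<^esub> (\<lambda>x. f w * path_elem u p x) = f" by (auto simp: R_add path_elem_def w)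
    ultimately show ?case by simp
  qed
  from this[of "{x. f x \<noteq> 0}" f] show "f \<in> I" using f by (auto simp: Z_def R_carrier)
qed

lemma I_iff: "f \<in> I \<longleftrightarrow> f \<in> carrier R \<and> (\<forall>w\<in>B. f w = 0)"
  using I_sub_Z Z_sub_I by (auto simp: Z_def)

lemma path_elem_power: "(u, p) \<in> paths Q \<Longrightarrow> n \<le> length p \<Longrightarrow> path_elem u p \<in> (arrow_ideal_power Q n :: ('v \<times> 'e list \<Rightarrow> 'k) set)"
proof (induction n arbitrary: u p)
  case 0
  then show ?case by (simp add: path_elem_carrier1)
next
  case (Suc n)
  then obtain a q where p: "p = a # q" by (cases p) auto
  have aq: "(u, [a] @ q) \<in> paths Q" using Suc.prems p by simp
  then have a: "u = tail Q a" "a \<in> arcs Q" by (auto simp: paths_iff)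
  have "path_elem (head Q a) q \<in> (arrow_ideal_power Q n :: ('v \<times> 'e list \<Rightarrow> 'k) set)"
    using paths_append[OF aq] Suc.prems p by (intro Suc.IH) auto
  moreover have "path_elem u [a] \<in> (arrow_ideal Q :: ('v \<times> 'e list \<Rightarrow> 'k) set)"
  proof -
    have "{path_elem (tail Q a) [a] | a. a \<in> arcs Q} \<subseteq> carrier R"
      by (auto simp: paths_iff intro!: path_elem_carrier1)
    from I.genideal_self[OF this] show ?thesis unfolding arrow_ideal_def using a by blast
  qed
  ultimately have "path_elem u [a] \<otimes>\<^bsub>R\<^esub> path_elem (head Q a) q \<in> arrow_ideal_power Q (Suc n)"
    by (simp add: ideal_prod.prod)
  then show ?case using path_elem_mult1[of u "[a]" "head Q a" q] p by (simp add: tgt_def)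
qed

text \<open>Admissibility puts all sufficiently long paths into the ideal, whereas elements of the
  ideal vanish on \<open>B\<close>.\<close>

lemma finite_B: "finite B"
proof -
  obtain m where m: "arrow_ideal_power Q m \<subseteq> I"
    using gentle by (auto simp: gentle_def bound_quiver_def admissible_def)
  have "length p \<le> m" if "(u, p) \<in> B" for u p
  proof (rule ccontr)
    assume "\<not> length p \<le> m"
    then have "path_elem u p \<in> (arrow_ideal_power Q m :: ('v \<times> 'e list \<Rightarrow> 'k) set)"
      using path_elem_power[OF subsetD[OF B_paths that]] by simp
    then have "path_elem u p \<in> I" by (rule subsetD[OF m])
    then have "path_elem u p (u, p) = (0 :: 'k)" using that unfolding I_iff by (rule conjunct2[THEN bspec])
    then show False by (simp add: path_elem_def)
  qed
  then have "B \<subseteq> verts Q \<times> {p. set p \<subseteq> arcs Q \<and> length p \<le> m}" by (auto simp: B_def nz_def)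
  moreover have "finite (verts Q \<times> {p. set p \<subseteq> arcs Q \<and> length p \<le> m})"
    by (intro finite_cartesian_product finite_lists_length_le) simp_all
  ultimately show ?thesis by (rule finite_subset)
qed

section \<open>The quotient algebra in coordinates\<close>

abbreviation "\<Lambda> \<equiv> bound_quiver_algebra Q I"

definition cl :: "('v \<times> 'e list \<Rightarrow> 'k) \<Rightarrow> ('v \<times> 'e list \<Rightarrow> 'k) set" where
  "cl f = I +>\<^bsub>R\<^esub> f"

text \<open>Meaningful on \<open>B\<close> only: elements of the ideal vanish there, so the value
  does not depend on the representative.\<close>

definition coef :: "('v \<times> 'e list \<Rightarrow> 'k) set \<Rightarrow> 'v \<times> 'e list \<Rightarrow> 'k" where
  "coef U w = (SOME f. f \<in> U) w"

lemma carrier_Lambda: "carrier \<Lambda> = cl ` carrier R"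
  by (auto simp: bound_quiver_algebra_def quot_def FactRing_def A_RCOSETS_def RCOSETS_def cl_def a_r_coset_def)

lemma cl_mem: "g \<in> cl f \<Longrightarrow> f \<in> carrier R \<Longrightarrow> g \<in> carrier R \<and> (\<forall>w\<in>B. g w = f w)"
proof -
  assume "g \<in> cl f" and f: "f \<in> carrier R"
  then obtain i where i: "i \<in> I" "g = i \<oplus>\<^bsub>R\<^esub> f"
    by (auto simp: cl_def a_r_coset_def r_coset_def)
  then have "g \<in> carrier R" using f I.add.m_closed[of i f] by (simp add: I_iff)
  then show ?thesis using i by (auto simp: I_iff R_add)
qed

lemma coef_cl:
  assumes "f \<in> carrier R" "w \<in> B" shows "coef (cl f) w = f w"
proof -
  have "f \<in> cl f" using I.a_rcos_self[OF assms(1)] by (simp add: cl_def)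
  then have "(SOME g. g \<in> cl f) \<in> cl f" by (rule someI[of "\<lambda>g. g \<in> cl f"])
  then show ?thesis using cl_mem assms by (simp add: coef_def)
qed

lemma cl_eqI:
  assumes "f \<in> carrier R" "g \<in> carrier R" "\<And>w. w \<in> B \<Longrightarrow> f w = g w"
  shows "cl f = cl g"
proof -
  have sub: "{x. f x - g x \<noteq> 0} \<subseteq> {x. f x \<noteq> 0} \<union> {x. g x \<noteq> 0}" by auto
  have f: "finite ({x. f x \<noteq> 0} \<union> {x. g x \<noteq> 0})" "{x. f x \<noteq> 0} \<union> {x. g x \<noteq> 0} \<subseteq> paths Q"
    using assms(1,2) by (simp_all add: R_carrier)
  have "(\<lambda>x. f x - g x) \<in> carrier R"
    unfolding R_carrier using finite_subset[OF sub f(1)] subset_trans[OF sub f(2)] by simp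
  then have "(\<lambda>x. f x - g x) \<in> I" using assms(3) by (simp add: I_iff)
  moreover have "f = (\<lambda>x. f x - g x) \<oplus>\<^bsub>R\<^esub> g" by (simp add: R_add)
  ultimately have "f \<in> I +>\<^bsub>R\<^esub> g" unfolding a_r_coset_def r_coset_def by auto
  then show ?thesis unfolding cl_def by (rule I.a_repr_independence'[OF _ assms(2), symmetric])
qed

lemma Lambda_add: "f \<in> carrier R \<Longrightarrow> g \<in> carrier R \<Longrightarrow> cl f \<oplus>\<^bsub>\<Lambda>\<^esub> cl g = cl (f \<oplus>\<^bsub>R\<^esub> g)"
  using I.a_rcos_sum by (simp add: bound_quiver_algebra_def quot_def FactRing_def cl_def)

lemma Lambda_mult: "f \<in> carrier R \<Longrightarrow> g \<in> carrier R \<Longrightarrow> cl f \<otimes>\<^bsub>\<Lambda>\<^esub> cl g = cl (f \<otimes>\<^bsub>R\<^esub> g)"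
  using I.rcoset_mult_add by (simp add: bound_quiver_algebra_def quot_def FactRing_def cl_def)

lemma Lambda_one: "\<one>\<^bsub>\<Lambda>\<^esub> = cl \<one>\<^bsub>R\<^esub>"
  by (simp add: bound_quiver_algebra_def quot_def FactRing_def cl_def)

lemma smult_carrier: "f \<in> carrier R \<Longrightarrow> c \<odot>\<^bsub>R\<^esub> f \<in> carrier R"
proof -
  assume f: "f \<in> carrier R"
  have "{x. c * f x \<noteq> 0} \<subseteq> {x. f x \<noteq> 0}" by auto
  then show ?thesis using f finite_subset subset_trans unfolding R_carrier R_smult by metis
qed

lemma Lambda_smult:
  assumes f: "f \<in> carrier R" shows "c \<odot>\<^bsub>\<Lambda>\<^esub> cl f = cl (c \<odot>\<^bsub>R\<^esub> f)"
proof -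
  have "cl (c \<odot>\<^bsub>R\<^esub> g) = cl (c \<odot>\<^bsub>R\<^esub> f)" if "g \<in> cl f" for g
    using cl_mem[OF that f] f by (intro cl_eqI smult_carrier) (auto simp: R_smult)
  then have "(\<Union>g\<in>cl f. cl (c \<odot>\<^bsub>R\<^esub> g)) = (\<Union>g\<in>cl f. cl (c \<odot>\<^bsub>R\<^esub> f))" by (rule SUP_cong[OF refl])
  also have "\<dots> = cl (c \<odot>\<^bsub>R\<^esub> f)" using I.a_rcos_self[OF f] by (auto simp: cl_def)
  finally show ?thesis by (simp add: bound_quiver_algebra_def quot_def cl_def)
qed

lemma ring_Lambda: "ring \<Lambda>"
proof -
  interpret L: ring "R Quot I" by (rule I.quotient_is_ring)
  have eq: "carrier \<Lambda> = carrier (R Quot I)" "mult \<Lambda> = mult (R Quot I)" "one \<Lambda> = one (R Quot I)"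
    "zero \<Lambda> = zero (R Quot I)" "add \<Lambda> = add (R Quot I)"
    by (simp_all add: bound_quiver_algebra_def quot_def)
  show ?thesis
  proof (rule ringI)
    show "abelian_group \<Lambda>"
    proof (rule abelian_groupI)
      fix x assume "x \<in> carrier \<Lambda>"
      then show "\<exists>y\<in>carrier \<Lambda>. y \<oplus>\<^bsub>\<Lambda>\<^esub> x = \<zero>\<^bsub>\<Lambda>\<^esub>"
        unfolding eq by (intro bexI[of _ "\<ominus>\<^bsub>R Quot I\<^esub> x"] L.l_neg L.a_inv_closed)
    qed (simp_all add: eq L.a_ac)
    show "monoid \<Lambda>" by (rule monoidI) (simp_all only: eq L.m_assoc L.m_closed L.one_closed L.l_one L.r_one)
  qed (simp_all only: eq L.l_distr L.r_distr)
qed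

lemma unique_of_card:
  assumes "card {a \<in> arcs Q. P a} \<le> 1" "a \<in> arcs Q" "b \<in> arcs Q" "P a" "P b" shows "a = b"
  using assms card_le_Suc0_iff_eq[of "{a \<in> arcs Q. P a}"] by auto

sublocale gentle_basis Q S \<Lambda> coef
proof (intro gentle_basis.intro path_basis.intro gentle_relations.intro path_basis_axioms.intro
    gentle_relations_axioms.intro quiver_relations_axioms ring_Lambda finite_B)
  fix x y assume "x \<in> carrier \<Lambda>" "y \<in> carrier \<Lambda>" and eq: "\<And>w. w \<in> B \<Longrightarrow> coef x w = coef y w"
  then obtain f g where fg: "f \<in> carrier R" "g \<in> carrier R" "x = cl f" "y = cl g" by (auto simp: carrier_Lambda)
  have "f w = g w" if "w \<in> B" for w
    using eq[OF that] fg that by (simp add: coef_cl)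
  then show "x = y" unfolding fg(3,4) by (rule cl_eqI[OF fg(1,2)])
next
  fix f :: "'v \<times> 'e list \<Rightarrow> 'k"
  have "(\<lambda>w. if w \<in> B then f w else 0) \<in> carrier R"
    using finite_B B_paths by (auto simp: R_carrier intro: finite_subset[of _ B])
  then show "\<exists>x\<in>carrier \<Lambda>. \<forall>w\<in>B. coef x w = f w"
    unfolding carrier_Lambda by (intro bexI[OF _ imageI]) (auto simp: coef_cl)
next
  fix x y w assume "x \<in> carrier \<Lambda>" "y \<in> carrier \<Lambda>" "w \<in> B"
  then show "coef (x \<oplus>\<^bsub>\<Lambda>\<^esub> y) w = coef x w + coef y w"
    using I.add.m_closed by (auto simp: carrier_Lambda Lambda_add coef_cl) (simp add: R_add)
next
  fix u p assume "(u, p) \<in> B"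
  then show "coef \<one>\<^bsub>\<Lambda>\<^esub> (u, p) = (if p = [] then 1 else 0)"
    by (auto simp: Lambda_one coef_cl R_one B_def)
next
  fix x y u p assume x: "x \<in> carrier \<Lambda>" "y \<in> carrier \<Lambda>" and B: "(u, p) \<in> B"
  then obtain f g where "f \<in> carrier R" "g \<in> carrier R" "x = cl f" "y = cl g" by (auto simp: carrier_Lambda)
  then show "coef (x \<otimes>\<^bsub>\<Lambda>\<^esub> y) (u, p) = (\<Sum>i\<le>length p. coef x (u, take i p) * coef y (tgt u (take i p), drop i p))"
    using B by (simp add: Lambda_mult coef_cl R_mult B_take_drop)
next
  fix t x assume "x \<in> carrier \<Lambda>"
  then show "t \<odot>\<^bsub>\<Lambda>\<^esub> x \<in> carrier \<Lambda>"
    by (auto simp: carrier_Lambda Lambda_smult smult_carrier)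
next
  fix t x w assume "x \<in> carrier \<Lambda>" "w \<in> B"
  then show "coef (t \<odot>\<^bsub>\<Lambda>\<^esub> x) w = t * coef x w"
    by (auto simp: carrier_Lambda Lambda_smult smult_carrier coef_cl) (simp add: R_smult)
next
  show "finite (arcs Q)" by simp
next
  fix a a' b assume "(a, b) \<in> S" "(a', b) \<in> S"
  then show "a = a'" using gentle
    by (intro unique_of_card[of "\<lambda>a. head Q a = tail Q b \<and> two_path Q a b \<in> I"]) (auto simp: gentle_def S_def)
next
  fix a b b' assume "(a, b) \<in> S" "(a, b') \<in> S"
  then show "b = b'" using gentle
    by (intro unique_of_card[of "\<lambda>b. head Q a = tail Q b \<and> two_path Q a b \<in> I"]) (auto simp: gentle_def S_def)
next
  fix a a' b assume "a \<in> arcs Q" "a' \<in> arcs Q" "b \<in> arcs Q" "head Q a = tail Q b" "head Q a' = tail Q b"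
    "(a, b) \<notin> S" "(a', b) \<notin> S"
  then show "a = a'" using gentle
    by (intro unique_of_card[of "\<lambda>a. head Q a = tail Q b \<and> two_path Q a b \<notin> I"]) (auto simp: gentle_def S_def)
next
  fix a b b' assume "a \<in> arcs Q" "b \<in> arcs Q" "b' \<in> arcs Q" "head Q a = tail Q b" "head Q a = tail Q b'"
    "(a, b) \<notin> S" "(a, b') \<notin> S"
  then show "b = b'" using gentle
    by (intro unique_of_card[of "\<lambda>b. head Q a = tail Q b \<and> two_path Q a b \<notin> I"]) (auto simp: gentle_def S_def)
next
  fix v assume "v \<in> verts Q"
  then show "card {a \<in> arcs Q. head Q a = v} \<le> 2" "card {a \<in> arcs Q. tail Q a = v} \<le> 2"
    using gentle by (auto simp: gentle_def)
qed

text \<open>Injective dimension at most one gives one inclusion. As a partial injection, the finite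
  relation has a domain and a range of equal size, so the inclusion is an equality.\<close>

lemma domain_eq_range:
  assumes "\<exists>d\<le>1. gorenstein \<Lambda> d" shows "Domain S = Range S"
proof -
  obtain d where d: "d \<le> 1" "inj_dim \<Lambda> (regular \<Lambda>) = enat d" using assms by (auto simp: gorenstein_def)
  let ?X = "{n. \<exists>J d e. inj_resolution \<Lambda> (regular \<Lambda>) J d e \<and> (\<forall>m>n. carrier (J m) = {\<zero>\<^bsub>J m\<^esub>})}"
  \<comment> \<open>A finite value of the infimum excludes the empty set, and a nonempty set of
    extended naturals attains its infimum.\<close>
  have ne: "enat ` ?X \<noteq> {}" and "(LEAST x. x \<in> enat ` ?X) = enat d"
    using d(2) by (auto simp: inj_dim_def Inf_enat_def split: if_splits)
  then have "enat d \<in> enat ` ?X" using LeastI_ex[of "\<lambda>x. x \<in> enat ` ?X"] by auto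
  then obtain J D e where J: "inj_resolution \<Lambda> (regular \<Lambda>) J D e" "\<And>m. m > d \<Longrightarrow> carrier (J m) = {\<zero>\<^bsub>J m\<^esub>}" by auto
  then have "\<And>m. m > 1 \<Longrightarrow> carrier (J m) = {\<zero>\<^bsub>J m\<^esub>}" using d(1) by auto
  from inj_dim_le_1_pred[OF J(1) this] have sub: "Domain S \<subseteq> Range S" by blast
  have fin: "finite S" by (rule finite_subset[of _ "arcs Q \<times> arcs Q"]) (auto simp: S_def)
  have "card (fst ` S) = card S" by (rule card_image) (auto simp: inj_on_def intro: S_succ)
  moreover have "card (snd ` S) = card S" by (rule card_image) (auto simp: inj_on_def intro: S_pred)
  ultimately have "fst ` S = snd ` S"
    using sub fin by (intro card_subset_eq) (auto simp: Domain_fst Range_snd)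
  then show ?thesis by (simp add: Domain_fst Range_snd)
qed

end

theorem theorem1:
  fixes Q :: "('v, 'e) pre_digraph"
    and I :: "('v \<times> 'e list \<Rightarrow> 'k::alg_closed_field) set"
  assumes gentle: "gentle Q I"
    and no_isolated_vertex: "\<forall>v\<in>verts Q. \<exists>a\<in>arcs Q. tail Q a = v \<or> head Q a = v"
    and gorenstein: "\<exists>d\<le>1. gorenstein (bound_quiver_algebra Q I) d"
    and syzygy2_tau: "\<forall>(M :: ('k, ('v \<times> 'e list \<Rightarrow> 'k) set) fgmod) T K L.
      cohen_macaulay (bound_quiver_algebra Q I) M \<and>
      no_projective_summand (bound_quiver_algebra Q I) M \<and>
      ar_translate (bound_quiver_algebra Q I) M T \<and>
      syzygy (bound_quiver_algebra Q I) T K \<and>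
      syzygy (bound_quiver_algebra Q I) K L \<longrightarrow>
      lmod_iso (bound_quiver_algebra Q I) L M"
  shows "gentle_block_decomposable Q I"
proof -
  interpret gentle_bound_quiver Q I by unfold_locales (rule gentle)
  have dr: "Domain S = Range S" by (rule domain_eq_range[OF gorenstein])
  interpret block_setup Q S
  proof (intro block_setup.intro block_setup_axioms.intro gentle_relations_axioms finite_B dr)
    fix a'' a' a b assume "(a'', a') \<in> S" "(a', a) \<in> S" "(a, b) \<in> S"
    then show "a'' = b" using syzygy2_tau by (intro pred3_eq[OF _ dr, of a b a' a'']) blast+
  qed (use no_isolated_vertex in blast)
  show ?thesis by (rule block_decomposable[OF I_eq_genideal])
qed

end
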